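(* Let $k$ be a field and $A$ a commutative $k$-algebra. The universal bimeasuring bialgebra construction $T\mapsto B(T,A)$ gives rise to a contravariant functor $B(\_,A)$ on the category of $k$-bialgebras that is adjoint to itself, i.e. there are bijections $\mathrm{Bialg}(T,B(N,A))\cong \mathrm{Bialg}(N,B(T,A))$, natural in the bialgebras $T$ and $N$. The functor restricts to the category of Hopf algebras.
   Context: All algebras are unital and associative over $k$; $\Delta(c)=c_1\otimes c_2$ is Sweedler notation. $\mathrm{Bialg}(X,Y)$ is the set of bialgebra maps $X\to Y$. Bimeasuring: for bialgebras $N,T$ and an algebra $A$, a linear map $\psi\colon N\otimes T\to A$ is a bimeasuring if $\psi(nm,t)=\psi(n,t_1)\psi(m,t_2)$, $\psi(1_N,t)=\varepsilon(t)1_A$, $\psi(n,ts)=\psi(n_1,t)\psi(n_2,s)$, $\psi(n,1_T)=\varepsilon(n)1_A$ for all $n,m\in N$, $t,s\in T$. Universal bimeasuring bialgebra: $B(T,A)$ is a bialgebra equipped with a bimeasuring $\theta_T\colon B(T,A)\otimes T\to A$ such that for every bialgebra $N$ and every bimeasuring $f\colon N\otimes T\to A$ there is a unique bialgebra map $\overline f\colon N\to B(T,A)$ with $f=\theta_T(\overline f\otimes 1)$. For $A$ commutative it exists for every bialgebra $T$: its underlying coalgebra is Sweedler's universal measuring coalgebra $M(T,A)$ with its universal measuring $\theta_T$. (Here a measuring $\psi\colon C\otimes T\to A$, $C$ a coalgebra, is a linear map with $\psi(c,tt')=\psi(c_1,t)\psi(c_2,t')$ and $\psi(c,1)=\varepsilon(c)1_A$,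 and $M(T,A)$ with $\theta_T$ is universal in the sense that each measuring $f\colon C\otimes T\to A$ is $\theta_T(\overline f\otimes 1)$ for a unique coalgebra map $\overline f\colon C\to M(T,A)$.) The functor sends a bialgebra map $\alpha\colon R\to T$ to the unique bialgebra map $B(\alpha,A)\colon B(T,A)\to B(R,A)$ with $\theta_R(B(\alpha,A)\otimes 1)=\theta_T(1\otimes\alpha)$. *)

theory Defs
  imports "HOL-Algebra.Module" "HOL-Library.FuncSet"
begin

text \<open>
  The library locale algebra is restricted to commutative algebras; bialgebras need not be commutative.
\<close>

definition k_algebra :: "'k ring \<Rightarrow> ('k, 'a, 'm) module_scheme \<Rightarrow> bool" where
  "k_algebra K A \<longleftrightarrow> module K A \<and> ring A \<and>
    (\<forall>c\<in>carrier K. \<forall>x\<in>carrier A. \<forall>y\<in>carrier A.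
      (c \<odot>\<^bsub>A\<^esub> x) \<otimes>\<^bsub>A\<^esub> y = c \<odot>\<^bsub>A\<^esub> (x \<otimes>\<^bsub>A\<^esub> y) \<and>
      x \<otimes>\<^bsub>A\<^esub> (c \<odot>\<^bsub>A\<^esub> y) = c \<odot>\<^bsub>A\<^esub> (x \<otimes>\<^bsub>A\<^esub> y))"

definition linear_map ::
    "'k ring \<Rightarrow> ('k, 'a, 'm) module_scheme \<Rightarrow> ('k, 'b, 'n) module_scheme \<Rightarrow> ('a \<Rightarrow> 'b) \<Rightarrow> bool" where
  "linear_map K M N f \<longleftrightarrow> f \<in> carrier M \<rightarrow> carrier N \<and>
    (\<forall>x\<in>carrier M. \<forall>y\<in>carrier M. f (x \<oplus>\<^bsub>M\<^esub> y) = f x \<oplus>\<^bsub>N\<^esub> f y) \<and>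
    (\<forall>c\<in>carrier K. \<forall>x\<in>carrier M. f (c \<odot>\<^bsub>M\<^esub> x) = c \<odot>\<^bsub>N\<^esub> f x)"

definition list_sum :: "('a, 'm) ring_scheme \<Rightarrow> 'a list \<Rightarrow> 'a" where
  "list_sum M xs = foldr (\<lambda>x y. x \<oplus>\<^bsub>M\<^esub> y) xs \<zero>\<^bsub>M\<^esub>"

text \<open>
  The library has no tensor products of modules. A list of pairs [(a1, b1), ..., (an, bn)] stands for
  the formal sum of the ai \<otimes> bi. The tensor product of M and N is the set of such lists
  (with entries in the carriers) modulo the congruence below, that is, the free commutative monoid
  on the pairs modulo the bilinearity relations; it is a group since (-a) \<otimes> b is inverse
  to a \<otimes> b. Triples give the threefold tensor product in the same way.
\<close>

inductive tensor_eq ::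
    "'k ring \<Rightarrow> ('k, 'a, 'm) module_scheme \<Rightarrow> ('k, 'b, 'n) module_scheme
      \<Rightarrow> ('a \<times> 'b) list \<Rightarrow> ('a \<times> 'b) list \<Rightarrow> bool"
  for K :: "'k ring" and M :: "('k, 'a, 'm) module_scheme" and N :: "('k, 'b, 'n) module_scheme"
where
  refl: "set xs \<subseteq> carrier M \<times> carrier N \<Longrightarrow> tensor_eq K M N xs xs"
| sym: "tensor_eq K M N xs ys \<Longrightarrow> tensor_eq K M N ys xs"
| trans: "tensor_eq K M N xs ys \<Longrightarrow> tensor_eq K M N ys zs \<Longrightarrow> tensor_eq K M N xs zs"
| append: "tensor_eq K M N xs xs' \<Longrightarrow> tensor_eq K M N ys ys' \<Longrightarrow>
    tensor_eq K M N (xs @ ys) (xs' @ ys')"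
| comm: "set xs \<subseteq> carrier M \<times> carrier N \<Longrightarrow> set ys \<subseteq> carrier M \<times> carrier N \<Longrightarrow>
    tensor_eq K M N (xs @ ys) (ys @ xs)"
| zero: "b \<in> carrier N \<Longrightarrow> tensor_eq K M N [(\<zero>\<^bsub>M\<^esub>, b)] []"
| add_left: "a \<in> carrier M \<Longrightarrow> a' \<in> carrier M \<Longrightarrow> b \<in> carrier N \<Longrightarrow>
    tensor_eq K M N [(a \<oplus>\<^bsub>M\<^esub> a', b)] [(a, b), (a', b)]"
| add_right: "a \<in> carrier M \<Longrightarrow> b \<in> carrier N \<Longrightarrow> b' \<in> carrier N \<Longrightarrow>
    tensor_eq K M N [(a, b \<oplus>\<^bsub>N\<^esub> b')] [(a, b), (a, b')]"
| smult: "c \<in> carrier K \<Longrightarrow> a \<in> carrier M \<Longrightarrow> b \<in> carrier N \<Longrightarrow>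
    tensor_eq K M N [(c \<odot>\<^bsub>M\<^esub> a, b)] [(a, c \<odot>\<^bsub>N\<^esub> b)]"

inductive tensor3_eq ::
    "'k ring \<Rightarrow> ('k, 'a, 'm) module_scheme
      \<Rightarrow> ('a \<times> 'a \<times> 'a) list \<Rightarrow> ('a \<times> 'a \<times> 'a) list \<Rightarrow> bool"
  for K :: "'k ring" and M :: "('k, 'a, 'm) module_scheme"
where
  refl: "set xs \<subseteq> carrier M \<times> carrier M \<times> carrier M \<Longrightarrow> tensor3_eq K M xs xs"
| sym: "tensor3_eq K M xs ys \<Longrightarrow> tensor3_eq K M ys xs"
| trans: "tensor3_eq K M xs ys \<Longrightarrow> tensor3_eq K M ys zs \<Longrightarrow> tensor3_eq K M xs zs"
| append: "tensor3_eq K M xs xs' \<Longrightarrow> tensor3_eq K M ys ys' \<Longrightarrow>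
    tensor3_eq K M (xs @ ys) (xs' @ ys')"
| comm: "set xs \<subseteq> carrier M \<times> carrier M \<times> carrier M \<Longrightarrow>
    set ys \<subseteq> carrier M \<times> carrier M \<times> carrier M \<Longrightarrow>
    tensor3_eq K M (xs @ ys) (ys @ xs)"
| zero: "b \<in> carrier M \<Longrightarrow> c \<in> carrier M \<Longrightarrow> tensor3_eq K M [(\<zero>\<^bsub>M\<^esub>, b, c)] []"
| add1: "a \<in> carrier M \<Longrightarrow> a' \<in> carrier M \<Longrightarrow> b \<in> carrier M \<Longrightarrow> c \<in> carrier M \<Longrightarrow>
    tensor3_eq K M [(a \<oplus>\<^bsub>M\<^esub> a', b, c)] [(a, b, c), (a', b, c)]"
| add2: "a \<in> carrier M \<Longrightarrow> b \<in> carrier M \<Longrightarrow> b' \<in> carrier M \<Longrightarrow> c \<in> carrier M \<Longrightarrow>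
    tensor3_eq K M [(a, b \<oplus>\<^bsub>M\<^esub> b', c)] [(a, b, c), (a, b', c)]"
| add3: "a \<in> carrier M \<Longrightarrow> b \<in> carrier M \<Longrightarrow> c \<in> carrier M \<Longrightarrow> c' \<in> carrier M \<Longrightarrow>
    tensor3_eq K M [(a, b, c \<oplus>\<^bsub>M\<^esub> c')] [(a, b, c), (a, b, c')]"
| smult12: "r \<in> carrier K \<Longrightarrow> a \<in> carrier M \<Longrightarrow> b \<in> carrier M \<Longrightarrow> c \<in> carrier M \<Longrightarrow>
    tensor3_eq K M [(r \<odot>\<^bsub>M\<^esub> a, b, c)] [(a, r \<odot>\<^bsub>M\<^esub> b, c)]"
| smult23: "r \<in> carrier K \<Longrightarrow> a \<in> carrier M \<Longrightarrow> b \<in> carrier M \<Longrightarrow> c \<in> carrier M \<Longrightarrow>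
    tensor3_eq K M [(a, r \<odot>\<^bsub>M\<^esub> b, c)] [(a, b, r \<odot>\<^bsub>M\<^esub> c)]"

text \<open>
  The comultiplication is a linear map into the tensor square, recorded by a representing formal sum:
  the pairs (c1, c2) in the list comult c are the summands of the Sweedler notation. All axioms are
  stated modulo equality of tensors, so they do not depend on the representatives.
\<close>

record ('k, 'a) bialg = "('k, 'a) module" +
  comult :: "'a \<Rightarrow> ('a \<times> 'a) list"
  counit :: "'a \<Rightarrow> 'k"

definition coalgebra :: "'k ring \<Rightarrow> ('k, 'a) bialg \<Rightarrow> bool" where
  "coalgebra K C \<longleftrightarrow> module K C \<and>
    (\<forall>x\<in>carrier C. set (comult C x) \<subseteq> carrier C \<times> carrier C) \<and>
    (\<forall>x\<in>carrier C. \<forall>y\<in>carrier C.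
      tensor_eq K C C (comult C (x \<oplus>\<^bsub>C\<^esub> y)) (comult C x @ comult C y)) \<and>
    (\<forall>c\<in>carrier K. \<forall>x\<in>carrier C.
      tensor_eq K C C (comult C (c \<odot>\<^bsub>C\<^esub> x))
        (map (\<lambda>(x1, x2). (c \<odot>\<^bsub>C\<^esub> x1, x2)) (comult C x))) \<and>
    (\<forall>x\<in>carrier C. counit C x \<in> carrier K) \<and>
    (\<forall>x\<in>carrier C. \<forall>y\<in>carrier C. counit C (x \<oplus>\<^bsub>C\<^esub> y) = counit C x \<oplus>\<^bsub>K\<^esub> counit C y) \<and>
    (\<forall>c\<in>carrier K. \<forall>x\<in>carrier C. counit C (c \<odot>\<^bsub>C\<^esub> x) = c \<otimes>\<^bsub>K\<^esub> counit C x) \<and>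
    (\<forall>x\<in>carrier C. tensor3_eq K C
      (concat (map (\<lambda>(x1, x2). map (\<lambda>(y1, y2). (y1, y2, x2)) (comult C x1)) (comult C x)))
      (concat (map (\<lambda>(x1, x2). map (\<lambda>(y1, y2). (x1, y1, y2)) (comult C x2)) (comult C x)))) \<and>
    (\<forall>x\<in>carrier C.
      list_sum C (map (\<lambda>(x1, x2). counit C x1 \<odot>\<^bsub>C\<^esub> x2) (comult C x)) = x \<and>
      list_sum C (map (\<lambda>(x1, x2). counit C x2 \<odot>\<^bsub>C\<^esub> x1) (comult C x)) = x)"

definition bialgebra :: "'k ring \<Rightarrow> ('k, 'a) bialg \<Rightarrow> bool" where
  "bialgebra K H \<longleftrightarrow> k_algebra K H \<and> coalgebra K H \<and>
    (\<forall>x\<in>carrier H. \<forall>y\<in>carrier H. tensor_eq K H H (comult H (x \<otimes>\<^bsub>H\<^esub> y))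
      (concat (map (\<lambda>(x1, x2). map (\<lambda>(y1, y2). (x1 \<otimes>\<^bsub>H\<^esub> y1, x2 \<otimes>\<^bsub>H\<^esub> y2)) (comult H y))
        (comult H x)))) \<and>
    tensor_eq K H H (comult H \<one>\<^bsub>H\<^esub>) [(\<one>\<^bsub>H\<^esub>, \<one>\<^bsub>H\<^esub>)] \<and>
    (\<forall>x\<in>carrier H. \<forall>y\<in>carrier H. counit H (x \<otimes>\<^bsub>H\<^esub> y) = counit H x \<otimes>\<^bsub>K\<^esub> counit H y) \<and>
    counit H \<one>\<^bsub>H\<^esub> = \<one>\<^bsub>K\<^esub>"

text \<open>
  Maps are extensional (undefined off the carrier), so that equality of maps is equality of functions.
\<close>

definition Bialg :: "'k ring \<Rightarrow> ('k, 'a) bialg \<Rightarrow> ('k, 'b) bialg \<Rightarrow> ('a \<Rightarrow> 'b) set" where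
  "Bialg K X Y = {f \<in> ring_hom X Y. f \<in> extensional (carrier X) \<and> linear_map K X Y f \<and>
    (\<forall>x\<in>carrier X. tensor_eq K Y Y (comult Y (f x)) (map (map_prod f f) (comult X x))) \<and>
    (\<forall>x\<in>carrier X. counit Y (f x) = counit X x)}"

definition antipode :: "'k ring \<Rightarrow> ('k, 'a) bialg \<Rightarrow> ('a \<Rightarrow> 'a) \<Rightarrow> bool" where
  "antipode K H S \<longleftrightarrow> linear_map K H H S \<and>
    (\<forall>x\<in>carrier H.
      list_sum H (map (\<lambda>(x1, x2). S x1 \<otimes>\<^bsub>H\<^esub> x2) (comult H x)) = counit H x \<odot>\<^bsub>H\<^esub> \<one>\<^bsub>H\<^esub> \<and>
      list_sum H (map (\<lambda>(x1, x2). x1 \<otimes>\<^bsub>H\<^esub> S x2) (comult H x)) = counit H x \<odot>\<^bsub>H\<^esub> \<one>\<^bsub>H\<^esub>)"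

definition hopf_algebra :: "'k ring \<Rightarrow> ('k, 'a) bialg \<Rightarrow> bool" where
  "hopf_algebra K H \<longleftrightarrow> bialgebra K H \<and> (\<exists>S. antipode K H S)"

definition Hopf :: "'k ring \<Rightarrow> ('k, 'a) bialg \<Rightarrow> ('k, 'b) bialg \<Rightarrow> ('a \<Rightarrow> 'b) set" where
  "Hopf K X Y = {f \<in> Bialg K X Y. \<forall>S S'. antipode K X S \<longrightarrow> antipode K Y S' \<longrightarrow>
    (\<forall>x\<in>carrier X. f (S x) = S' (f x))}"

text \<open>
  A linear map on a tensor product N \<otimes> T is given as a bilinear map, in curried form.
\<close>

definition bimeasuring ::
    "'k ring \<Rightarrow> ('k, 'n) bialg \<Rightarrow> ('k, 't) bialg \<Rightarrow> ('k, 'a) module \<Rightarrow> ('n \<Rightarrow> 't \<Rightarrow> 'a) \<Rightarrow> bool" where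
  "bimeasuring K N T A \<psi> \<longleftrightarrow>
    (\<forall>n\<in>carrier N. linear_map K T A (\<psi> n)) \<and>
    (\<forall>t\<in>carrier T. linear_map K N A (\<lambda>n. \<psi> n t)) \<and>
    (\<forall>n\<in>carrier N. \<forall>m\<in>carrier N. \<forall>t\<in>carrier T.
      \<psi> (n \<otimes>\<^bsub>N\<^esub> m) t = list_sum A (map (\<lambda>(t1, t2). \<psi> n t1 \<otimes>\<^bsub>A\<^esub> \<psi> m t2) (comult T t))) \<and>
    (\<forall>t\<in>carrier T. \<psi> \<one>\<^bsub>N\<^esub> t = counit T t \<odot>\<^bsub>A\<^esub> \<one>\<^bsub>A\<^esub>) \<and>
    (\<forall>n\<in>carrier N. \<forall>t\<in>carrier T. \<forall>s\<in>carrier T.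
      \<psi> n (t \<otimes>\<^bsub>T\<^esub> s) = list_sum A (map (\<lambda>(n1, n2). \<psi> n1 t \<otimes>\<^bsub>A\<^esub> \<psi> n2 s) (comult N n))) \<and>
    (\<forall>n\<in>carrier N. \<psi> n \<one>\<^bsub>T\<^esub> = counit N n \<odot>\<^bsub>A\<^esub> \<one>\<^bsub>A\<^esub>)"

text \<open>
  The universal property with respect to all bialgebras N whose carrier lies in the type passed as
  first argument: a formula cannot quantify over types.
\<close>

definition universal_bimeasuring ::
    "'n itself \<Rightarrow> 'k ring \<Rightarrow> ('k, 'a) module \<Rightarrow> ('k, 't) bialg \<Rightarrow> ('k, 'b) bialg
      \<Rightarrow> ('b \<Rightarrow> 't \<Rightarrow> 'a) \<Rightarrow> bool" where
  "universal_bimeasuring (_ :: 'n itself) K A T B \<theta> \<longleftrightarrow>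
    bialgebra K B \<and> bimeasuring K B T A \<theta> \<and>
    (\<forall>(N :: ('k, 'n) bialg) f. bialgebra K N \<longrightarrow> bimeasuring K N T A f \<longrightarrow>
      (\<exists>!g. g \<in> Bialg K N B \<and> (\<forall>n\<in>carrier N. \<forall>t\<in>carrier T. f n t = \<theta> (g n) t)))"

text \<open>
  A type large enough to carry B(T, A): an element x of the universal measuring coalgebra is
  determined by the scalars \<phi>1(\<theta>(x1, t1)) ... \<phi>n(\<theta>(xn, tn)) for all words of
  pairs (ti, \<phi>i) with ti in T and \<phi>i a linear form on A. Universality among the bialgebras
  carried by this type pins down B(T, A) up to isomorphism; that the result is universal among
  bialgebras carried by any type is a theorem, not part of the definition.
\<close>

type_synonym ('k, 't, 'a) univ_carrier = "('t \<times> ('a \<Rightarrow> 'k)) list \<Rightarrow> 'k"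

definition univ_pair ::
    "'k ring \<Rightarrow> ('k, 'a) module \<Rightarrow> ('k, 't) bialg
      \<Rightarrow> ('k, ('k, 't, 'a) univ_carrier) bialg \<times> (('k, 't, 'a) univ_carrier \<Rightarrow> 't \<Rightarrow> 'a)" where
  "univ_pair K A T =
    (SOME (B, \<theta>). universal_bimeasuring TYPE(('k, 't, 'a) univ_carrier) K A T B \<theta>)"

definition univ_bialg ::
    "'k ring \<Rightarrow> ('k, 'a) module \<Rightarrow> ('k, 't) bialg \<Rightarrow> ('k, ('k, 't, 'a) univ_carrier) bialg" where
  "univ_bialg K A T = fst (univ_pair K A T)"

definition univ_theta ::
    "'k ring \<Rightarrow> ('k, 'a) module \<Rightarrow> ('k, 't) bialg \<Rightarrow> ('k, 't, 'a) univ_carrier \<Rightarrow> 't \<Rightarrow> 'a" where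
  "univ_theta K A T = snd (univ_pair K A T)"

definition bimeasuring_lift ::
    "'k ring \<Rightarrow> ('k, 'a) module \<Rightarrow> ('k, 'n) bialg \<Rightarrow> ('k, 't) bialg \<Rightarrow> ('n \<Rightarrow> 't \<Rightarrow> 'a)
      \<Rightarrow> 'n \<Rightarrow> ('k, 't, 'a) univ_carrier" where
  "bimeasuring_lift K A N T f = (THE g. g \<in> Bialg K N (univ_bialg K A T) \<and>
    (\<forall>n\<in>carrier N. \<forall>t\<in>carrier T. f n t = univ_theta K A T (g n) t))"

definition univ_bialg_map ::
    "'k ring \<Rightarrow> ('k, 'a) module \<Rightarrow> ('k, 'r) bialg \<Rightarrow> ('k, 't) bialg \<Rightarrow> ('r \<Rightarrow> 't)
      \<Rightarrow> ('k, 't, 'a) univ_carrier \<Rightarrow> ('k, 'r, 'a) univ_carrier" where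
  "univ_bialg_map K A R T \<alpha> =
    bimeasuring_lift K A (univ_bialg K A T) R (\<lambda>b r. univ_theta K A T b (\<alpha> r))"

text \<open>
  For f : T \<rightarrow> B(N, A), the map (n, t) \<mapsto> \<theta>(f t, n) is a bimeasuring on
  N \<otimes> T because A is commutative and the bimeasuring axioms are symmetric in N and T; it
  corresponds to a map N \<rightarrow> B(T, A).
\<close>

definition adjoint_transpose ::
    "'k ring \<Rightarrow> ('k, 'a) module \<Rightarrow> ('k, 't) bialg \<Rightarrow> ('k, 'n) bialg
      \<Rightarrow> ('t \<Rightarrow> ('k, 'n, 'a) univ_carrier) \<Rightarrow> 'n \<Rightarrow> ('k, 't, 'a) univ_carrier" where
  "adjoint_transpose K A T N f =
    bimeasuring_lift K A N T (\<lambda>n t. univ_theta K A N (f t) n)"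

end

theory Submission imports Defs begin

text \<open>
  Everything rests on a concrete model of \<open>B(T, A)\<close>. An element \<open>x\<close> of a coalgebra that measures \<open>T\<close>
  to \<open>A\<close> by \<open>\<theta>\<close> gives a function on words in the letters \<open>(t, \<phi>)\<close>, where \<open>t \<in> T\<close> and \<open>\<phi>\<close> is
  a linear form on \<open>A\<close>: its value at \<open>(t1, \<phi>1) \<dots> (tn, \<phi>n)\<close> is \<open>\<phi>1(\<theta>(x1, t1)) \<dots> \<phi>n(\<theta>(xn, tn))\<close>.
  Coassociativity turns concatenation of words into the comultiplication: \<open>x(uv) = x1(u) x2(v)\<close>.
  Conversely, let \<open>U\<close> be the largest set of functions \<open>y\<close> on words such that \<open>y(uv)\<close> is a finite sum
  of products \<open>a(u) b(v)\<close> with \<open>a, b\<close> again in \<open>U\<close>, the values of \<open>y\<close> at the letters \<open>(t, \<phi>)\<close> have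
  the form \<open>\<phi>(\<theta>(y, t))\<close> with \<open>\<theta>(y, t)\<close> in \<open>A\<close>, and \<open>\<theta>\<close> obeys the measuring identities. Evaluations at
  words separate the points of \<open>U\<close>, and a separating family of linear forms detects equality of
  tensors (\<open>tensor_eqI_separating\<close>, \<open>tensor3_eqI_separating\<close>). So each axiom of a coalgebra or
  bialgebra for \<open>U\<close> is checked by evaluating at words, where it becomes associativity of
  concatenation or an induction along the word.

  Two tools produce and compare maps into \<open>U\<close>. A measuring \<open>f\<close> of a coalgebra \<open>N\<close> lifts to
  \<open>N \<rightarrow> U\<close> by sending a word to the convolution product of the functionals \<open>\<phi>(f(_, t))\<close>
  (\<open>word_lift\<close>, \<open>measuring_lift\<close>); and two maps into \<open>U\<close> that split in the same way, with the same
  \<open>\<theta>\<close> and the same counit, are equal, by induction along words (\<open>word_maps_eqI\<close>). The product of \<open>U\<close> is the lift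
  of \<open>(x, y, t) \<mapsto> \<theta>(x, t1) \<theta>(y, t2)\<close>, which is a measuring because \<open>A\<close> is commutative
  (\<open>theta_product_mult\<close>). Universality among all bialgebras follows (\<open>universal_bimeasuring_B\<close>), with
  carriers in any type; a pair that is universal only for carriers in one large type is
  isomorphic to this model, hence universal for all types (\<open>univ_universal\<close>).

  The self-adjunction is then formal: the bimeasuring axioms are symmetric in the two bialgebras
  (\<open>bimeasuring_swap\<close>), so both \<open>Bialg(T, B(N, A))\<close> and \<open>Bialg(N, B(T, A))\<close> are the set of
  bimeasurings of \<open>N\<close> and \<open>T\<close> in \<open>A\<close>, and all naturality statements follow from uniqueness.

  If \<open>T\<close> has an antipode \<open>S\<close>, then \<open>(b, t) \<mapsto> \<theta>(b, S t)\<close> measures along the opposite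
  comultiplication of \<open>U\<close>, since \<open>S\<close> reverses products and \<open>A\<close> is commutative. Its lift \<open>g\<close> is an
  antipode: at a word of length \<open>n\<close>, the convolution of \<open>g\<close> with the identity is a product over
  \<open>2n\<close> Sweedler components that collapses from the middle, one letter at a time (\<open>antipode_B\<close>).
\<close>

section \<open>Sums over formal tensors\<close>

abbreviation tsum :: "('v, 'm) ring_scheme \<Rightarrow> ('a \<times> 'b) list \<Rightarrow> ('a \<Rightarrow> 'b \<Rightarrow> 'v) \<Rightarrow> 'v" where
  "tsum V xs F \<equiv> list_sum V (map (\<lambda>(a, b). F a b) xs)"

lemma list_sum_Nil [simp]: "list_sum V [] = \<zero>\<^bsub>V\<^esub>"
  and list_sum_Cons [simp]: "list_sum V (x # xs) = x \<oplus>\<^bsub>V\<^esub> list_sum V xs"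
  by (simp_all add: list_sum_def)

lemma tsum_cong:
  "(\<And>a b. (a, b) \<in> set xs \<Longrightarrow> F a b = F' a b) \<Longrightarrow> tsum V xs F = tsum V xs F'"
  by (rule arg_cong[where f = "list_sum V"]) auto

lemma tsum_map: "tsum V (map (\<lambda>(a, b). (f a b, g a b)) xs) F = tsum V xs (\<lambda>a b. F (f a b) (g a b))"
  by (simp add: comp_def case_prod_unfold)

lemma tsum_map_prod: "tsum V (map (map_prod f g) xs) F = tsum V xs (\<lambda>a b. F (f a) (g b))"
  by (simp add: comp_def case_prod_unfold)

context abelian_monoid
begin

lemma list_sum_closed: "set xs \<subseteq> carrier G \<Longrightarrow> list_sum G xs \<in> carrier G"
  by (induction xs) auto

lemma tsum_closed [intro]:
  "(\<And>a b. (a, b) \<in> set xs \<Longrightarrow> F a b \<in> carrier G) \<Longrightarrow> tsum G xs F \<in> carrier G"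
  by (rule list_sum_closed) auto

lemma list_sum_append:
  "set xs \<subseteq> carrier G \<Longrightarrow> set ys \<subseteq> carrier G \<Longrightarrow>
    list_sum G (xs @ ys) = list_sum G xs \<oplus> list_sum G ys"
  by (induction xs) (auto simp: a_assoc list_sum_closed)

lemma tsum_append:
  assumes "\<And>a b. (a, b) \<in> set xs \<Longrightarrow> F a b \<in> carrier G" "\<And>a b. (a, b) \<in> set ys \<Longrightarrow> F a b \<in> carrier G"
  shows "tsum G (xs @ ys) F = tsum G xs F \<oplus> tsum G ys F"
  unfolding map_append by (rule list_sum_append) (use assms in auto)

lemma tsum_zero: "tsum G xs (\<lambda>a b. \<zero>) = \<zero>"
  by (induction xs) auto

lemma tsum_add:
  assumes "\<And>a b. (a, b) \<in> set xs \<Longrightarrow> F a b \<in> carrier G" "\<And>a b. (a, b) \<in> set xs \<Longrightarrow> F' a b \<in> carrier G"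
  shows "tsum G xs (\<lambda>a b. F a b \<oplus> F' a b) = tsum G xs F \<oplus> tsum G xs F'"
  using assms
proof (induction xs)
  case (Cons p xs)
  obtain a b where p: "p = (a, b)" by (cases p)
  have c: "F a b \<in> carrier G" "F' a b \<in> carrier G" "tsum G xs F \<in> carrier G" "tsum G xs F' \<in> carrier G"
    using Cons.prems p by (auto intro!: tsum_closed)
  have "tsum G xs (\<lambda>a b. F a b \<oplus> F' a b) = tsum G xs F \<oplus> tsum G xs F'"
    by (rule Cons.IH) (use Cons.prems in auto)
  then show ?case using c by (simp add: p a_ac)
qed auto

lemma tsum_swap:
  assumes "\<And>a b c d. (a, b) \<in> set xs \<Longrightarrow> (c, d) \<in> set ys \<Longrightarrow> F a b c d \<in> carrier G"
  shows "tsum G xs (\<lambda>a b. tsum G ys (F a b)) = tsum G ys (\<lambda>c d. tsum G xs (\<lambda>a b. F a b c d))"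
  using assms
proof (induction xs)
  case Nil
  show ?case using tsum_zero[of ys] by (simp add: case_prod_unfold)
next
  case (Cons p xs)
  obtain a b where p: "p = (a, b)" by (cases p)
  have "tsum G ys (\<lambda>c d. F a b c d \<oplus> tsum G xs (\<lambda>a b. F a b c d)) =
      tsum G ys (F a b) \<oplus> tsum G ys (\<lambda>c d. tsum G xs (\<lambda>a b. F a b c d))"
    by (rule tsum_add) (use Cons.prems p in \<open>auto intro!: tsum_closed\<close>)
  moreover have "tsum G xs (\<lambda>a b. tsum G ys (F a b)) = tsum G ys (\<lambda>c d. tsum G xs (\<lambda>a b. F a b c d))"
    by (rule Cons.IH) (use Cons.prems in auto)
  ultimately show ?case by (simp add: p)
qed

lemma tsum_concat:
  assumes "\<And>a b c d. (a, b) \<in> set xs \<Longrightarrow> (c, d) \<in> set (ys a b) \<Longrightarrow> F c d \<in> carrier G"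
  shows "tsum G (concat (map (\<lambda>(a, b). ys a b) xs)) F = tsum G xs (\<lambda>a b. tsum G (ys a b) F)"
  using assms
proof (induction xs)
  case (Cons p xs)
  obtain a b where p: "p = (a, b)" by (cases p)
  have "tsum G (ys a b @ concat (map (\<lambda>(a, b). ys a b) xs)) F =
      tsum G (ys a b) F \<oplus> tsum G (concat (map (\<lambda>(a, b). ys a b) xs)) F"
    by (rule tsum_append) (use Cons.prems p in \<open>auto; blast\<close>)+
  moreover have "tsum G (concat (map (\<lambda>(a, b). ys a b) xs)) F = tsum G xs (\<lambda>a b. tsum G (ys a b) F)"
    by (rule Cons.IH) (use Cons.prems in auto)
  ultimately show ?case by (simp add: p)
qed auto

end

lemma additive_tsum:
  assumes "abelian_monoid V" "h \<zero>\<^bsub>V\<^esub> = \<zero>\<^bsub>W\<^esub>"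
    and "\<And>x y. x \<in> carrier V \<Longrightarrow> y \<in> carrier V \<Longrightarrow> h (x \<oplus>\<^bsub>V\<^esub> y) = h x \<oplus>\<^bsub>W\<^esub> h y"
    and "\<And>a b. (a, b) \<in> set xs \<Longrightarrow> F a b \<in> carrier V"
  shows "h (tsum V xs F) = tsum W xs (\<lambda>a b. h (F a b))"
  using assms(4)
proof (induction xs)
  case (Cons p xs)
  obtain a b where p: "p = (a, b)" by (cases p)
  have "tsum V xs F \<in> carrier V" "F a b \<in> carrier V"
    using Cons.prems p by (auto intro!: abelian_monoid.tsum_closed[OF assms(1)])
  then show ?case using Cons by (simp add: p assms(3))
qed (simp add: assms(2))

lemma (in ring) tsum_l_distr:
  assumes "\<And>a b. (a, b) \<in> set xs \<Longrightarrow> F a b \<in> carrier R" "r \<in> carrier R"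
  shows "tsum R xs F \<otimes> r = tsum R xs (\<lambda>a b. F a b \<otimes> r)"
  by (rule additive_tsum[where h = "\<lambda>x. x \<otimes> r"])
    (use assms in \<open>auto simp: l_distr intro: abelian_monoid_axioms\<close>)

lemma (in ring) tsum_r_distr:
  assumes "\<And>a b. (a, b) \<in> set xs \<Longrightarrow> F a b \<in> carrier R" "r \<in> carrier R"
  shows "r \<otimes> tsum R xs F = tsum R xs (\<lambda>a b. r \<otimes> F a b)"
  by (rule additive_tsum[where h = "\<lambda>x. r \<otimes> x"])
    (use assms in \<open>auto simp: r_distr intro: abelian_monoid_axioms\<close>)

lemma (in ring) tsum_mult:
  assumes "\<And>a b. (a, b) \<in> set xs \<Longrightarrow> F a b \<in> carrier R" "\<And>a b. (a, b) \<in> set ys \<Longrightarrow> G a b \<in> carrier R"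
  shows "tsum R xs F \<otimes> tsum R ys G = tsum R xs (\<lambda>a b. tsum R ys (\<lambda>c d. F a b \<otimes> G c d))"
proof -
  have "tsum R xs F \<otimes> tsum R ys G = tsum R xs (\<lambda>a b. F a b \<otimes> tsum R ys G)"
    by (rule tsum_l_distr) (use assms in \<open>auto intro!: tsum_closed\<close>)
  also have "\<dots> = tsum R xs (\<lambda>a b. tsum R ys (\<lambda>c d. F a b \<otimes> G c d))"
    by (rule tsum_cong, rule tsum_r_distr) (use assms in auto)
  finally show ?thesis .
qed

section \<open>Linear, bilinear and trilinear maps\<close>

lemma linear_mapI:
  assumes "\<And>x. x \<in> carrier M \<Longrightarrow> f x \<in> carrier N"
    and "\<And>x y. x \<in> carrier M \<Longrightarrow> y \<in> carrier M \<Longrightarrow> f (x \<oplus>\<^bsub>M\<^esub> y) = f x \<oplus>\<^bsub>N\<^esub> f y"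
    and "\<And>c x. c \<in> carrier K \<Longrightarrow> x \<in> carrier M \<Longrightarrow> f (c \<odot>\<^bsub>M\<^esub> x) = c \<odot>\<^bsub>N\<^esub> f x"
  shows "linear_map K M N f"
  using assms by (auto simp: linear_map_def)

lemma linear_mapD:
  assumes "linear_map K M N f"
  shows "x \<in> carrier M \<Longrightarrow> f x \<in> carrier N"
    and "x \<in> carrier M \<Longrightarrow> y \<in> carrier M \<Longrightarrow> f (x \<oplus>\<^bsub>M\<^esub> y) = f x \<oplus>\<^bsub>N\<^esub> f y"
    and "c \<in> carrier K \<Longrightarrow> x \<in> carrier M \<Longrightarrow> f (c \<odot>\<^bsub>M\<^esub> x) = c \<odot>\<^bsub>N\<^esub> f x"
  using assms by (auto simp: linear_map_def)

lemma linear_map_cong: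
  assumes "module K M" "\<And>x. x \<in> carrier M \<Longrightarrow> f x = g x"
  shows "linear_map K M N f = linear_map K M N g"
proof -
  interpret M: module K M by fact
  show ?thesis using assms(2) by (auto simp: linear_map_def Pi_iff)
qed

lemma linear_map_zero:
  assumes "module K M" "module K N" "linear_map K M N f"
  shows "f \<zero>\<^bsub>M\<^esub> = \<zero>\<^bsub>N\<^esub>"
proof -
  interpret M: module K M by fact
  interpret N: module K N by fact
  have "f (\<zero>\<^bsub>K\<^esub> \<odot>\<^bsub>M\<^esub> \<zero>\<^bsub>M\<^esub>) = \<zero>\<^bsub>K\<^esub> \<odot>\<^bsub>N\<^esub> f \<zero>\<^bsub>M\<^esub>"
    using linear_mapD(3)[OF assms(3)] by blast
  then show ?thesis using linear_mapD(1)[OF assms(3)] by simp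
qed

lemma linear_map_tsum:
  assumes "module K M" "module K N" "linear_map K M N f"
    and "\<And>a b. (a, b) \<in> set xs \<Longrightarrow> F a b \<in> carrier M"
  shows "f (tsum M xs F) = tsum N xs (\<lambda>a b. f (F a b))"
proof -
  interpret M: module K M by fact
  show ?thesis
    by (rule additive_tsum) (use linear_map_zero[OF assms(1-3)] linear_mapD[OF assms(3)] assms(4) in
      \<open>auto intro: M.abelian_monoid_axioms\<close>)
qed

lemma linear_map_comp:
  "linear_map K M N f \<Longrightarrow> linear_map K N P g \<Longrightarrow> linear_map K M P (\<lambda>x. g (f x))"
  by (auto simp: linear_map_def Pi_iff)

lemma linear_map_ident: "linear_map K M M (\<lambda>x. x)"
  by (auto simp: linear_map_def)

lemma (in module) tsum_smult:
  assumes "c \<in> carrier R" "\<And>a b. (a, b) \<in> set xs \<Longrightarrow> F a b \<in> carrier M"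
  shows "c \<odot>\<^bsub>M\<^esub> tsum M xs F = tsum M xs (\<lambda>a b. c \<odot>\<^bsub>M\<^esub> F a b)"
  by (rule additive_tsum[where h = "\<lambda>x. c \<odot>\<^bsub>M\<^esub> x"])
    (use assms in \<open>auto simp: smult_r_distr intro: M.abelian_monoid_axioms\<close>)

lemma linear_map_sum:
  assumes "module K N" "\<And>a b. (a, b) \<in> set xs \<Longrightarrow> linear_map K M N (\<lambda>x. F x a b)"
  shows "linear_map K M N (\<lambda>x. tsum N xs (F x))"
proof -
  interpret N: module K N by fact
  show ?thesis
  proof (rule linear_mapI, goal_cases)
    case (1 x)
    then show ?case using linear_mapD(1)[OF assms(2)] by (auto intro!: N.tsum_closed)
  next
    case (2 x y)
    have "tsum N xs (F (x \<oplus>\<^bsub>M\<^esub> y)) = tsum N xs (\<lambda>a b. F x a b \<oplus>\<^bsub>N\<^esub> F y a b)"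
      by (rule tsum_cong) (use linear_mapD(2)[OF assms(2)] 2 in auto)
    then show ?case using linear_mapD(1)[OF assms(2)] 2 by (simp add: N.tsum_add)
  next
    case (3 c x)
    have "tsum N xs (F (c \<odot>\<^bsub>M\<^esub> x)) = tsum N xs (\<lambda>a b. c \<odot>\<^bsub>N\<^esub> F x a b)"
      by (rule tsum_cong) (use linear_mapD(3)[OF assms(2)] 3 in auto)
    then show ?case using linear_mapD(1)[OF assms(2)] 3 by (simp add: N.tsum_smult)
  qed
qed

definition bilinear ::
    "'k ring \<Rightarrow> ('k, 'a, 'm) module_scheme \<Rightarrow> ('k, 'b, 'n) module_scheme \<Rightarrow> ('k, 'v, 'o) module_scheme
      \<Rightarrow> ('a \<Rightarrow> 'b \<Rightarrow> 'v) \<Rightarrow> bool" where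
  "bilinear K M N V F \<longleftrightarrow>
    (\<forall>a\<in>carrier M. linear_map K N V (F a)) \<and> (\<forall>b\<in>carrier N. linear_map K M V (\<lambda>a. F a b))"

lemma bilinearI:
  "(\<And>a. a \<in> carrier M \<Longrightarrow> linear_map K N V (F a)) \<Longrightarrow>
   (\<And>b. b \<in> carrier N \<Longrightarrow> linear_map K M V (\<lambda>a. F a b)) \<Longrightarrow> bilinear K M N V F"
  by (simp add: bilinear_def)

lemma bilinearD:
  assumes "bilinear K M N V F"
  shows "a \<in> carrier M \<Longrightarrow> linear_map K N V (F a)"
    and "b \<in> carrier N \<Longrightarrow> linear_map K M V (\<lambda>a. F a b)"
    and "a \<in> carrier M \<Longrightarrow> b \<in> carrier N \<Longrightarrow> F a b \<in> carrier V"
  using assms linear_mapD(1)[of K N V "F a" b] by (auto simp: bilinear_def)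

lemma linear_map_bilinear_comp:
  assumes "bilinear K M N V F" "linear_map K V W g"
  shows "bilinear K M N W (\<lambda>x y. g (F x y))"
  by (rule bilinearI) (fact linear_map_comp[OF bilinearD(1)[OF assms(1)] assms(2)]
    linear_map_comp[OF bilinearD(2)[OF assms(1)] assms(2)])+

lemma tensor_eq_set:
  assumes "tensor_eq K M N xs ys" "module K M" "module K N"
  shows "set xs \<subseteq> carrier M \<times> carrier N \<and> set ys \<subseteq> carrier M \<times> carrier N"
proof -
  interpret M: module K M by fact
  interpret N: module K N by fact
  show ?thesis using assms(1) by induction auto
qed

text \<open>
  The universal property of the tensor product: every generating relation of \<open>tensor_eq\<close> is respected
  by a bilinear map. This is what makes a Sweedler sum independent of the chosen representative.
\<close>

lemma tensor_eq_tsum: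
  assumes "tensor_eq K M N xs ys" "module K M" "module K N" "module K V" "bilinear K M N V F"
  shows "tsum V xs F = tsum V ys F"
proof -
  interpret M: module K M by fact
  interpret N: module K N by fact
  interpret V: module K V by fact
  note cl = bilinearD(3)[OF assms(5)]
  note l = linear_mapD(2-3)[OF bilinearD(1)[OF assms(5)]] linear_mapD(2-3)[OF bilinearD(2)[OF assms(5)]]
  show ?thesis using assms(1)
  proof induction
    case (append xs xs' ys ys')
    note s = tensor_eq_set[OF append(1) assms(2,3)] tensor_eq_set[OF append(2) assms(2,3)]
    show ?case by (subst (1 2) V.tsum_append) (use s append cl in auto)
  next
    case (comm xs ys)
    then show ?case by (subst (1 2) V.tsum_append) (auto simp: subset_iff cl intro!: V.a_comm V.tsum_closed)
  next
    case (zero b)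
    have "F \<zero>\<^bsub>M\<^esub> b = \<zero>\<^bsub>V\<^esub>" by (rule linear_map_zero[OF assms(2,4) bilinearD(2)[OF assms(5) zero]])
    then show ?case by simp
  qed (simp_all add: cl l)
qed

text \<open>
  Fixing the first or the last argument covers linearity in each of the three arguments.
\<close>

definition trilinear ::
    "'k ring \<Rightarrow> ('k, 'a, 'm) module_scheme \<Rightarrow> ('k, 'v, 'o) module_scheme
      \<Rightarrow> ('a \<Rightarrow> 'a \<Rightarrow> 'a \<Rightarrow> 'v) \<Rightarrow> bool" where
  "trilinear K M V F \<longleftrightarrow>
    (\<forall>a\<in>carrier M. bilinear K M M V (F a)) \<and> (\<forall>c\<in>carrier M. bilinear K M M V (\<lambda>a b. F a b c))"

lemma tensor3_eq_set:
  assumes "tensor3_eq K M xs ys" "module K M"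
  shows "set xs \<subseteq> carrier M \<times> carrier M \<times> carrier M \<and> set ys \<subseteq> carrier M \<times> carrier M \<times> carrier M"
proof -
  interpret M: module K M by fact
  show ?thesis using assms(1) by induction auto
qed

lemma tensor3_eq_tsum:
  assumes "tensor3_eq K M xs ys" "module K M" "module K V" "trilinear K M V F"
  shows "tsum V xs (\<lambda>a (b, c). F a b c) = tsum V ys (\<lambda>a (b, c). F a b c)"
proof -
  interpret M: module K M by fact
  interpret V: module K V by fact
  have b: "a \<in> carrier M \<Longrightarrow> bilinear K M M V (F a)" "c \<in> carrier M \<Longrightarrow> bilinear K M M V (\<lambda>a b. F a b c)" for a c
    using assms(4) by (auto simp: trilinear_def)
  note cl = bilinearD(3)[OF b(1)]
  note l = linear_mapD(2-3)[OF bilinearD(1)[OF b(1)]] linear_mapD(2-3)[OF bilinearD(2)[OF b(1)]]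
    linear_mapD(2-3)[OF bilinearD(2)[OF b(2)]]
  show ?thesis using assms(1)
  proof induction
    case (append xs xs' ys ys')
    note s = tensor3_eq_set[OF append(1) assms(2)] tensor3_eq_set[OF append(2) assms(2)]
    show ?case by (subst (1 2) V.tsum_append) (use s append cl in auto)
  next
    case (comm xs ys)
    then show ?case by (subst (1 2) V.tsum_append) (auto simp: subset_iff cl intro!: V.a_comm V.tsum_closed)
  next
    case (zero b c)
    have "F \<zero>\<^bsub>M\<^esub> b c = \<zero>\<^bsub>V\<^esub>"
      by (rule linear_map_zero[OF assms(2,3) bilinearD(2)[OF b(2)], OF zero(2,1)])
    then show ?case by simp
  qed (simp_all add: cl l)
qed

section \<open>Algebras and coalgebras\<close>

lemma k_algebraD:
  fixes V (structure)
  assumes "k_algebra K V"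
  shows "module K V" "ring V"
    and "c \<in> carrier K \<Longrightarrow> x \<in> carrier V \<Longrightarrow> y \<in> carrier V \<Longrightarrow>
      (c \<odot> x) \<otimes> y = c \<odot> (x \<otimes> y)"
    and "c \<in> carrier K \<Longrightarrow> x \<in> carrier V \<Longrightarrow> y \<in> carrier V \<Longrightarrow>
      x \<otimes> (c \<odot> y) = c \<odot> (x \<otimes> y)"
  using assms by (auto simp: k_algebra_def)

lemma algebra_k_algebra:
  assumes "algebra K A"
  shows "k_algebra K A"
proof -
  interpret algebra K A by fact
  show ?thesis unfolding k_algebra_def
    using smult_assoc2 m_comm by (auto intro: module_axioms ring_axioms)
qed

text \<open>
  With \<open>K\<close> as a module over itself, linear forms are linear maps, and scalar-valued Sweedler
  sums are a case of those with values in an algebra.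
\<close>

definition ground :: "'k ring \<Rightarrow> ('k, 'k) module" where
  "ground K = \<lparr>carrier = carrier K, mult = mult K, one = one K, zero = zero K, add = add K, smult = mult K\<rparr>"

lemma ground_simps [simp]:
  "carrier (ground K) = carrier K" "mult (ground K) = mult K" "one (ground K) = one K"
  "zero (ground K) = zero K" "add (ground K) = add K" "smult (ground K) = mult K"
  by (simp_all add: ground_def)

lemma list_sum_ground [simp]: "list_sum (ground K) xs = list_sum K xs"
  by (simp add: list_sum_def)

lemma algebra_ground:
  assumes "cring K"
  shows "algebra K (ground K)"
proof -
  interpret cring K by fact
  have "abelian_group (ground K)"
    by (rule abelian_groupI) (auto simp: a_ac l_neg intro!: bexI[of _ "\<ominus>\<^bsub>K\<^esub> _"])
  moreover have "comm_monoid (ground K)"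
    by (rule comm_monoidI) (auto simp: m_ac)
  ultimately have "cring (ground K)"
    by (rule cringI) (auto simp: l_distr)
  then show ?thesis
    by (intro algebraI) (auto simp: l_distr r_distr m_assoc cring_axioms)
qed

lemma linear_map_mult_l:
  assumes "k_algebra K V" "linear_map K M V f" "v \<in> carrier V"
  shows "linear_map K M V (\<lambda>x. f x \<otimes>\<^bsub>V\<^esub> v)"
proof -
  interpret V: ring V using assms(1) by (rule k_algebraD)
  show ?thesis
    by (rule linear_mapI) (use assms k_algebraD(3)[OF assms(1)] in \<open>auto simp: linear_mapD[OF assms(2)] V.l_distr\<close>)
qed

lemma linear_map_mult_r:
  assumes "k_algebra K V" "linear_map K M V f" "v \<in> carrier V"
  shows "linear_map K M V (\<lambda>x. v \<otimes>\<^bsub>V\<^esub> f x)"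
proof -
  interpret V: ring V using assms(1) by (rule k_algebraD)
  show ?thesis
    by (rule linear_mapI) (use assms k_algebraD(4)[OF assms(1)] in \<open>auto simp: linear_mapD[OF assms(2)] V.r_distr\<close>)
qed

lemma bilinear_mult:
  assumes "k_algebra K V" "linear_map K M V f" "linear_map K N V g"
  shows "bilinear K M N V (\<lambda>a b. f a \<otimes>\<^bsub>V\<^esub> g b)"
  by (intro bilinearI linear_map_mult_r[OF assms(1,3)] linear_map_mult_l[OF assms(1,2)]
    linear_mapD(1)[OF assms(2)] linear_mapD(1)[OF assms(3)])

lemma coalgebraD:
  assumes "coalgebra K C"
  shows "module K C"
    and "x \<in> carrier C \<Longrightarrow> set (comult C x) \<subseteq> carrier C \<times> carrier C"
    and "x \<in> carrier C \<Longrightarrow> (a, b) \<in> set (comult C x) \<Longrightarrow> a \<in> carrier C"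
    and "x \<in> carrier C \<Longrightarrow> (a, b) \<in> set (comult C x) \<Longrightarrow> b \<in> carrier C"
    and "x \<in> carrier C \<Longrightarrow> counit C x \<in> carrier K"
    and "linear_map K C (ground K) (counit C)"
proof -
  show "module K C" "linear_map K C (ground K) (counit C)"
    using assms unfolding coalgebra_def by (blast intro: linear_mapI, simp add: linear_map_def)
  show "x \<in> carrier C \<Longrightarrow> set (comult C x) \<subseteq> carrier C \<times> carrier C"
    and "x \<in> carrier C \<Longrightarrow> (a, b) \<in> set (comult C x) \<Longrightarrow> a \<in> carrier C"
    and "x \<in> carrier C \<Longrightarrow> (a, b) \<in> set (comult C x) \<Longrightarrow> b \<in> carrier C"
    and "x \<in> carrier C \<Longrightarrow> counit C x \<in> carrier K"
    using assms unfolding coalgebra_def by blast+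
qed

lemma comult_closed:
  assumes "coalgebra K C" "(a, b) \<in> set (comult C x)" "x \<in> carrier C"
  shows "a \<in> carrier C \<and> b \<in> carrier C"
  using coalgebraD(3,4)[OF assms(1,3,2)] by blast

lemma comult_cong:
  assumes "coalgebra K C" "x \<in> carrier C"
    and "\<And>a b. a \<in> carrier C \<Longrightarrow> b \<in> carrier C \<Longrightarrow> F a b = F' a b"
  shows "tsum V (comult C x) F = tsum V (comult C x) F'"
  by (rule tsum_cong) (use assms coalgebraD(3,4)[OF assms(1,2)] in auto)

text \<open>
  The comultiplication is linear only modulo equality of tensors; after applying a bilinear map the
  equalities are literal.
\<close>

lemma linear_map_comult:
  assumes "coalgebra K C" "module K V" "bilinear K C C V F"
  shows "linear_map K C V (\<lambda>x. tsum V (comult C x) F)"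
proof -
  note C = coalgebraD[OF assms(1)]
  interpret C: module K C by (rule C(1))
  interpret V: module K V by fact
  note F = bilinearD(3)[OF assms(3)]
  note te = tensor_eq_tsum[OF _ C(1) C(1) assms(2,3)]
  show ?thesis
  proof (rule linear_mapI, goal_cases)
    case (1 x)
    show ?case by (rule V.tsum_closed) (use C(3,4)[OF 1] F in auto)
  next
    case (2 x y)
    then have "tsum V (comult C (x \<oplus>\<^bsub>C\<^esub> y)) F = tsum V (comult C x @ comult C y) F"
      using assms(1) unfolding coalgebra_def by (intro te) blast
    also have "\<dots> = tsum V (comult C x) F \<oplus>\<^bsub>V\<^esub> tsum V (comult C y) F"
      by (rule V.tsum_append) (use C(3,4)[OF 2(1)] C(3,4)[OF 2(2)] F in auto)
    finally show ?case .
  next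
    case (3 c x)
    then have "tsum V (comult C (c \<odot>\<^bsub>C\<^esub> x)) F = tsum V (map (\<lambda>(x1, x2). (c \<odot>\<^bsub>C\<^esub> x1, x2)) (comult C x)) F"
      using assms(1) unfolding coalgebra_def by (intro te) blast
    also have "\<dots> = tsum V (comult C x) (\<lambda>a b. F (c \<odot>\<^bsub>C\<^esub> a) b)"
      by (rule tsum_map)
    also have "\<dots> = tsum V (comult C x) (\<lambda>a b. c \<odot>\<^bsub>V\<^esub> F a b)"
      using 3 linear_mapD(3)[OF bilinearD(2)[OF assms(3)]] by (intro comult_cong[OF assms(1)]) auto
    also have "\<dots> = c \<odot>\<^bsub>V\<^esub> tsum V (comult C x) F"
      by (rule V.tsum_smult[symmetric]) (use 3(1) C(3,4)[OF 3(2)] F in auto)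
    finally show ?case .
  qed
qed

text \<open>
  In Sweedler notation both sides are \<open>F(x1, x2, x3)\<close>.
\<close>

lemma coalgebra_coassoc:
  assumes "coalgebra K C" "module K V" "trilinear K C V F" "x \<in> carrier C"
  shows "tsum V (comult C x) (\<lambda>a b. tsum V (comult C a) (\<lambda>c d. F c d b)) =
    tsum V (comult C x) (\<lambda>a b. tsum V (comult C b) (F a))"
proof -
  note C = coalgebraD[OF assms(1)]
  interpret V: module K V by fact
  have F: "a \<in> carrier C \<Longrightarrow> b \<in> carrier C \<Longrightarrow> c \<in> carrier C \<Longrightarrow> F a b c \<in> carrier V" for a b c
    using assms(3) bilinearD(3) unfolding trilinear_def by metis
  let ?F = "\<lambda>a (b, c). F a b c"
  have "tsum V (concat (map (\<lambda>(x1, x2). map (\<lambda>(y1, y2). (y1, y2, x2)) (comult C x1)) (comult C x))) ?F =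
      tsum V (comult C x) (\<lambda>a b. tsum V (map (\<lambda>(y1, y2). (y1, y2, b)) (comult C a)) ?F)"
    by (rule V.tsum_concat) (use assms(4) in \<open>clarsimp, blast intro: F dest: comult_closed[OF assms(1)]\<close>)
  moreover have "tsum V (concat (map (\<lambda>(x1, x2). map (\<lambda>(y1, y2). (x1, y1, y2)) (comult C x2)) (comult C x))) ?F =
      tsum V (comult C x) (\<lambda>a b. tsum V (map (\<lambda>(y1, y2). (a, y1, y2)) (comult C b)) ?F)"
    by (rule V.tsum_concat) (use assms(4) in \<open>clarsimp, blast intro: F dest: comult_closed[OF assms(1)]\<close>)
  moreover have "tsum V (concat (map (\<lambda>(x1, x2). map (\<lambda>(y1, y2). (y1, y2, x2)) (comult C x1)) (comult C x))) ?F =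
      tsum V (concat (map (\<lambda>(x1, x2). map (\<lambda>(y1, y2). (x1, y1, y2)) (comult C x2)) (comult C x))) ?F"
    by (rule tensor3_eq_tsum[OF _ C(1) assms(2,3)]) (use assms(1,4) in \<open>unfold coalgebra_def, blast\<close>)
  ultimately show ?thesis by (simp add: comp_def case_prod_unfold)
qed

lemma coalgebra_counit:
  fixes C (structure)
  assumes "coalgebra K C" "module K V" "linear_map K C V f" "x \<in> carrier C"
  shows "tsum V (comult C x) (\<lambda>a b. counit C a \<odot>\<^bsub>V\<^esub> f b) = f x"
    and "tsum V (comult C x) (\<lambda>a b. counit C b \<odot>\<^bsub>V\<^esub> f a) = f x"
proof -
  note C = coalgebraD[OF assms(1)]
  interpret C: module K C by (rule C(1))
  note f = linear_mapD[OF assms(3)]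
  have "tsum C (comult C x) (\<lambda>a b. counit C a \<odot> b) = x" "tsum C (comult C x) (\<lambda>a b. counit C b \<odot> a) = x"
    using assms(1,4) unfolding coalgebra_def by blast+
  moreover have "f (tsum C (comult C x) (\<lambda>a b. counit C a \<odot> b)) = tsum V (comult C x) (\<lambda>a b. f (counit C a \<odot> b))"
    "f (tsum C (comult C x) (\<lambda>a b. counit C b \<odot> a)) = tsum V (comult C x) (\<lambda>a b. f (counit C b \<odot> a))"
    using C(3,4)[OF assms(4)] C(5) by (auto intro!: linear_map_tsum[OF C(1) assms(2,3)])
  moreover have "tsum V (comult C x) (\<lambda>a b. f (counit C a \<odot> b)) = tsum V (comult C x) (\<lambda>a b. counit C a \<odot>\<^bsub>V\<^esub> f b)"
    "tsum V (comult C x) (\<lambda>a b. f (counit C b \<odot> a)) = tsum V (comult C x) (\<lambda>a b. counit C b \<odot>\<^bsub>V\<^esub> f a)"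
    using f(3) C(5) by (auto intro!: comult_cong[OF assms(1,4)])
  ultimately show "tsum V (comult C x) (\<lambda>a b. counit C a \<odot>\<^bsub>V\<^esub> f b) = f x"
    "tsum V (comult C x) (\<lambda>a b. counit C b \<odot>\<^bsub>V\<^esub> f a) = f x" by simp_all
qed

section \<open>The convolution algebra\<close>

text \<open>
  The linear maps from a coalgebra to an algebra under convolution. They are restricted to the carrier
  of the coalgebra, so that maps that agree there are equal.
\<close>

definition conv_alg :: "'k ring \<Rightarrow> ('k, 'c) bialg \<Rightarrow> ('k, 'v, 'm) module_scheme \<Rightarrow> ('k, 'c \<Rightarrow> 'v) module" where
  "conv_alg K C V = \<lparr>carrier = {f. linear_map K C V f \<and> f \<in> extensional (carrier C)},
    mult = (\<lambda>f g. \<lambda>x\<in>carrier C. tsum V (comult C x) (\<lambda>a b. f a \<otimes>\<^bsub>V\<^esub> g b)),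
    one = (\<lambda>x\<in>carrier C. counit C x \<odot>\<^bsub>V\<^esub> \<one>\<^bsub>V\<^esub>),
    zero = (\<lambda>x\<in>carrier C. \<zero>\<^bsub>V\<^esub>),
    add = (\<lambda>f g. \<lambda>x\<in>carrier C. f x \<oplus>\<^bsub>V\<^esub> g x),
    smult = (\<lambda>c f. \<lambda>x\<in>carrier C. c \<odot>\<^bsub>V\<^esub> f x)\<rparr>"

lemma conv_alg_simps:
  "f \<in> carrier (conv_alg K C V) \<longleftrightarrow> linear_map K C V f \<and> f \<in> extensional (carrier C)"
  "mult (conv_alg K C V) f g = (\<lambda>x\<in>carrier C. tsum V (comult C x) (\<lambda>a b. f a \<otimes>\<^bsub>V\<^esub> g b))"
  "one (conv_alg K C V) = (\<lambda>x\<in>carrier C. counit C x \<odot>\<^bsub>V\<^esub> \<one>\<^bsub>V\<^esub>)"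
  "zero (conv_alg K C V) = (\<lambda>x\<in>carrier C. \<zero>\<^bsub>V\<^esub>)"
  "add (conv_alg K C V) f g = (\<lambda>x\<in>carrier C. f x \<oplus>\<^bsub>V\<^esub> g x)"
  "smult (conv_alg K C V) c f = (\<lambda>x\<in>carrier C. c \<odot>\<^bsub>V\<^esub> f x)"
  by (auto simp: conv_alg_def)

lemma linear_map_restrict:
  "module K M \<Longrightarrow> linear_map K M N (\<lambda>x\<in>carrier M. f x) \<longleftrightarrow> linear_map K M N f"
  by (rule linear_map_cong) auto

lemma linear_map_add:
  assumes "module K N" "linear_map K M N f" "linear_map K M N g"
  shows "linear_map K M N (\<lambda>x. f x \<oplus>\<^bsub>N\<^esub> g x)"
proof -
  interpret N: module K N by fact
  show ?thesis
    by (rule linear_mapI) (auto simp: linear_mapD[OF assms(2)] linear_mapD[OF assms(3)] N.smult_r_distr N.a_ac)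
qed

lemma linear_map_smult:
  assumes "module K N" "linear_map K M N f" "c \<in> carrier K"
  shows "linear_map K M N (\<lambda>x. c \<odot>\<^bsub>N\<^esub> f x)"
proof -
  interpret N: module K N by fact
  have "c \<odot>\<^bsub>N\<^esub> (d \<odot>\<^bsub>N\<^esub> x) = d \<odot>\<^bsub>N\<^esub> (c \<odot>\<^bsub>N\<^esub> x)" if "d \<in> carrier K" "x \<in> carrier N" for d x
    using N.smult_assoc1[of c d x] N.smult_assoc1[of d c x] that assms(3) N.m_comm[of c d] by simp
  then show ?thesis
    by (intro linear_mapI) (auto simp: linear_mapD[OF assms(2)] N.smult_r_distr assms(3))
qed

lemma linear_map_smult_const:
  assumes "module K N" "linear_map K M (ground K) f" "v \<in> carrier N"
  shows "linear_map K M N (\<lambda>x. f x \<odot>\<^bsub>N\<^esub> v)"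
proof -
  interpret N: module K N by fact
  show ?thesis
    using linear_mapD[OF assms(2)]
    by (intro linear_mapI) (auto simp: N.smult_l_distr N.smult_assoc1 assms(3))
qed

lemma linear_map_const_zero:
  assumes "module K N"
  shows "linear_map K M N (\<lambda>x. \<zero>\<^bsub>N\<^esub>)"
proof -
  interpret N: module K N by fact
  show ?thesis by (intro linear_mapI) auto
qed

lemma trilinear_mult:
  assumes "k_algebra K V" "linear_map K M V f" "linear_map K M V g" "linear_map K M V h"
  shows "trilinear K M V (\<lambda>a b c. f a \<otimes>\<^bsub>V\<^esub> g b \<otimes>\<^bsub>V\<^esub> h c)"
proof -
  interpret V: ring V using assms(1) by (rule k_algebraD)
  note cl = linear_mapD(1)[OF assms(2)] linear_mapD(1)[OF assms(3)] linear_mapD(1)[OF assms(4)]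
  show ?thesis unfolding trilinear_def
    by (auto intro!: bilinearI linear_map_mult_l[OF assms(1)] linear_map_mult_r[OF assms(1)] assms cl V.m_closed)
qed

text \<open>
  Associativity is coassociativity of \<open>C\<close> together with associativity of \<open>V\<close>, and the unit laws are the
  counit laws.
\<close>

lemma k_algebra_conv_alg:
  fixes V (structure)
  assumes "coalgebra K C" "k_algebra K V"
  shows "k_algebra K (conv_alg K C V)"
proof -
  note C = coalgebraD[OF assms(1)]
  note V = k_algebraD[OF assms(2)]
  interpret C: module K C by (rule C(1))
  interpret V: module K V by (rule V(1))
  interpret V: ring V by (rule V(2))
  let ?R = "conv_alg K C V"
  note cs = conv_alg_simps
  have lin: "f \<in> carrier ?R \<Longrightarrow> linear_map K C V f" and ex: "f \<in> carrier ?R \<Longrightarrow> f \<in> extensional (carrier C)"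
    and cl: "f \<in> carrier ?R \<Longrightarrow> x \<in> carrier C \<Longrightarrow> f x \<in> carrier V" for f x
    by (auto simp: cs linear_mapD(1))
  have eqI: "f = g" if "f \<in> carrier ?R" "g \<in> carrier ?R" "\<And>x. x \<in> carrier C \<Longrightarrow> f x = g x" for f g
    using that by (intro extensionalityI[of f "carrier C" g]) (auto simp: cs)
  have mul: "f \<otimes>\<^bsub>?R\<^esub> g \<in> carrier ?R" if "f \<in> carrier ?R" "g \<in> carrier ?R" for f g
    using that by (auto simp: cs linear_map_restrict[OF C(1)] intro!: linear_map_comult[OF assms(1) V(1)] bilinear_mult[OF assms(2)])
  have add: "f \<oplus>\<^bsub>?R\<^esub> g \<in> carrier ?R" if "f \<in> carrier ?R" "g \<in> carrier ?R" for f g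
    using that by (auto simp: cs linear_map_restrict[OF C(1)] intro!: linear_map_add[OF V(1)])
  have sm: "c \<odot>\<^bsub>?R\<^esub> g \<in> carrier ?R" if "c \<in> carrier K" "g \<in> carrier ?R" for c g
    using that by (auto simp: cs linear_map_restrict[OF C(1)] intro!: linear_map_smult[OF V(1)])
  have zero: "\<zero>\<^bsub>?R\<^esub> \<in> carrier ?R"
    by (auto simp: cs linear_map_restrict[OF C(1)] intro!: linear_map_const_zero[OF V(1)])
  have one: "\<one>\<^bsub>?R\<^esub> \<in> carrier ?R"
    by (auto simp: cs linear_map_restrict[OF C(1)] intro!: linear_map_smult_const[OF V(1)] C(6))
  have ev: "x \<in> carrier C \<Longrightarrow> (f \<otimes>\<^bsub>?R\<^esub> g) x = tsum V (comult C x) (\<lambda>a b. f a \<otimes> g b)"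
    "x \<in> carrier C \<Longrightarrow> (f \<oplus>\<^bsub>?R\<^esub> g) x = f x \<oplus> g x" "x \<in> carrier C \<Longrightarrow> (c \<odot>\<^bsub>?R\<^esub> g) x = c \<odot> g x"
    "x \<in> carrier C \<Longrightarrow> \<one>\<^bsub>?R\<^esub> x = counit C x \<odot> \<one>" "x \<in> carrier C \<Longrightarrow> \<zero>\<^bsub>?R\<^esub> x = \<zero>" for f g x c
    by (auto simp: cs)
  have grp: "abelian_group ?R"
  proof (rule abelian_groupI)
    fix f assume f: "f \<in> carrier ?R"
    have "\<ominus>\<^bsub>K\<^esub> \<one>\<^bsub>K\<^esub> \<odot>\<^bsub>?R\<^esub> f \<oplus>\<^bsub>?R\<^esub> f = \<zero>\<^bsub>?R\<^esub>"
      by (rule eqI) (use f in \<open>auto simp: add sm zero ev V.smult_l_minus cl V.l_neg\<close>)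
    then show "\<exists>g\<in>carrier ?R. g \<oplus>\<^bsub>?R\<^esub> f = \<zero>\<^bsub>?R\<^esub>" using f by (auto intro!: sm)
  qed (auto intro!: eqI add zero simp: ev cl V.a_ac)
  have mod: "module K ?R"
    by (rule moduleI) (auto intro!: grp eqI sm add simp: ev cl V.smult_l_distr V.smult_r_distr V.smult_assoc1 C.cring_axioms)
  have assoc: "f \<otimes>\<^bsub>?R\<^esub> g \<otimes>\<^bsub>?R\<^esub> h = f \<otimes>\<^bsub>?R\<^esub> (g \<otimes>\<^bsub>?R\<^esub> h)"
    if fgh: "f \<in> carrier ?R" "g \<in> carrier ?R" "h \<in> carrier ?R" for f g h
  proof (rule eqI)
    fix x assume x: "x \<in> carrier C"
    have "(f \<otimes>\<^bsub>?R\<^esub> g \<otimes>\<^bsub>?R\<^esub> h) x =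
        tsum V (comult C x) (\<lambda>a b. tsum V (comult C a) (\<lambda>c d. f c \<otimes> g d) \<otimes> h b)"
      using x by (auto simp: ev intro!: comult_cong[OF assms(1)])
    also have "\<dots> = tsum V (comult C x) (\<lambda>a b. tsum V (comult C a) (\<lambda>c d. f c \<otimes> g d \<otimes> h b))"
      using fgh cl by (intro comult_cong[OF assms(1) x] V.tsum_l_distr) (auto dest: comult_closed[OF assms(1)])
    also have "\<dots> = tsum V (comult C x) (\<lambda>a b. tsum V (comult C b) (\<lambda>c d. f a \<otimes> g c \<otimes> h d))"
      by (rule coalgebra_coassoc[OF assms(1) V(1) _ x]) (use fgh lin in \<open>auto intro!: trilinear_mult assms(2)\<close>)
    also have "\<dots> = tsum V (comult C x) (\<lambda>a b. tsum V (comult C b) (\<lambda>c d. f a \<otimes> (g c \<otimes> h d)))"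
      using x fgh cl by (intro comult_cong[OF assms(1)]) (auto simp: V.m_assoc)
    also have "\<dots> = tsum V (comult C x) (\<lambda>a b. f a \<otimes> tsum V (comult C b) (\<lambda>c d. g c \<otimes> h d))"
      using fgh cl by (intro comult_cong[OF assms(1) x] V.tsum_r_distr[symmetric]) (auto dest: comult_closed[OF assms(1)])
    also have "\<dots> = (f \<otimes>\<^bsub>?R\<^esub> (g \<otimes>\<^bsub>?R\<^esub> h)) x"
      using x by (auto simp: ev intro!: comult_cong[OF assms(1)])
    finally show "(f \<otimes>\<^bsub>?R\<^esub> g \<otimes>\<^bsub>?R\<^esub> h) x = (f \<otimes>\<^bsub>?R\<^esub> (g \<otimes>\<^bsub>?R\<^esub> h)) x" .
  qed (use fgh mul in auto)
  have l_one: "\<one>\<^bsub>?R\<^esub> \<otimes>\<^bsub>?R\<^esub> f = f" if f: "f \<in> carrier ?R" for f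
  proof (rule eqI)
    fix x assume x: "x \<in> carrier C"
    have "(\<one>\<^bsub>?R\<^esub> \<otimes>\<^bsub>?R\<^esub> f) x = tsum V (comult C x) (\<lambda>a b. counit C a \<odot> f b)"
      using x f cl C(5) by (auto simp: ev V(3) intro!: comult_cong[OF assms(1)])
    then show "(\<one>\<^bsub>?R\<^esub> \<otimes>\<^bsub>?R\<^esub> f) x = f x"
      using coalgebra_counit(1)[OF assms(1) V(1) lin x] f by simp
  qed (use f one mul in auto)
  have r_one: "f \<otimes>\<^bsub>?R\<^esub> \<one>\<^bsub>?R\<^esub> = f" if f: "f \<in> carrier ?R" for f
  proof (rule eqI)
    fix x assume x: "x \<in> carrier C"
    have "(f \<otimes>\<^bsub>?R\<^esub> \<one>\<^bsub>?R\<^esub>) x = tsum V (comult C x) (\<lambda>a b. counit C b \<odot> f a)"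
      using x f cl C(5) by (auto simp: ev V(4) intro!: comult_cong[OF assms(1)])
    then show "(f \<otimes>\<^bsub>?R\<^esub> \<one>\<^bsub>?R\<^esub>) x = f x"
      using coalgebra_counit(2)[OF assms(1) V(1) lin x] f by simp
  qed (use f one mul in auto)
  have mon: "monoid ?R" by (rule monoidI) (use assoc l_one r_one mul one in auto)
  have tcl: "x \<in> carrier C \<Longrightarrow> f \<in> carrier ?R \<Longrightarrow> g \<in> carrier ?R \<Longrightarrow> (a, b) \<in> set (comult C x) \<Longrightarrow>
      f a \<otimes> g b \<in> carrier V" for f g x a b
    using cl by (auto dest: comult_closed[OF assms(1)])
  have ring: "ring ?R"
  proof (rule ringI[OF grp mon])
    fix f g h assume fgh: "f \<in> carrier ?R" "g \<in> carrier ?R" "h \<in> carrier ?R"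
    show "(f \<oplus>\<^bsub>?R\<^esub> g) \<otimes>\<^bsub>?R\<^esub> h = f \<otimes>\<^bsub>?R\<^esub> h \<oplus>\<^bsub>?R\<^esub> g \<otimes>\<^bsub>?R\<^esub> h"
    proof (rule eqI)
      fix x assume x: "x \<in> carrier C"
      have "((f \<oplus>\<^bsub>?R\<^esub> g) \<otimes>\<^bsub>?R\<^esub> h) x = tsum V (comult C x) (\<lambda>a b. f a \<otimes> h b \<oplus> g a \<otimes> h b)"
        using x fgh cl by (auto simp: ev V.l_distr intro!: comult_cong[OF assms(1)])
      then show "((f \<oplus>\<^bsub>?R\<^esub> g) \<otimes>\<^bsub>?R\<^esub> h) x = (f \<otimes>\<^bsub>?R\<^esub> h \<oplus>\<^bsub>?R\<^esub> g \<otimes>\<^bsub>?R\<^esub> h) x"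
        using x fgh tcl by (simp add: ev V.tsum_add)
    qed (use fgh add mul in auto)
    show "h \<otimes>\<^bsub>?R\<^esub> (f \<oplus>\<^bsub>?R\<^esub> g) = h \<otimes>\<^bsub>?R\<^esub> f \<oplus>\<^bsub>?R\<^esub> h \<otimes>\<^bsub>?R\<^esub> g"
    proof (rule eqI)
      fix x assume x: "x \<in> carrier C"
      have "(h \<otimes>\<^bsub>?R\<^esub> (f \<oplus>\<^bsub>?R\<^esub> g)) x = tsum V (comult C x) (\<lambda>a b. h a \<otimes> f b \<oplus> h a \<otimes> g b)"
        using x fgh cl by (auto simp: ev V.r_distr intro!: comult_cong[OF assms(1)])
      then show "(h \<otimes>\<^bsub>?R\<^esub> (f \<oplus>\<^bsub>?R\<^esub> g)) x = (h \<otimes>\<^bsub>?R\<^esub> f \<oplus>\<^bsub>?R\<^esub> h \<otimes>\<^bsub>?R\<^esub> g) x"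
        using x fgh tcl by (simp add: ev V.tsum_add)
    qed (use fgh add mul in auto)
  qed
  have "(c \<odot>\<^bsub>?R\<^esub> f) \<otimes>\<^bsub>?R\<^esub> g = c \<odot>\<^bsub>?R\<^esub> (f \<otimes>\<^bsub>?R\<^esub> g) \<and> f \<otimes>\<^bsub>?R\<^esub> (c \<odot>\<^bsub>?R\<^esub> g) = c \<odot>\<^bsub>?R\<^esub> (f \<otimes>\<^bsub>?R\<^esub> g)"
    if cfg: "c \<in> carrier K" "f \<in> carrier ?R" "g \<in> carrier ?R" for c f g
  proof -
    have sc: "x \<in> carrier C \<Longrightarrow> tsum V (comult C x) (\<lambda>a b. c \<odot> (f a \<otimes> g b)) = (c \<odot>\<^bsub>?R\<^esub> (f \<otimes>\<^bsub>?R\<^esub> g)) x" for x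
      using cfg tcl by (simp add: ev V.tsum_smult)
    have "(c \<odot>\<^bsub>?R\<^esub> f) \<otimes>\<^bsub>?R\<^esub> g = c \<odot>\<^bsub>?R\<^esub> (f \<otimes>\<^bsub>?R\<^esub> g)"
    proof (rule eqI)
      fix x assume x: "x \<in> carrier C"
      have "((c \<odot>\<^bsub>?R\<^esub> f) \<otimes>\<^bsub>?R\<^esub> g) x = tsum V (comult C x) (\<lambda>a b. c \<odot> (f a \<otimes> g b))"
        using x cfg cl by (auto simp: ev V(3) intro!: comult_cong[OF assms(1)])
      then show "((c \<odot>\<^bsub>?R\<^esub> f) \<otimes>\<^bsub>?R\<^esub> g) x = (c \<odot>\<^bsub>?R\<^esub> (f \<otimes>\<^bsub>?R\<^esub> g)) x" using sc x by simp
    qed (use cfg sm mul in auto)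
    moreover have "f \<otimes>\<^bsub>?R\<^esub> (c \<odot>\<^bsub>?R\<^esub> g) = c \<odot>\<^bsub>?R\<^esub> (f \<otimes>\<^bsub>?R\<^esub> g)"
    proof (rule eqI)
      fix x assume x: "x \<in> carrier C"
      have "(f \<otimes>\<^bsub>?R\<^esub> (c \<odot>\<^bsub>?R\<^esub> g)) x = tsum V (comult C x) (\<lambda>a b. c \<odot> (f a \<otimes> g b))"
        using x cfg cl by (auto simp: ev V(4) intro!: comult_cong[OF assms(1)])
      then show "(f \<otimes>\<^bsub>?R\<^esub> (c \<odot>\<^bsub>?R\<^esub> g)) x = (c \<odot>\<^bsub>?R\<^esub> (f \<otimes>\<^bsub>?R\<^esub> g)) x" using sc x by simp
    qed (use cfg sm mul in auto)
    ultimately show ?thesis by blast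
  qed
  then show ?thesis using mod ring by (simp add: k_algebra_def)
qed

section \<open>Linear forms separate points\<close>

text \<open>
  A subspace that is maximal among those avoiding \<open>a\<close> is a complement of the line through \<open>a\<close>; the
  coordinate along \<open>a\<close> is the form.
\<close>

lemma exists_linear_form:
  fixes A (structure)
  assumes "field K" "module K A" "a \<in> carrier A" "a \<noteq> \<zero>"
  shows "\<exists>\<phi>. linear_map K A (ground K) \<phi> \<and> \<phi> a = \<one>\<^bsub>K\<^esub>"
proof -
  interpret K: field K by fact
  interpret A: module K A by fact
  define sub where "sub U \<longleftrightarrow> U \<subseteq> carrier A \<and> \<zero> \<in> U \<and> (\<forall>x\<in>U. \<forall>y\<in>U. x \<oplus> y \<in> U) \<and>
    (\<forall>c\<in>carrier K. \<forall>x\<in>U. c \<odot> x \<in> U) \<and> a \<notin> U" for U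
  have "sub {\<zero>}" using assms by (auto simp: sub_def)
  moreover have "sub (\<Union>\<C>)" if "\<C> \<noteq> {}" "subset.chain (Collect sub) \<C>" for \<C>
  proof -
    have s: "U \<in> \<C> \<Longrightarrow> sub U" for U using that(2) by (auto simp: subset.chain_def)
    have "x \<oplus> y \<in> \<Union>\<C>" if "U \<in> \<C>" "V \<in> \<C>" "x \<in> U" "y \<in> V" for x y U V
    proof -
      have "U \<subseteq> V \<or> V \<subseteq> U" using \<open>subset.chain (Collect sub) \<C>\<close> that by (auto simp: subset_chain_def)
      then show ?thesis using that s unfolding sub_def by blast
    qed
    moreover have "\<Union>\<C> \<subseteq> carrier A" "\<zero> \<in> \<Union>\<C>" "a \<notin> \<Union>\<C>"
      and "\<And>c x. c \<in> carrier K \<Longrightarrow> x \<in> \<Union>\<C> \<Longrightarrow> c \<odot> x \<in> \<Union>\<C>"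
      using s that(1) unfolding sub_def by fast+
    ultimately show ?thesis unfolding sub_def by (meson UnionE)
  qed
  ultimately obtain M where M: "sub M" and max: "\<And>X. sub X \<Longrightarrow> M \<subseteq> X \<Longrightarrow> X = M"
    using subset_Zorn_nonempty[of "Collect sub"] by (metis empty_Collect_eq mem_Collect_eq)
  have Mc: "x \<in> M \<Longrightarrow> x \<in> carrier A" and M0: "\<zero> \<in> M" and Ma: "a \<notin> M"
    and Madd: "x \<in> M \<Longrightarrow> y \<in> M \<Longrightarrow> x \<oplus> y \<in> M" and Msm: "c \<in> carrier K \<Longrightarrow> x \<in> M \<Longrightarrow> c \<odot> x \<in> M"
    for x y c using M unfolding sub_def by blast+
  have Mneg: "\<ominus> x \<in> M" if "x \<in> M" for x
    using Msm[of "\<ominus>\<^bsub>K\<^esub> \<one>\<^bsub>K\<^esub>" x] Mc that by (simp add: A.smult_l_minus)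
  have inv: "inv\<^bsub>K\<^esub> c \<in> carrier K" "inv\<^bsub>K\<^esub> c \<otimes>\<^bsub>K\<^esub> c = \<one>\<^bsub>K\<^esub>" if "c \<in> carrier K" "c \<noteq> \<zero>\<^bsub>K\<^esub>" for c
    using that K.field_Units by auto
  \<comment> \<open>If \<open>x\<close> is outside of \<open>M\<close>, then \<open>M\<close> together with \<open>x\<close> spans \<open>a\<close>, by maximality.\<close>
  have ex: "\<exists>c\<in>carrier K. \<exists>m\<in>M. x = m \<oplus> c \<odot> a" if x: "x \<in> carrier A" for x
  proof (cases "x \<in> M")
    case True
    then show ?thesis using assms x by (intro bexI[of _ "\<zero>\<^bsub>K\<^esub>"] bexI[of _ x]) auto
  next
    case False
    define X where "X = {m \<oplus> c \<odot> x | m c. m \<in> M \<and> c \<in> carrier K}"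
    have "M \<subseteq> X"
    proof
      fix m assume "m \<in> M"
      then show "m \<in> X" using x Mc unfolding X_def by (auto intro!: exI[of _ m] exI[of _ "\<zero>\<^bsub>K\<^esub>"])
    qed
    moreover have "x \<in> X"
      using x M0 unfolding X_def by (auto intro!: exI[of _ "\<zero>"] exI[of _ "\<one>\<^bsub>K\<^esub>"])
    ultimately have "\<not> sub X" using max False by blast
    moreover have "X \<subseteq> carrier A" using x Mc unfolding X_def by auto
    moreover have "y \<oplus> z \<in> X" if yz: "y \<in> X" "z \<in> X" for y z
    proof -
      obtain m c n d where *: "y = m \<oplus> c \<odot> x" "z = n \<oplus> d \<odot> x" "m \<in> M" "n \<in> M" "c \<in> carrier K" "d \<in> carrier K"
        using yz unfolding X_def by blast
      have "y \<oplus> z = (m \<oplus> n) \<oplus> (c \<oplus>\<^bsub>K\<^esub> d) \<odot> x"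
        using * x Mc by (simp add: A.smult_l_distr A.a_ac)
      then show ?thesis using * Madd unfolding X_def by blast
    qed
    moreover have "d \<odot> y \<in> X" if yd: "y \<in> X" "d \<in> carrier K" for y d
    proof -
      obtain m c where *: "y = m \<oplus> c \<odot> x" "m \<in> M" "c \<in> carrier K"
        using yd unfolding X_def by blast
      have "d \<odot> y = d \<odot> m \<oplus> (d \<otimes>\<^bsub>K\<^esub> c) \<odot> x"
        using * x Mc yd by (simp add: A.smult_r_distr A.smult_assoc1)
      then show ?thesis using * yd Msm K.m_closed unfolding X_def by blast
    qed
    ultimately have "a \<in> X" using \<open>M \<subseteq> X\<close> M0 unfolding sub_def by blast
    then obtain m c where *: "a = m \<oplus> c \<odot> x" "m \<in> M" "c \<in> carrier K" unfolding X_def by blast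
    have c0: "c \<noteq> \<zero>\<^bsub>K\<^esub>" using * Ma Mc x by auto
    note i = inv[OF *(3) c0]
    have "inv\<^bsub>K\<^esub> c \<odot> a = inv\<^bsub>K\<^esub> c \<odot> m \<oplus> x"
      using i *(2,3) Mc x by (simp add: *(1) A.smult_r_distr A.smult_assoc1[symmetric])
    then have "x = \<ominus> (inv\<^bsub>K\<^esub> c \<odot> m) \<oplus> inv\<^bsub>K\<^esub> c \<odot> a"
      using i Mc[OF *(2)] x by (simp add: A.r_neg1)
    then show ?thesis using i(1) Mneg Msm *(2) by blast
  qed
  have uniq: "c = d" if h: "m \<oplus> c \<odot> a = n \<oplus> d \<odot> a" "m \<in> M" "n \<in> M" "c \<in> carrier K" "d \<in> carrier K" for m n c d
  proof (rule ccontr)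
    assume "c \<noteq> d"
    then have e: "c \<ominus>\<^bsub>K\<^esub> d \<in> carrier K" "c \<ominus>\<^bsub>K\<^esub> d \<noteq> \<zero>\<^bsub>K\<^esub>"
      using h K.minus_equality[of c "\<ominus>\<^bsub>K\<^esub> d"] by (auto simp: a_minus_def)
    note i = inv[OF this]
    have "(c \<ominus>\<^bsub>K\<^esub> d) \<odot> a = c \<odot> a \<oplus> \<ominus> (d \<odot> a)"
      using h assms by (simp add: a_minus_def A.smult_l_distr A.smult_l_minus)
    also have "c \<odot> a = \<ominus> m \<oplus> (m \<oplus> c \<odot> a)"
      using h(2-) Mc assms by (simp add: A.r_neg1)
    also have "\<dots> \<oplus> \<ominus> (d \<odot> a) = \<ominus> m \<oplus> n"
      using h(2-) Mc assms by (simp add: h(1) A.a_assoc A.r_neg)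
    finally have "(c \<ominus>\<^bsub>K\<^esub> d) \<odot> a \<in> M" using h Madd Mneg by simp
    then have "inv\<^bsub>K\<^esub> (c \<ominus>\<^bsub>K\<^esub> d) \<odot> ((c \<ominus>\<^bsub>K\<^esub> d) \<odot> a) \<in> M" using Msm i by blast
    then show False using i e assms Ma by (simp add: A.smult_assoc1[symmetric])
  qed
  define \<phi> where "\<phi> x = (THE c. c \<in> carrier K \<and> (\<exists>m\<in>M. x = m \<oplus> c \<odot> a))" for x
  have phi: "\<phi> x = c" if "x = m \<oplus> c \<odot> a" "m \<in> M" "c \<in> carrier K" for x m c
    unfolding \<phi>_def by (rule the_equality) (use that uniq in blast)+
  have "linear_map K A (ground K) \<phi>"
  proof (rule linear_mapI)
    fix x assume "x \<in> carrier A"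
    then show "\<phi> x \<in> carrier (ground K)" using ex[of x] phi by force
  next
    fix x y assume x: "x \<in> carrier A" and y: "y \<in> carrier A"
    obtain c m d n where *: "c \<in> carrier K" "m \<in> M" "x = m \<oplus> c \<odot> a" "d \<in> carrier K" "n \<in> M" "y = n \<oplus> d \<odot> a"
      using ex[OF x] ex[OF y] by blast
    have "x \<oplus> y = (m \<oplus> n) \<oplus> (c \<oplus>\<^bsub>K\<^esub> d) \<odot> a"
      using * Mc assms by (simp add: A.smult_l_distr A.a_ac)
    then have "\<phi> (x \<oplus> y) = c \<oplus>\<^bsub>K\<^esub> d" by (rule phi) (use * Madd in auto)
    moreover have "\<phi> x = c" "\<phi> y = d" using * by (blast intro: phi)+
    ultimately show "\<phi> (x \<oplus> y) = \<phi> x \<oplus>\<^bsub>ground K\<^esub> \<phi> y" by simp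
  next
    fix d x assume d: "d \<in> carrier K" and x: "x \<in> carrier A"
    obtain c m where *: "c \<in> carrier K" "m \<in> M" "x = m \<oplus> c \<odot> a"
      using ex[OF x] by blast
    have "d \<odot> x = d \<odot> m \<oplus> (d \<otimes>\<^bsub>K\<^esub> c) \<odot> a"
      using * d Mc assms by (simp add: A.smult_r_distr A.smult_assoc1)
    then have "\<phi> (d \<odot> x) = d \<otimes>\<^bsub>K\<^esub> c" by (rule phi) (use * d Msm in auto)
    moreover have "\<phi> x = c" using * by (blast intro: phi)
    ultimately show "\<phi> (d \<odot> x) = d \<odot>\<^bsub>ground K\<^esub> \<phi> x" by simp
  qed
  moreover have "\<phi> a = \<one>\<^bsub>K\<^esub>" by (rule phi[of _ "\<zero>"]) (use M0 assms in auto)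
  ultimately show ?thesis by blast
qed

definition separating :: "'k ring \<Rightarrow> ('k, 'a, 'm) module_scheme \<Rightarrow> ('a \<Rightarrow> 'k) set \<Rightarrow> bool" where
  "separating K M E \<longleftrightarrow> (\<forall>e\<in>E. linear_map K M (ground K) e) \<and>
    (\<forall>a\<in>carrier M. (\<forall>e\<in>E. e a = \<zero>\<^bsub>K\<^esub>) \<longrightarrow> a = \<zero>\<^bsub>M\<^esub>)"

lemma separating_linear_forms:
  assumes "field K" "module K A"
  shows "separating K A {\<phi>. linear_map K A (ground K) \<phi>}"
proof -
  interpret K: field K by fact
  show ?thesis unfolding separating_def using exists_linear_form[OF assms] by (auto) (metis K.one_not_zero)
qed

lemma separating_eqI:
  fixes M (structure)
  assumes "module K M" "separating K M E" "a \<in> carrier M" "b \<in> carrier M" "\<And>e. e \<in> E \<Longrightarrow> e a = e b"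
  shows "a = b"
proof -
  interpret M: module K M by fact
  have "e (a \<oplus> (\<ominus>\<^bsub>K\<^esub> \<one>\<^bsub>K\<^esub>) \<odot> b) = \<zero>\<^bsub>K\<^esub>" if e: "e \<in> E" for e
  proof -
    have l: "linear_map K M (ground K) e" using assms(2) e by (simp add: separating_def)
    then show ?thesis using assms(3,4) linear_mapD(1)[OF l, of b]
      by (simp add: linear_mapD[OF l] assms(5)[OF e] M.R.l_minus M.R.r_neg)
  qed
  moreover have "a \<oplus> (\<ominus>\<^bsub>K\<^esub> \<one>\<^bsub>K\<^esub>) \<odot> b \<in> carrier M" using assms(3,4) by simp
  ultimately have "a \<oplus> (\<ominus>\<^bsub>K\<^esub> \<one>\<^bsub>K\<^esub>) \<odot> b = \<zero>" using assms(2) by (simp add: separating_def)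
  then show "a = b" using assms(3,4) by (simp add: M.smult_l_minus M.M.minus_equality[symmetric]
    M.M.minus_unique) (metis M.M.a_inv_closed M.M.add.inv_equality M.M.minus_minus)
qed

lemma separating_neg:
  assumes "module K M" "separating K M E" "e \<in> E" "a \<in> carrier M"
  shows "e a \<in> carrier K" "e (\<ominus>\<^bsub>M\<^esub> a) = \<ominus>\<^bsub>K\<^esub> (e a)"
proof -
  interpret M: module K M by fact
  have l: "linear_map K M (ground K) e" using assms(2,3) by (simp add: separating_def)
  show "e a \<in> carrier K" using linear_mapD(1)[OF l assms(4)] by simp
  then show "e (\<ominus>\<^bsub>M\<^esub> a) = \<ominus>\<^bsub>K\<^esub> (e a)"
    using linear_mapD(3)[OF l, of "\<ominus>\<^bsub>K\<^esub> \<one>\<^bsub>K\<^esub>" a] assms(4) by (simp add: M.smult_l_minus M.R.l_minus)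
qed

section \<open>Equality of tensors is detected by a separating family\<close>

text \<open>
  The properties that \<open>tensor_eq\<close> and \<open>tensor3_eq\<close> have in common: congruence for concatenation,
  with the order of summands irrelevant on the lists over the carriers \<open>S\<close>.
\<close>

locale formal_sum_congruence =
  fixes R :: "'x list \<Rightarrow> 'x list \<Rightarrow> bool" and S :: "'x set"
  assumes R_refl: "set xs \<subseteq> S \<Longrightarrow> R xs xs"
    and R_sym: "R xs ys \<Longrightarrow> R ys xs"
    and R_trans [trans]: "R xs ys \<Longrightarrow> R ys zs \<Longrightarrow> R xs zs"
    and R_append: "R xs xs' \<Longrightarrow> R ys ys' \<Longrightarrow> R (xs @ ys) (xs' @ ys')"
    and R_comm: "set xs \<subseteq> S \<Longrightarrow> set ys \<subseteq> S \<Longrightarrow> R (xs @ ys) (ys @ xs)"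
begin

lemma map_append:
  assumes "\<And>y. y \<in> set ys \<Longrightarrow> f y \<in> S \<and> g y \<in> S \<and> R [f y, g y] (h y)"
  shows "R (map f ys @ map g ys) (concat (map h ys))"
  using assms
proof (induction ys)
  case Nil
  show ?case using R_refl[of "[]"] by simp
next
  case (Cons y ys)
  have s: "set (map f ys) \<subseteq> S" "set (map g ys) \<subseteq> S" "f y \<in> S" "g y \<in> S" using Cons.prems by auto
  have "R ([f y] @ (map f ys @ [g y]) @ map g ys) ([f y] @ ([g y] @ map f ys) @ map g ys)"
    by (intro R_append R_comm R_refl) (use s in auto)
  also have "R (\<dots>) (h y @ concat (map h ys))"
    using R_append[OF _ Cons.IH, of "[f y, g y]" "h y"] Cons.prems by simp
  finally show ?case by simp
qed

text \<open>
  Subtraction of formal sums: \<open>n\<close> plays the role of negation of a summand.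
\<close>

lemma cancel:
  assumes "R (xs @ map n ys) []" "set xs \<subseteq> S" "\<And>y. y \<in> set ys \<Longrightarrow> n y \<in> S \<and> y \<in> S \<and> R [n y, y] []"
  shows "R xs ys"
proof -
  have "R (map n ys @ map (\<lambda>y. y) ys) (concat (map (\<lambda>y. []) ys))"
    by (rule map_append) (use assms(3) in auto)
  also have "concat (map (\<lambda>y. []) ys) = []" by simp
  finally have z: "R (map n ys @ ys) []" by simp
  have "R (xs @ []) (xs @ (map n ys @ ys))" by (intro R_append R_refl R_sym[OF z] assms)
  also have "xs @ (map n ys @ ys) = (xs @ map n ys) @ ys" by simp
  also have "R \<dots> ([] @ ys)" by (intro R_append assms(1) R_refl) (use assms(3) in auto)
  finally show ?thesis by simp
qed

text \<open>
  If the functions \<open>val\<close> detect the zero tensor, they detect equality: subtract.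
\<close>

lemma eqI_by_values:
  assumes "ring K" and val: "\<And>i y. i \<in> I \<Longrightarrow> y \<in> S \<Longrightarrow> val i y \<in> carrier K"
    and n: "\<And>y. y \<in> S \<Longrightarrow> n y \<in> S \<and> R [n y, y] []"
    and val_n: "\<And>i y. i \<in> I \<Longrightarrow> y \<in> S \<Longrightarrow> val i (n y) = \<ominus>\<^bsub>K\<^esub> val i y"
    and null: "\<And>zs. set zs \<subseteq> S \<Longrightarrow> (\<And>i. i \<in> I \<Longrightarrow> list_sum K (map (val i) zs) = \<zero>\<^bsub>K\<^esub>) \<Longrightarrow> R zs []"
    and xs: "set xs \<subseteq> S" and ys: "set ys \<subseteq> S"
    and eq: "\<And>i. i \<in> I \<Longrightarrow> list_sum K (map (val i) xs) = list_sum K (map (val i) ys)"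
  shows "R xs ys"
proof (rule cancel[where n = n])
  interpret K: ring K by fact
  show "R (xs @ map n ys) []"
  proof (rule null)
    fix i assume i: "i \<in> I"
    have cl: "set (map (val i) zs) \<subseteq> carrier K" if "set zs \<subseteq> S" for zs using val[OF i] that by auto
    have "list_sum K (map (val i) (map n zs)) = \<ominus>\<^bsub>K\<^esub> list_sum K (map (val i) zs)" if "set zs \<subseteq> S" for zs
      using that
    proof (induction zs)
      case (Cons z zs)
      then show ?case using cl[of zs] val[OF i, of z] by (simp add: val_n[OF i] K.minus_add K.list_sum_closed)
    qed simp
    moreover have "set (map n ys) \<subseteq> S" using n ys by auto
    ultimately show "list_sum K (map (val i) (xs @ map n ys)) = \<zero>\<^bsub>K\<^esub>"
      unfolding map_append using cl[OF xs] cl[of "map n ys"] K.list_sum_closed[OF cl[OF ys]] ys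
      by (simp add: K.list_sum_append eq[OF i] K.r_neg del: map_map)
  qed (use xs ys n in auto)
qed (use xs ys n in auto)

end

lemma tensor_eq_congruence: "formal_sum_congruence (tensor_eq K M N) (carrier M \<times> carrier N)"
  by (unfold_locales) (blast intro: tensor_eq.intros)+

lemma tensor3_eq_congruence: "formal_sum_congruence (tensor3_eq K M) (carrier M \<times> carrier M \<times> carrier M)"
  by (unfold_locales) (blast intro: tensor3_eq.intros)+

lemma tensor_eq_zero_right:
  fixes N (structure)
  assumes "module K M" "module K N" "a \<in> carrier M"
  shows "tensor_eq K M N [(a, \<zero>)] []"
proof -
  interpret M: module K M by fact
  interpret N: module K N by fact
  have "tensor_eq K M N [(\<zero>\<^bsub>K\<^esub> \<odot>\<^bsub>M\<^esub> a, \<zero>)] [(a, \<zero>\<^bsub>K\<^esub> \<odot> \<zero>)]"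
    by (rule tensor_eq.smult) (use assms(3) in auto)
  then have "tensor_eq K M N [(\<zero>\<^bsub>M\<^esub>, \<zero>)] [(a, \<zero>)]" using assms(3) by simp
  then show ?thesis using tensor_eq.sym tensor_eq.trans tensor_eq.zero[OF N.M.zero_closed] by blast
qed

lemma tensor_eq_sum_left:
  assumes "module K M" "module K N" "b \<in> carrier N" "set xs \<subseteq> carrier M"
  shows "tensor_eq K M N [(list_sum M xs, b)] (map (\<lambda>a. (a, b)) xs)"
  using assms(4)
proof (induction xs)
  case Nil
  show ?case using tensor_eq.zero[OF assms(3)] by simp
next
  case (Cons a xs)
  interpret M: module K M by fact
  have "tensor_eq K M N [(a \<oplus>\<^bsub>M\<^esub> list_sum M xs, b)] ([(a, b)] @ [(list_sum M xs, b)])"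
    using tensor_eq.add_left[of a M "list_sum M xs" b] Cons.prems assms(3) by (simp add: M.M.list_sum_closed)
  moreover have "tensor_eq K M N ([(a, b)] @ [(list_sum M xs, b)]) ([(a, b)] @ map (\<lambda>a. (a, b)) xs)"
    by (intro tensor_eq.append tensor_eq.refl) (use Cons assms(3) in auto)
  ultimately show ?case using tensor_eq.trans by fastforce
qed

text \<open>
  If \<open>a\<close> is a combination of the left factors \<open>a'\<close> of the other summands, bilinearity distributes
  \<open>a \<otimes> b\<close> over these summands.
\<close>

lemma tensor_eq_Cons_eliminate:
  fixes N (structure)
  assumes "module K M" "module K N" "b \<in> carrier N" "set ys \<subseteq> carrier M \<times> carrier N"
    and "\<And>a' b'. (a', b') \<in> set ys \<Longrightarrow> d a' b' \<in> carrier K"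
    and a: "a = tsum M ys (\<lambda>a' b'. d a' b' \<odot>\<^bsub>M\<^esub> a')"
  shows "tensor_eq K M N ((a, b) # ys) (map (\<lambda>(a', b'). (a', d a' b' \<odot> b \<oplus> b')) ys)"
proof -
  interpret M: module K M by fact
  interpret N: module K N by fact
  interpret formal_sum_congruence "tensor_eq K M N" "carrier M \<times> carrier N" by (rule tensor_eq_congruence)
  let ?f = "\<lambda>(a', b'). (d a' b' \<odot>\<^bsub>M\<^esub> a', b)"
  have in_ys: "(a', b') \<in> set ys \<Longrightarrow> a' \<in> carrier M \<and> b' \<in> carrier N" for a' b' using assms(4) by auto
  have "tensor_eq K M N [(a, b)] (map (\<lambda>a. (a, b)) (map (\<lambda>(a', b'). d a' b' \<odot>\<^bsub>M\<^esub> a') ys))"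
    unfolding a by (rule tensor_eq_sum_left) (use assms(1-5) in_ys in auto)
  then have "tensor_eq K M N [(a, b)] (map ?f ys)" by (simp add: comp_def case_prod_unfold)
  then have "tensor_eq K M N ([(a, b)] @ ys) (map ?f ys @ ys)"
    by (rule R_append) (rule R_refl, rule assms(4))
  also have "map ?f ys @ ys = map ?f ys @ map (\<lambda>y. y) ys" by simp
  also have "tensor_eq K M N (map ?f ys @ map (\<lambda>y. y) ys)
      (concat (map (\<lambda>y. [(\<lambda>(a', b'). (a', d a' b' \<odot> b \<oplus> b')) y]) ys))"
  proof (rule map_append)
    fix y assume y: "y \<in> set ys"
    obtain a' b' where y': "y = (a', b')" by (cases y)
    have c: "a' \<in> carrier M" "b' \<in> carrier N" "d a' b' \<in> carrier K" using in_ys assms(5) y y' by auto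
    have "tensor_eq K M N ([(d a' b' \<odot>\<^bsub>M\<^esub> a', b)] @ [(a', b')]) ([(a', d a' b' \<odot> b)] @ [(a', b')])"
      by (intro R_append tensor_eq.smult tensor_eq.refl) (use c assms(3) in auto)
    also have "tensor_eq K M N ([(a', d a' b' \<odot> b)] @ [(a', b')]) [(a', d a' b' \<odot> b \<oplus> b')]"
      using tensor_eq.sym[OF tensor_eq.add_right[of a' M "d a' b' \<odot> b" N b']] c assms(3) by simp
    finally show "?f y \<in> carrier M \<times> carrier N \<and> y \<in> carrier M \<times> carrier N \<and>
        tensor_eq K M N [?f y, y] [(\<lambda>(a', b'). (a', d a' b' \<odot> b \<oplus> b')) y]"
      using c assms(3) by (simp add: y')
  qed
  finally show ?thesis by (simp add: concat_map_singleton)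
qed

text \<open>
  Induction on the number of summands. If the first summand \<open>a \<otimes> b\<close> has \<open>b \<noteq> 0\<close>, some form of the
  family does not vanish at \<open>b\<close>; applying it to the right factors writes \<open>a\<close> as a combination of the
  other left factors, and \<open>tensor_eq_Cons_eliminate\<close> removes one summand.
\<close>

lemma tensor_eq_null:
  fixes K (structure)
  assumes "field K" "module K M" "separating K M E" "set xs \<subseteq> carrier M \<times> carrier M"
    and "\<And>e e'. e \<in> E \<Longrightarrow> e' \<in> E \<Longrightarrow> tsum K xs (\<lambda>a b. e a \<otimes> e' b) = \<zero>"
  shows "tensor_eq K M M xs []"
  using assms(4,5)
proof (induction "length xs" arbitrary: xs)
  case 0
  then show ?case by (simp add: tensor_eq.refl)
next
  case (Suc n)
  interpret K: field K by fact
  interpret M: module K M by fact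
  have G: "k_algebra K (ground K)" by (rule algebra_k_algebra[OF algebra_ground[OF K.cring_axioms]])
  have E: "e \<in> E \<Longrightarrow> linear_map K M (ground K) e" for e using assms(3) by (simp add: separating_def)
  note Ec = linear_mapD(1)[OF E, simplified]
  obtain a b ys where xs: "xs = (a, b) # ys" using Suc(2) by (cases xs) auto
  have ab: "a \<in> carrier M" "b \<in> carrier M" and ys: "set ys \<subseteq> carrier M \<times> carrier M" using Suc(3) xs by auto
  have in_ys: "(a', b') \<in> set ys \<Longrightarrow> a' \<in> carrier M \<and> b' \<in> carrier M" for a' b' using ys by auto
  note te = tensor_eq_tsum[OF _ assms(2,2) k_algebraD(1)[OF G] bilinear_mult[OF G E E], simplified]
  have "\<exists>zs. tensor_eq K M M xs zs \<and> length zs = n"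
  proof (cases "b = \<zero>\<^bsub>M\<^esub>")
    case True
    have "tensor_eq K M M ([(a, b)] @ ys) ([] @ ys)" unfolding True
      by (intro tensor_eq.append tensor_eq_zero_right tensor_eq.refl) (use assms(2) ab ys in auto)
    then show ?thesis using xs Suc(2) by auto
  next
    case False
    then obtain f where f: "f \<in> E" "f b \<noteq> \<zero>" using assms(3) ab by (auto simp: separating_def)
    define \<beta> where "\<beta> = inv (f b)"
    have \<beta>: "\<beta> \<in> carrier K" "f b \<otimes> \<beta> = \<one>"
      using f Ec[OF f(1) ab(2)] K.field_Units by (auto simp: \<beta>_def)
    \<comment> \<open>The coefficients solve \<open>e a \<cdot> f b + \<Sum> e a' \<cdot> f b' = 0\<close> for \<open>e a\<close>.\<close>
    define d where "d b' = \<ominus> (f b' \<otimes> \<beta>)" for b'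
    have dc: "b' \<in> carrier M \<Longrightarrow> d b' \<in> carrier K" for b' using Ec[OF f(1)] \<beta> by (simp add: d_def)
    have "a = tsum M ys (\<lambda>a' b'. d b' \<odot>\<^bsub>M\<^esub> a')"
    proof (rule separating_eqI[OF assms(2,3) ab(1)])
      show "tsum M ys (\<lambda>a' b'. d b' \<odot>\<^bsub>M\<^esub> a') \<in> carrier M" using in_ys dc by (auto intro!: M.M.tsum_closed)
      fix e assume e: "e \<in> E"
      define s where "s = tsum K ys (\<lambda>a' b'. e a' \<otimes> f b')"
      have s: "s \<in> carrier K" unfolding s_def using in_ys Ec[OF e] Ec[OF f(1)] by (auto intro!: K.tsum_closed)
      have "e a \<otimes> f b \<oplus> s = \<zero>" using Suc(4)[OF e f(1)] by (simp add: xs s_def)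
      then have "e a \<otimes> f b = \<ominus> s"
        using K.minus_equality[of "e a \<otimes> f b" s] s Ec[OF e ab(1)] Ec[OF f(1) ab(2)] by simp
      then have "e a \<otimes> f b \<otimes> \<beta> = \<ominus> s \<otimes> \<beta>" by simp
      then have "e a = s \<otimes> \<ominus> \<beta>"
        using s \<beta> Ec[OF e ab(1)] Ec[OF f(1) ab(2)] by (simp add: K.m_assoc K.l_minus K.r_minus)
      also have "\<dots> = tsum K ys (\<lambda>a' b'. e a' \<otimes> f b' \<otimes> \<ominus> \<beta>)"
        unfolding s_def by (rule K.tsum_l_distr) (use in_ys Ec[OF e] Ec[OF f(1)] \<beta> in auto)
      also have "\<dots> = tsum K ys (\<lambda>a' b'. e (d b' \<odot>\<^bsub>M\<^esub> a'))"
      proof (rule tsum_cong)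
        fix a' b' assume "(a', b') \<in> set ys"
        then have c: "a' \<in> carrier M" "b' \<in> carrier M" using in_ys by auto
        show "e a' \<otimes> f b' \<otimes> \<ominus> \<beta> = e (d b' \<odot>\<^bsub>M\<^esub> a')"
          using c dc Ec[OF e c(1)] Ec[OF f(1) c(2)] \<beta>
          by (simp add: linear_mapD(3)[OF E[OF e]] d_def K.m_ac K.l_minus K.r_minus)
      qed
      also have "\<dots> = e (tsum M ys (\<lambda>a' b'. d b' \<odot>\<^bsub>M\<^esub> a'))"
        using linear_map_tsum[OF assms(2) k_algebraD(1)[OF G] E[OF e], of ys "\<lambda>a' b'. d b' \<odot>\<^bsub>M\<^esub> a'"] in_ys dc by auto
      finally show "e a = e (tsum M ys (\<lambda>a' b'. d b' \<odot>\<^bsub>M\<^esub> a'))" .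
    qed
    from tensor_eq_Cons_eliminate[OF assms(2,2) ab(2) ys _ this] dc in_ys
    show ?thesis using xs Suc(2) by fastforce
  qed
  then obtain zs where zs: "tensor_eq K M M xs zs" "length zs = n" by blast
  have "tsum K zs (\<lambda>a b. e a \<otimes> e' b) = \<zero>" if "e \<in> E" "e' \<in> E" for e e'
    using te[OF zs(1) that] Suc(4)[OF that] by simp
  then have "tensor_eq K M M zs []"
    using zs(2) tensor_eq_set[OF zs(1) assms(2,2)] by (intro Suc(1)) auto
  then show ?case using zs(1) tensor_eq.trans by blast
qed

lemma tensor_eqI_separating:
  fixes M (structure)
  assumes "field K" "module K M" "separating K M E"
    and xs: "set xs \<subseteq> carrier M \<times> carrier M" and ys: "set ys \<subseteq> carrier M \<times> carrier M"
    and eq: "\<And>e e'. e \<in> E \<Longrightarrow> e' \<in> E \<Longrightarrow>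
      tsum K xs (\<lambda>a b. e a \<otimes>\<^bsub>K\<^esub> e' b) = tsum K ys (\<lambda>a b. e a \<otimes>\<^bsub>K\<^esub> e' b)"
  shows "tensor_eq K M M xs ys"
proof -
  interpret K: field K by fact
  interpret M: module K M by fact
  note E = separating_neg[OF assms(2,3)]
  interpret formal_sum_congruence "tensor_eq K M M" "carrier M \<times> carrier M" by (rule tensor_eq_congruence)
  show ?thesis
  proof (rule eqI_by_values[where I = "E \<times> E" and val = "\<lambda>(e, e') (a, b). e a \<otimes>\<^bsub>K\<^esub> e' b"
        and n = "\<lambda>(a, b). (\<ominus> a, b)", OF K.ring_axioms])
    fix y assume "y \<in> carrier M \<times> carrier M"
    then obtain a b where y: "y = (a, b)" and c: "a \<in> carrier M" "b \<in> carrier M" by blast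
    have "tensor_eq K M M [(\<ominus> a \<oplus> a, b)] [(\<ominus> a, b), (a, b)]"
      by (rule tensor_eq.add_left) (use c in auto)
    then have "tensor_eq K M M [(\<ominus> a, b), (a, b)] []"
      using c tensor_eq.zero[of b M K M] R_sym R_trans by (metis M.M.l_neg)
    then show "(\<lambda>(a, b). (\<ominus> a, b)) y \<in> carrier M \<times> carrier M \<and> tensor_eq K M M [(\<lambda>(a, b). (\<ominus> a, b)) y, y] []"
      using c by (simp add: y)
  qed (use xs ys eq in \<open>auto simp: E K.l_minus intro!: tensor_eq_null[OF assms(1-3)]\<close>)
qed

lemma tensor_eq_tensor3_eq:
  assumes "tensor_eq K M M xs ys" "module K M" "c \<in> carrier M"
  shows "tensor3_eq K M (map (\<lambda>(a, b). (a, b, c)) xs) (map (\<lambda>(a, b). (a, b, c)) ys)"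
  using assms(1)
proof induction
  case (refl xs)
  then show ?case using assms(3) by (intro tensor3_eq.refl) auto
next
  case (comm xs ys)
  show ?case unfolding map_append
    by (rule tensor3_eq.comm) (use comm assms(3) in auto)
qed (use assms(3) in \<open>auto intro: tensor3_eq.intros simp del: map_append simp: map_append[symmetric]\<close>,
     simp_all add: tensor3_eq.append)

lemma tensor3_eq_zero_right:
  fixes M (structure)
  assumes "module K M" "a \<in> carrier M" "b \<in> carrier M"
  shows "tensor3_eq K M [(a, b, \<zero>)] []"
proof -
  interpret M: module K M by fact
  have "tensor3_eq K M [(\<zero>\<^bsub>K\<^esub> \<odot> a, \<zero>, \<zero>)] [(a, \<zero>\<^bsub>K\<^esub> \<odot> \<zero>, \<zero>)]"
    by (rule tensor3_eq.smult12) (use assms in auto)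
  moreover have "tensor3_eq K M [(a, \<zero>\<^bsub>K\<^esub> \<odot> b, \<zero>)] [(a, b, \<zero>\<^bsub>K\<^esub> \<odot> \<zero>)]"
    by (rule tensor3_eq.smult23) (use assms in auto)
  ultimately have "tensor3_eq K M [(\<zero>, \<zero>, \<zero>)] [(a, b, \<zero>)]"
    using assms tensor3_eq.trans by (simp, blast)
  then show ?thesis
    using tensor3_eq.sym tensor3_eq.trans tensor3_eq.zero[of "\<zero>" M "\<zero>"] M.M.zero_closed by blast
qed

lemma tensor3_eq_Cons_eliminate:
  fixes M (structure)
  assumes "module K M" "c \<in> carrier M" "set ys \<subseteq> carrier M \<times> carrier M \<times> carrier M"
    and "\<And>c'. c' \<in> carrier M \<Longrightarrow> d c' \<in> carrier K"
    and "tensor_eq K M M [(a, b)] (map (\<lambda>(a', b', c'). (d c' \<odot> a', b')) ys)"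
  shows "tensor3_eq K M ((a, b, c) # ys) (map (\<lambda>(a', b', c'). (a', b', d c' \<odot> c \<oplus> c')) ys)"
proof -
  interpret M: module K M by fact
  interpret formal_sum_congruence "tensor3_eq K M" "carrier M \<times> carrier M \<times> carrier M"
    by (rule tensor3_eq_congruence)
  let ?f = "\<lambda>(a', b', c'). (d c' \<odot> a', b', c)"
  have "tensor3_eq K M [(a, b, c)] (map ?f ys)"
    using tensor_eq_tensor3_eq[OF assms(5,1,2)] by (simp add: comp_def case_prod_unfold)
  then have "tensor3_eq K M ([(a, b, c)] @ ys) (map ?f ys @ ys)"
    by (rule R_append) (rule R_refl, rule assms(3))
  also have "map ?f ys @ ys = map ?f ys @ map (\<lambda>y. y) ys" by simp
  also have "tensor3_eq K M (map ?f ys @ map (\<lambda>y. y) ys)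
      (concat (map (\<lambda>y. [(\<lambda>(a', b', c'). (a', b', d c' \<odot> c \<oplus> c')) y]) ys))"
  proof (rule map_append)
    fix y assume y: "y \<in> set ys"
    obtain a' b' c' where y': "y = (a', b', c')" by (cases y)
    have m: "a' \<in> carrier M" "b' \<in> carrier M" "c' \<in> carrier M" "d c' \<in> carrier K" using y y' assms(3,4) by auto
    have "tensor3_eq K M [(d c' \<odot> a', b', c)] [(a', d c' \<odot> b', c)]"
      by (rule tensor3_eq.smult12) (use m assms(2) in auto)
    also have "tensor3_eq K M \<dots> [(a', b', d c' \<odot> c)]"
      by (rule tensor3_eq.smult23) (use m assms(2) in auto)
    finally have "tensor3_eq K M ([(d c' \<odot> a', b', c)] @ [y]) ([(a', b', d c' \<odot> c)] @ [y])"
      by (intro R_append R_refl) (use m y' in auto)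
    also have "tensor3_eq K M ([(a', b', d c' \<odot> c)] @ [y]) [(a', b', d c' \<odot> c \<oplus> c')]"
      using R_sym[OF tensor3_eq.add3[of a' M b' "d c' \<odot> c" c']] m assms(2) by (simp add: y')
    finally show "?f y \<in> carrier M \<times> carrier M \<times> carrier M \<and> y \<in> carrier M \<times> carrier M \<times> carrier M \<and>
        tensor3_eq K M [?f y, y] [(\<lambda>(a', b', c'). (a', b', d c' \<odot> c \<oplus> c')) y]"
      using m assms(2) by (simp add: y')
  qed
  finally show ?thesis by (simp add: concat_map_singleton)
qed

text \<open>
  As for two factors. Applying a form that does not vanish at \<open>c\<close> to the last factors leaves an
  identity between tensors with two factors, which \<open>tensor_eqI_separating\<close> turns into an
  equality of tensors.
\<close>

lemma tensor3_eq_null: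
  fixes K (structure)
  assumes "field K" "module K M" "separating K M E" "set xs \<subseteq> carrier M \<times> carrier M \<times> carrier M"
    and "\<And>e e' e''. e \<in> E \<Longrightarrow> e' \<in> E \<Longrightarrow> e'' \<in> E \<Longrightarrow>
      tsum K xs (\<lambda>a (b, c). e a \<otimes> e' b \<otimes> e'' c) = \<zero>"
  shows "tensor3_eq K M xs []"
  using assms(4,5)
proof (induction "length xs" arbitrary: xs)
  case 0
  then show ?case by (simp add: tensor3_eq.refl)
next
  case (Suc n)
  interpret K: field K by fact
  interpret M: module K M by fact
  have G: "k_algebra K (ground K)" by (rule algebra_k_algebra[OF algebra_ground[OF K.cring_axioms]])
  have E: "e \<in> E \<Longrightarrow> linear_map K M (ground K) e" for e using assms(3) by (simp add: separating_def)
  note Ec = linear_mapD(1)[OF E, simplified]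
  obtain a b c ys where xs: "xs = (a, b, c) # ys" using Suc(2) by (cases xs) auto
  have abc: "a \<in> carrier M" "b \<in> carrier M" "c \<in> carrier M" and ys: "set ys \<subseteq> carrier M \<times> carrier M \<times> carrier M"
    using Suc(3) xs by auto
  have in_ys: "(a', b', c') \<in> set ys \<Longrightarrow> a' \<in> carrier M \<and> b' \<in> carrier M \<and> c' \<in> carrier M" for a' b' c' using ys by auto
  note te = tensor3_eq_tsum[OF _ assms(2) k_algebraD(1)[OF G] trilinear_mult[OF G E E E], simplified]
  have "\<exists>zs. tensor3_eq K M xs zs \<and> length zs = n"
  proof (cases "c = \<zero>\<^bsub>M\<^esub>")
    case True
    have "tensor3_eq K M ([(a, b, c)] @ ys) ([] @ ys)" unfolding True
      by (intro tensor3_eq.append tensor3_eq_zero_right tensor3_eq.refl) (use assms(2) abc ys in auto)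
    then show ?thesis using xs Suc(2) by auto
  next
    case False
    then obtain f where f: "f \<in> E" "f c \<noteq> \<zero>" using assms(3) abc by (auto simp: separating_def)
    define \<gamma> where "\<gamma> = inv (f c)"
    have \<gamma>: "\<gamma> \<in> carrier K" "f c \<otimes> \<gamma> = \<one>"
      using f Ec[OF f(1) abc(3)] K.field_Units by (auto simp: \<gamma>_def)
    define d where "d c' = \<ominus> (f c' \<otimes> \<gamma>)" for c'
    have dc: "c' \<in> carrier M \<Longrightarrow> d c' \<in> carrier K" for c' using Ec[OF f(1)] \<gamma> by (simp add: d_def)
    let ?zs = "map (\<lambda>(a', b', c'). (d c' \<odot>\<^bsub>M\<^esub> a', b')) ys"
    have "tensor_eq K M M [(a, b)] ?zs"
    proof (rule tensor_eqI_separating[OF assms(1-3)])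
      show "set ?zs \<subseteq> carrier M \<times> carrier M" using in_ys dc by fastforce
      fix e e' assume e: "e \<in> E" "e' \<in> E"
      note Ecs = Ec[OF e(1)] Ec[OF e(2)] Ec[OF f(1)]
      define s where "s = tsum K ys (\<lambda>a' (b', c'). e a' \<otimes> e' b' \<otimes> f c')"
      have s: "s \<in> carrier K" unfolding s_def using in_ys Ecs by (intro K.tsum_closed) auto
      define u where "u = e a \<otimes> e' b"
      have u: "u \<in> carrier K" using Ecs abc by (simp add: u_def)
      have "u \<otimes> f c \<oplus> s = \<zero>"
        using Suc(4)[OF e f(1)] by (simp add: xs s_def u_def)
      then have "u \<otimes> f c = \<ominus> s"
        using K.minus_equality[of "u \<otimes> f c" s] s u Ecs abc by simp
      then have "u \<otimes> f c \<otimes> \<gamma> = \<ominus> s \<otimes> \<gamma>" by simp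
      then have "u = s \<otimes> \<ominus> \<gamma>"
        using s u \<gamma> Ecs abc by (simp add: K.m_assoc K.l_minus K.r_minus)
      also have "\<dots> = tsum K ys (\<lambda>a' p. (case p of (b', c') \<Rightarrow> e a' \<otimes> e' b' \<otimes> f c') \<otimes> \<ominus> \<gamma>)"
        unfolding s_def by (rule K.tsum_l_distr) (use in_ys Ecs \<gamma> in auto)
      also have "\<dots> = tsum K ys (\<lambda>a' (b', c'). e (d c' \<odot>\<^bsub>M\<^esub> a') \<otimes> e' b')"
      proof (rule tsum_cong)
        fix a' p assume "(a', p) \<in> set ys"
        moreover obtain b' c' where p: "p = (b', c')" by (cases p)
        ultimately have m: "a' \<in> carrier M" "b' \<in> carrier M" "c' \<in> carrier M" using in_ys by auto
        show "(case p of (b', c') \<Rightarrow> e a' \<otimes> e' b' \<otimes> f c') \<otimes> \<ominus> \<gamma> =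
            (case p of (b', c') \<Rightarrow> e (d c' \<odot>\<^bsub>M\<^esub> a') \<otimes> e' b')"
          using m dc Ecs \<gamma>
          by (simp add: p linear_mapD(3)[OF E[OF e(1)]] d_def K.m_ac K.l_minus K.r_minus)
      qed
      also have "\<dots> = tsum K ?zs (\<lambda>a b. e a \<otimes> e' b)"
        by (simp add: comp_def case_prod_unfold)
      finally show "tsum K [(a, b)] (\<lambda>a b. e a \<otimes> e' b) = tsum K ?zs (\<lambda>a b. e a \<otimes> e' b)"
        using u by (simp add: u_def)
    qed (use abc in auto)
    from tensor3_eq_Cons_eliminate[OF assms(2) abc(3) ys dc this]
    show ?thesis using xs Suc(2) by fastforce
  qed
  then obtain zs where zs: "tensor3_eq K M xs zs" "length zs = n" by blast
  have "tsum K zs (\<lambda>a (b, c). e a \<otimes> e' b \<otimes> e'' c) = \<zero>" if "e \<in> E" "e' \<in> E" "e'' \<in> E" for e e' e''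
    using te[OF zs(1) that] Suc(4)[OF that] by simp
  then have "tensor3_eq K M zs []"
    using zs(2) tensor3_eq_set[OF zs(1) assms(2)] by (intro Suc(1)) auto
  then show ?case using zs(1) tensor3_eq.trans by blast
qed

lemma tensor3_eqI_separating:
  fixes M (structure)
  assumes "field K" "module K M" "separating K M E"
    and xs: "set xs \<subseteq> carrier M \<times> carrier M \<times> carrier M" and ys: "set ys \<subseteq> carrier M \<times> carrier M \<times> carrier M"
    and eq: "\<And>e e' e''. e \<in> E \<Longrightarrow> e' \<in> E \<Longrightarrow> e'' \<in> E \<Longrightarrow>
      tsum K xs (\<lambda>a (b, c). e a \<otimes>\<^bsub>K\<^esub> e' b \<otimes>\<^bsub>K\<^esub> e'' c) = tsum K ys (\<lambda>a (b, c). e a \<otimes>\<^bsub>K\<^esub> e' b \<otimes>\<^bsub>K\<^esub> e'' c)"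
  shows "tensor3_eq K M xs ys"
proof -
  interpret K: field K by fact
  interpret M: module K M by fact
  note E = separating_neg[OF assms(2,3)]
  interpret formal_sum_congruence "tensor3_eq K M" "carrier M \<times> carrier M \<times> carrier M"
    by (rule tensor3_eq_congruence)
  show ?thesis
  proof (rule eqI_by_values[where I = "E \<times> E \<times> E" and n = "\<lambda>(a, p). (\<ominus> a, p)"
        and val = "\<lambda>(e, e', e'') (a, b, c). e a \<otimes>\<^bsub>K\<^esub> e' b \<otimes>\<^bsub>K\<^esub> e'' c", OF K.ring_axioms])
    fix y assume "y \<in> carrier M \<times> carrier M \<times> carrier M"
    then obtain a b c where y: "y = (a, b, c)" and c: "a \<in> carrier M" "b \<in> carrier M" "c \<in> carrier M" by blast
    have "tensor3_eq K M [(\<ominus> a \<oplus> a, b, c)] [(\<ominus> a, b, c), (a, b, c)]"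
      by (rule tensor3_eq.add1) (use c in auto)
    then have "tensor3_eq K M [(\<ominus> a, b, c), (a, b, c)] []"
      using c tensor3_eq.zero[of b M c K] R_sym R_trans by (metis M.M.l_neg)
    then show "(\<lambda>(a, p). (\<ominus> a, p)) y \<in> carrier M \<times> carrier M \<times> carrier M \<and>
        tensor3_eq K M [(\<lambda>(a, p). (\<ominus> a, p)) y, y] []"
      using c by (simp add: y)
  qed (use xs ys eq in \<open>auto simp: E K.l_minus intro!: tensor3_eq_null[OF assms(1-3)]\<close>)
qed

section \<open>The universal measuring coalgebra as a space of functions on words\<close>

definition forms :: "'k ring \<Rightarrow> ('k, 'a) module \<Rightarrow> ('a \<Rightarrow> 'k) set" where
  "forms K A = {\<phi>. linear_map K A (ground K) \<phi>}"

abbreviation letters :: "'k ring \<Rightarrow> ('k, 'a) module \<Rightarrow> ('k, 't) bialg \<Rightarrow> ('t \<times> ('a \<Rightarrow> 'k)) set" where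
  "letters K A T \<equiv> carrier T \<times> forms K A"

text \<open>
  The point of \<open>A\<close> that is encoded by the values of \<open>y\<close> at the letters \<open>(t, \<phi>)\<close>; linear forms separate
  points, so there is at most one. A bare function on letters would only give a point of the bidual
  of \<open>A\<close>.
\<close>

definition theta :: "'k ring \<Rightarrow> ('k, 'a) module \<Rightarrow> ('k, 't, 'a) univ_carrier \<Rightarrow> 't \<Rightarrow> 'a" where
  "theta K A y t = (THE e. e \<in> carrier A \<and> (\<forall>\<phi>\<in>forms K A. y [(t, \<phi>)] = \<phi> e))"

text \<open>
  The conditions on a single function \<open>y\<close>. Words with letters outside of the alphabet get the value
  zero, so that functions on words are equal as soon as they agree on words in the alphabet.
\<close>

definition measuring_functional ::
    "'k ring \<Rightarrow> ('k, 'a) module \<Rightarrow> ('k, 't) bialg \<Rightarrow> ('k, 't, 'a) univ_carrier \<Rightarrow> bool" where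
  "measuring_functional K A T y \<longleftrightarrow>
    (\<forall>w. y w \<in> carrier K) \<and> (\<forall>w. w \<notin> lists (letters K A T) \<longrightarrow> y w = \<zero>\<^bsub>K\<^esub>) \<and>
    linear_map K T A (theta K A y) \<and>
    (\<forall>t\<in>carrier T. \<forall>\<phi>\<in>forms K A. y [(t, \<phi>)] = \<phi> (theta K A y t)) \<and>
    theta K A y \<one>\<^bsub>T\<^esub> = y [] \<odot>\<^bsub>A\<^esub> \<one>\<^bsub>A\<^esub>"

text \<open>
  The list \<open>xs\<close> is a comultiplication of \<open>y\<close>, for which \<open>\<theta>\<close> is a measuring.
\<close>

definition measuring_splitting ::
    "'k ring \<Rightarrow> ('k, 'a) module \<Rightarrow> ('k, 't) bialg \<Rightarrow> ('k, 't, 'a) univ_carrier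
      \<Rightarrow> (('k, 't, 'a) univ_carrier \<times> ('k, 't, 'a) univ_carrier) list \<Rightarrow> bool" where
  "measuring_splitting K A T y xs \<longleftrightarrow>
    (\<forall>u v. y (u @ v) = tsum K xs (\<lambda>a b. a u \<otimes>\<^bsub>K\<^esub> b v)) \<and>
    (\<forall>t\<in>carrier T. \<forall>s\<in>carrier T.
      theta K A y (t \<otimes>\<^bsub>T\<^esub> s) = tsum A xs (\<lambda>a b. theta K A a t \<otimes>\<^bsub>A\<^esub> theta K A b s))"

text \<open>
  The largest set of functions whose members split inside the set. Its members are
  representative functions on the free monoid of words, so it is a coalgebra of the kind of a
  finite dual.
\<close>

definition measuring_space :: "'k ring \<Rightarrow> ('k, 'a) module \<Rightarrow> ('k, 't) bialg \<Rightarrow> ('k, 't, 'a) univ_carrier set" where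
  "measuring_space K A T = \<Union>{D. \<forall>y\<in>D. measuring_functional K A T y \<and>
    (\<exists>xs. set xs \<subseteq> D \<times> D \<and> measuring_splitting K A T y xs)}"

definition word_comult :: "'k ring \<Rightarrow> ('k, 'a) module \<Rightarrow> ('k, 't) bialg \<Rightarrow> ('k, 't, 'a) univ_carrier
      \<Rightarrow> (('k, 't, 'a) univ_carrier \<times> ('k, 't, 'a) univ_carrier) list" where
  "word_comult K A T y = (SOME xs. set xs \<subseteq> measuring_space K A T \<times> measuring_space K A T \<and>
    measuring_splitting K A T y xs)"

text \<open>
  The product \<open>m\<close> and the unit \<open>e\<close> are parameters because the product is constructed from the
  convolution algebra of this coalgebra.
\<close>

definition measuring_bialg ::
    "'k ring \<Rightarrow> ('k, 'a) module \<Rightarrow> ('k, 't) bialg \<Rightarrow>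
      (('k, 't, 'a) univ_carrier \<Rightarrow> ('k, 't, 'a) univ_carrier \<Rightarrow> ('k, 't, 'a) univ_carrier) \<Rightarrow>
      ('k, 't, 'a) univ_carrier \<Rightarrow> ('k, ('k, 't, 'a) univ_carrier) bialg" where
  "measuring_bialg K A T m e = \<lparr>carrier = measuring_space K A T, mult = m, one = e,
    zero = (\<lambda>w. \<zero>\<^bsub>K\<^esub>), add = (\<lambda>x y w. x w \<oplus>\<^bsub>K\<^esub> y w), smult = (\<lambda>c x w. c \<otimes>\<^bsub>K\<^esub> x w),
    comult = word_comult K A T, counit = (\<lambda>y. y [])\<rparr>"

lemma measuring_bialg_simps [simp]:
  "carrier (measuring_bialg K A T m e) = measuring_space K A T"
  "mult (measuring_bialg K A T m e) = m" "one (measuring_bialg K A T m e) = e"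
  "zero (measuring_bialg K A T m e) = (\<lambda>w. \<zero>\<^bsub>K\<^esub>)"
  "add (measuring_bialg K A T m e) = (\<lambda>x y w. x w \<oplus>\<^bsub>K\<^esub> y w)"
  "smult (measuring_bialg K A T m e) = (\<lambda>c x w. c \<otimes>\<^bsub>K\<^esub> x w)"
  "comult (measuring_bialg K A T m e) = word_comult K A T"
  "counit (measuring_bialg K A T m e) = (\<lambda>y. y [])"
  by (simp_all add: measuring_bialg_def)

locale measuring_data =
  fixes K :: "'k ring" (structure) and A :: "('k, 'a) module" and T :: "('k, 't) bialg"
  assumes field_K: "field K" and algebra_A: "algebra K A" and bialgebra_T: "bialgebra K T"
begin

sublocale K: field K by (rule field_K)
sublocale A: algebra K A by (rule algebra_A)

lemma k_algebra_T: "k_algebra K T" and coalgebra_T: "coalgebra K T"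
  using bialgebra_T by (simp_all add: bialgebra_def)

sublocale T: ring T by (rule k_algebraD(2)[OF k_algebra_T])

lemma module_T: "module K T" by (rule k_algebraD(1)[OF k_algebra_T])

lemma k_algebra_A: "k_algebra K A" by (rule algebra_k_algebra[OF algebra_A])

lemma module_A: "module K A" by (rule A.module_axioms)

lemma k_algebra_ground: "k_algebra K (ground K)"
  by (rule algebra_k_algebra[OF algebra_ground[OF K.cring_axioms]])

lemma module_ground: "module K (ground K)" by (rule k_algebraD(1)[OF k_algebra_ground])

abbreviation "U \<equiv> measuring_space K A T"
abbreviation "\<theta> \<equiv> theta K A"
abbreviation "\<Delta> \<equiv> word_comult K A T"

lemma form_linear: "\<phi> \<in> forms K A \<Longrightarrow> linear_map K A (ground K) \<phi>" by (simp add: forms_def)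

lemma form_simps:
  assumes "\<phi> \<in> forms K A" "a \<in> carrier A"
  shows "\<phi> a \<in> carrier K" "b \<in> carrier A \<Longrightarrow> \<phi> (a \<oplus>\<^bsub>A\<^esub> b) = \<phi> a \<oplus> \<phi> b"
    "c \<in> carrier K \<Longrightarrow> \<phi> (c \<odot>\<^bsub>A\<^esub> a) = c \<otimes> \<phi> a"
  using linear_mapD[OF form_linear[OF assms(1)]] assms(2) by auto

lemma form_zero: "\<phi> \<in> forms K A \<Longrightarrow> \<phi> \<zero>\<^bsub>A\<^esub> = \<zero>"
  using linear_map_zero[OF module_A module_ground form_linear] by simp

lemma form_eqI:
  "a \<in> carrier A \<Longrightarrow> b \<in> carrier A \<Longrightarrow> (\<And>\<phi>. \<phi> \<in> forms K A \<Longrightarrow> \<phi> a = \<phi> b) \<Longrightarrow> a = b"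
  using separating_eqI[OF module_A separating_linear_forms[OF field_K module_A]] by (simp add: forms_def)

lemma theta_eqI:
  assumes "e \<in> carrier A" "\<And>\<phi>. \<phi> \<in> forms K A \<Longrightarrow> y [(t, \<phi>)] = \<phi> e"
  shows "\<theta> y t = e"
  unfolding theta_def by (rule the_equality) (use assms form_eqI in auto)

lemma U_D:
  assumes "y \<in> U"
  shows "measuring_functional K A T y" "\<exists>xs. set xs \<subseteq> U \<times> U \<and> measuring_splitting K A T y xs"
proof -
  obtain D where D: "y \<in> D" "\<forall>y\<in>D. measuring_functional K A T y \<and>
      (\<exists>xs. set xs \<subseteq> D \<times> D \<and> measuring_splitting K A T y xs)"
    using assms by (auto simp: measuring_space_def)
  then have "D \<subseteq> U" unfolding measuring_space_def by (intro Union_upper CollectI)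
  then show "measuring_functional K A T y" "\<exists>xs. set xs \<subseteq> U \<times> U \<and> measuring_splitting K A T y xs"
    using D by blast+
qed

text \<open>
  Coinduction: it suffices to split the members of \<open>D\<close> into members of \<open>D\<close> and of \<open>U\<close>.
\<close>

lemma U_coinduct:
  assumes "y \<in> D" "\<And>y. y \<in> D \<Longrightarrow> measuring_functional K A T y"
    and "\<And>y. y \<in> D \<Longrightarrow> \<exists>xs. set xs \<subseteq> (D \<union> U) \<times> (D \<union> U) \<and> measuring_splitting K A T y xs"
  shows "y \<in> U"
proof -
  have "measuring_functional K A T z \<and> (\<exists>xs. set xs \<subseteq> (D \<union> U) \<times> (D \<union> U) \<and> measuring_splitting K A T z xs)"
    if z: "z \<in> D \<union> U" for z
  proof (cases "z \<in> D")
    case True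
    then show ?thesis using assms(2,3) by simp
  next
    case False
    then have "z \<in> U" using z by simp
    from U_D[OF this] show ?thesis by blast
  qed
  then have "y \<in> \<Union>{D. \<forall>y\<in>D. measuring_functional K A T y \<and>
      (\<exists>xs. set xs \<subseteq> D \<times> D \<and> measuring_splitting K A T y xs)}"
    using assms(1) by (intro UnionI[of "D \<union> U"] CollectI ballI) simp_all
  then show ?thesis by (simp only: measuring_space_def)
qed

lemma U_props:
  assumes "y \<in> U"
  shows "y w \<in> carrier K" "w \<notin> lists (letters K A T) \<Longrightarrow> y w = \<zero>"
    and "linear_map K T A (\<theta> y)"
    and "t \<in> carrier T \<Longrightarrow> \<phi> \<in> forms K A \<Longrightarrow> y [(t, \<phi>)] = \<phi> (\<theta> y t)"
    and "\<theta> y \<one>\<^bsub>T\<^esub> = y [] \<odot>\<^bsub>A\<^esub> \<one>\<^bsub>A\<^esub>"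
    and "t \<in> carrier T \<Longrightarrow> \<theta> y t \<in> carrier A"
proof -
  note f = U_D(1)[OF assms, unfolded measuring_functional_def]
  show "y w \<in> carrier K" "w \<notin> lists (letters K A T) \<Longrightarrow> y w = \<zero>" "linear_map K T A (\<theta> y)"
    "t \<in> carrier T \<Longrightarrow> \<phi> \<in> forms K A \<Longrightarrow> y [(t, \<phi>)] = \<phi> (\<theta> y t)"
    "\<theta> y \<one>\<^bsub>T\<^esub> = y [] \<odot>\<^bsub>A\<^esub> \<one>\<^bsub>A\<^esub>"
    using f by simp_all
  then show "t \<in> carrier T \<Longrightarrow> \<theta> y t \<in> carrier A" by (simp add: linear_mapD(1))
qed

lemma comult_props:
  assumes "y \<in> U"
  shows "set (\<Delta> y) \<subseteq> U \<times> U" "y (u @ v) = tsum K (\<Delta> y) (\<lambda>a b. a u \<otimes> b v)"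
    and "t \<in> carrier T \<Longrightarrow> s \<in> carrier T \<Longrightarrow>
      \<theta> y (t \<otimes>\<^bsub>T\<^esub> s) = tsum A (\<Delta> y) (\<lambda>a b. \<theta> a t \<otimes>\<^bsub>A\<^esub> \<theta> b s)"
proof -
  note c = someI_ex[OF U_D(2)[OF assms], folded word_comult_def, unfolded measuring_splitting_def]
  show "set (\<Delta> y) \<subseteq> U \<times> U" "y (u @ v) = tsum K (\<Delta> y) (\<lambda>a b. a u \<otimes> b v)"
    using c by blast+
  show "t \<in> carrier T \<Longrightarrow> s \<in> carrier T \<Longrightarrow>
      \<theta> y (t \<otimes>\<^bsub>T\<^esub> s) = tsum A (\<Delta> y) (\<lambda>a b. \<theta> a t \<otimes>\<^bsub>A\<^esub> \<theta> b s)"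
    using c by simp
qed

lemma comult_in_U: "(a, b) \<in> set (\<Delta> y) \<Longrightarrow> y \<in> U \<Longrightarrow> a \<in> U \<and> b \<in> U"
  using comult_props(1) by blast

lemma measuring_functionalI:
  assumes "\<And>w. y w \<in> carrier K" "\<And>w. w \<notin> lists (letters K A T) \<Longrightarrow> y w = \<zero>"
    and "linear_map K T A h" "\<And>t \<phi>. t \<in> carrier T \<Longrightarrow> \<phi> \<in> forms K A \<Longrightarrow> y [(t, \<phi>)] = \<phi> (h t)"
    and "h \<one>\<^bsub>T\<^esub> = y [] \<odot>\<^bsub>A\<^esub> \<one>\<^bsub>A\<^esub>"
  shows "measuring_functional K A T y"
proof -
  have h: "\<theta> y t = h t" if "t \<in> carrier T" for t
    by (rule theta_eqI) (use that assms(4) linear_mapD(1)[OF assms(3)] in auto)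
  have "linear_map K T A (\<theta> y) = linear_map K T A h" by (rule linear_map_cong[OF module_T h])
  then show ?thesis using assms by (simp add: measuring_functional_def h)
qed

subsection \<open>The coalgebra structure\<close>

lemma zero_in_U: "(\<lambda>w. \<zero>) \<in> U"
proof (rule U_coinduct[where D = "{\<lambda>w. \<zero>}"])
  fix y :: "('k, 't, 'a) univ_carrier" assume "y \<in> {\<lambda>w. \<zero>}"
  then have y: "y = (\<lambda>w. \<zero>)" by simp
  have th: "\<theta> y t = \<zero>\<^bsub>A\<^esub>" for t by (rule theta_eqI) (auto simp: form_zero y)
  show "measuring_functional K A T y"
    by (rule measuring_functionalI[where h = "\<lambda>t. \<zero>\<^bsub>A\<^esub>"])
      (auto simp: y form_zero intro: linear_map_const_zero[OF module_A])
  show "\<exists>xs. set xs \<subseteq> ({\<lambda>w. \<zero>} \<union> U) \<times> ({\<lambda>w. \<zero>} \<union> U) \<and> measuring_splitting K A T y xs"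
    by (rule exI[of _ "[]"]) (simp add: measuring_splitting_def th, simp add: y)
qed simp

lemma theta_add:
  assumes "x \<in> U" "y \<in> U" "t \<in> carrier T"
  shows "\<theta> (\<lambda>w. x w \<oplus> y w) t = \<theta> x t \<oplus>\<^bsub>A\<^esub> \<theta> y t"
  by (rule theta_eqI) (use assms in \<open>auto simp: form_simps U_props(4)[OF assms(1)] U_props(4)[OF assms(2)] U_props(6)\<close>)

lemma theta_smult:
  assumes "x \<in> U" "c \<in> carrier K" "t \<in> carrier T"
  shows "\<theta> (\<lambda>w. c \<otimes> x w) t = c \<odot>\<^bsub>A\<^esub> \<theta> x t"
  by (rule theta_eqI) (use assms in \<open>auto simp: form_simps U_props(4)[OF assms(1)] U_props(6)\<close>)

lemma add_in_U:
  assumes "x \<in> U" "y \<in> U"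
  shows "(\<lambda>w. x w \<oplus> y w) \<in> U"
proof -
  let ?z = "\<lambda>w. x w \<oplus> y w"
  have "measuring_functional K A T ?z"
  proof (rule measuring_functionalI[where h = "\<lambda>t. \<theta> x t \<oplus>\<^bsub>A\<^esub> \<theta> y t"])
    show "linear_map K T A (\<lambda>t. \<theta> x t \<oplus>\<^bsub>A\<^esub> \<theta> y t)"
      by (rule linear_map_add[OF module_A]) (use assms U_props(3) in auto)
    show "\<theta> x \<one>\<^bsub>T\<^esub> \<oplus>\<^bsub>A\<^esub> \<theta> y \<one>\<^bsub>T\<^esub> = ?z [] \<odot>\<^bsub>A\<^esub> \<one>\<^bsub>A\<^esub>"
      by (simp add: U_props(5)[OF assms(1)] U_props(5)[OF assms(2)] U_props(1)[OF assms(1)]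
        U_props(1)[OF assms(2)] A.smult_l_distr)
  qed (use assms in \<open>auto simp: U_props form_simps\<close>)
  moreover have "measuring_splitting K A T ?z (\<Delta> x @ \<Delta> y)"
    unfolding measuring_splitting_def
  proof (intro conjI allI ballI)
    fix u v
    have "tsum K (\<Delta> x @ \<Delta> y) (\<lambda>a b. a u \<otimes> b v) =
        tsum K (\<Delta> x) (\<lambda>a b. a u \<otimes> b v) \<oplus> tsum K (\<Delta> y) (\<lambda>a b. a u \<otimes> b v)"
      by (rule K.tsum_append) (use comult_in_U assms in \<open>auto simp: U_props(1)\<close>)
    then show "?z (u @ v) = tsum K (\<Delta> x @ \<Delta> y) (\<lambda>a b. a u \<otimes> b v)"
      using comult_props(2)[OF assms(1), of u v] comult_props(2)[OF assms(2), of u v] by simp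
  next
    fix t s assume ts: "t \<in> carrier T" "s \<in> carrier T"
    have c: "(a, b) \<in> set (\<Delta> z) \<Longrightarrow> z \<in> U \<Longrightarrow> \<theta> a t \<otimes>\<^bsub>A\<^esub> \<theta> b s \<in> carrier A" for a b z
      using comult_in_U[of a b z] U_props(6) ts by simp
    have "tsum A (\<Delta> x @ \<Delta> y) (\<lambda>a b. \<theta> a t \<otimes>\<^bsub>A\<^esub> \<theta> b s) =
        tsum A (\<Delta> x) (\<lambda>a b. \<theta> a t \<otimes>\<^bsub>A\<^esub> \<theta> b s) \<oplus>\<^bsub>A\<^esub> tsum A (\<Delta> y) (\<lambda>a b. \<theta> a t \<otimes>\<^bsub>A\<^esub> \<theta> b s)"
      by (rule A.tsum_append) (use c assms in auto)
    then show "\<theta> ?z (t \<otimes>\<^bsub>T\<^esub> s) = tsum A (\<Delta> x @ \<Delta> y) (\<lambda>a b. \<theta> a t \<otimes>\<^bsub>A\<^esub> \<theta> b s)"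
      using ts by (simp add: theta_add assms comult_props(3))
  qed
  moreover have "set (\<Delta> x @ \<Delta> y) \<subseteq> U \<times> U" using comult_props(1) assms by auto
  ultimately show ?thesis
    by (intro U_coinduct[where D = "{?z}"]) blast+
qed

lemma smult_in_U:
  assumes "c \<in> carrier K" "x \<in> U"
  shows "(\<lambda>w. c \<otimes> x w) \<in> U"
proof (rule U_coinduct[where D = "{\<lambda>w. c \<otimes> x w | x. x \<in> U}"])
  let ?D = "{\<lambda>w. c \<otimes> x w | x. x \<in> U}"
  fix y assume "y \<in> ?D"
  then obtain x where x: "x \<in> U" and y: "y = (\<lambda>w. c \<otimes> x w)" by blast
  show "measuring_functional K A T y" unfolding y
  proof (rule measuring_functionalI[where h = "\<lambda>t. c \<odot>\<^bsub>A\<^esub> \<theta> x t"])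
    show "linear_map K T A (\<lambda>t. c \<odot>\<^bsub>A\<^esub> \<theta> x t)"
      by (rule linear_map_smult[OF module_A]) (use assms x U_props(3) in auto)
    show "c \<odot>\<^bsub>A\<^esub> \<theta> x \<one>\<^bsub>T\<^esub> = (c \<otimes> x []) \<odot>\<^bsub>A\<^esub> \<one>\<^bsub>A\<^esub>"
      by (simp add: U_props(5)[OF x] U_props(1)[OF x] assms A.smult_assoc1)
  qed (use assms x in \<open>auto simp: U_props form_simps\<close>)
  let ?xs = "map (\<lambda>(a, b). (\<lambda>w. c \<otimes> a w, b)) (\<Delta> x)"
  have "measuring_splitting K A T y ?xs"
    unfolding measuring_splitting_def
  proof (intro conjI allI ballI)
    fix u v
    have "tsum K ?xs (\<lambda>a b. a u \<otimes> b v) = tsum K (\<Delta> x) (\<lambda>a b. c \<otimes> a u \<otimes> b v)"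
      by (rule tsum_map)
    also have "\<dots> = tsum K (\<Delta> x) (\<lambda>a b. c \<otimes> (a u \<otimes> b v))"
      by (rule tsum_cong) (use comult_in_U x assms in \<open>auto simp: U_props(1) K.m_assoc\<close>)
    also have "\<dots> = c \<otimes> tsum K (\<Delta> x) (\<lambda>a b. a u \<otimes> b v)"
      by (rule K.tsum_r_distr[symmetric]) (use comult_in_U x assms in \<open>auto simp: U_props(1)\<close>)
    finally show "y (u @ v) = tsum K ?xs (\<lambda>a b. a u \<otimes> b v)"
      using comult_props(2)[OF x, of u v] by (simp add: y)
  next
    fix t s assume ts: "t \<in> carrier T" "s \<in> carrier T"
    have c: "(a, b) \<in> set (\<Delta> x) \<Longrightarrow> a \<in> U \<and> \<theta> a t \<in> carrier A \<and> \<theta> b s \<in> carrier A" for a b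
      using comult_in_U[of a b x] U_props(6) ts x by simp
    have "tsum A ?xs (\<lambda>a b. \<theta> a t \<otimes>\<^bsub>A\<^esub> \<theta> b s) = tsum A (\<Delta> x) (\<lambda>a b. \<theta> (\<lambda>w. c \<otimes> a w) t \<otimes>\<^bsub>A\<^esub> \<theta> b s)"
      by (rule tsum_map)
    also have "\<dots> = tsum A (\<Delta> x) (\<lambda>a b. c \<odot>\<^bsub>A\<^esub> (\<theta> a t \<otimes>\<^bsub>A\<^esub> \<theta> b s))"
      by (rule tsum_cong) (use c assms ts in \<open>auto simp: theta_smult A.smult_assoc2\<close>)
    also have "\<dots> = c \<odot>\<^bsub>A\<^esub> tsum A (\<Delta> x) (\<lambda>a b. \<theta> a t \<otimes>\<^bsub>A\<^esub> \<theta> b s)"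
      by (rule A.tsum_smult[symmetric]) (use c assms in auto)
    finally show "\<theta> y (t \<otimes>\<^bsub>T\<^esub> s) = tsum A ?xs (\<lambda>a b. \<theta> a t \<otimes>\<^bsub>A\<^esub> \<theta> b s)"
      using ts by (simp add: y theta_smult assms x comult_props(3))
  qed
  moreover have "set ?xs \<subseteq> (?D \<union> U) \<times> (?D \<union> U)"
    using comult_in_U x by fastforce
  ultimately show "\<exists>xs. set xs \<subseteq> (?D \<union> U) \<times> (?D \<union> U) \<and> measuring_splitting K A T y xs" by blast
qed (use assms in blast)

lemma module_U: "module K (measuring_bialg K A T m e)"
proof -
  let ?B = "measuring_bialg K A T m e"
  note v = U_props(1)
  have "abelian_group ?B"
  proof (rule abelian_groupI)
    fix x assume x: "x \<in> carrier ?B"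
    then have "(\<lambda>w. \<ominus> \<one> \<otimes> x w) \<oplus>\<^bsub>?B\<^esub> x = \<zero>\<^bsub>?B\<^esub>"
      by (auto simp: v K.l_minus K.l_neg)
    then show "\<exists>y\<in>carrier ?B. y \<oplus>\<^bsub>?B\<^esub> x = \<zero>\<^bsub>?B\<^esub>" using x by (auto intro!: smult_in_U)
  qed (auto simp: v zero_in_U add_in_U K.a_ac)
  then show ?thesis
    by (intro moduleI) (auto simp: v smult_in_U K.l_distr K.r_distr K.m_assoc K.cring_axioms)
qed

lemma linear_eval: "linear_map K (measuring_bialg K A T m e) (ground K) (\<lambda>y. y w)"
  by (rule linear_mapI) (auto simp: U_props(1))

lemma linear_theta: "t \<in> carrier T \<Longrightarrow> linear_map K (measuring_bialg K A T m e) A (\<lambda>y. \<theta> y t)"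
  by (rule linear_mapI) (auto simp: U_props(6) theta_add theta_smult)

lemma separating_eval: "separating K (measuring_bialg K A T m e) (range (\<lambda>w y. y w))"
  by (auto simp: separating_def linear_eval)

text \<open>
  Equality of tensors over \<open>U\<close> may be checked at pairs of words.
\<close>

lemma U_tensor_eqI:
  assumes "set xs \<subseteq> U \<times> U" "set ys \<subseteq> U \<times> U"
    and "\<And>u v. tsum K xs (\<lambda>a b. a u \<otimes> b v) = tsum K ys (\<lambda>a b. a u \<otimes> b v)"
  shows "tensor_eq K (measuring_bialg K A T m e) (measuring_bialg K A T m e) xs ys"
  by (rule tensor_eqI_separating[OF field_K module_U separating_eval]) (use assms in auto)

lemma U_sum_apply:
  assumes "\<And>a b. (a, b) \<in> set xs \<Longrightarrow> F a b \<in> U"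
  shows "tsum (measuring_bialg K A T m e) xs F w = tsum K xs (\<lambda>a b. F a b w)"
  using linear_map_tsum[OF module_U module_ground linear_eval, of xs F] assms by simp

text \<open>
  Evaluated at words, coassociativity says that \<open>x((pq)s) = x(p(qs))\<close>, and the counit laws say that the
  empty word is neutral.
\<close>

lemma coalgebra_U: "coalgebra K (measuring_bialg K A T m e)"
proof -
  let ?B = "measuring_bialg K A T m e"
  note v = U_props(1)
  have mv: "(a, b) \<in> set (\<Delta> x) \<Longrightarrow> x \<in> U \<Longrightarrow> a u \<otimes> b w \<in> carrier K" for a b x u w
    using comult_in_U v by blast
  have cs: "a \<in> U" "b \<in> U" if "(a, b) \<in> set (\<Delta> x)" "x \<in> U" for a b x using comult_in_U that by blast+
  note B = measuring_bialg_simps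
  have 1: "tensor_eq K ?B ?B (\<Delta> (x \<oplus>\<^bsub>?B\<^esub> y)) (\<Delta> x @ \<Delta> y)" if "x \<in> U" "y \<in> U" for x y
  proof (rule U_tensor_eqI)
    fix u w
    have "tsum K (\<Delta> x @ \<Delta> y) (\<lambda>a b. a u \<otimes> b w) =
        tsum K (\<Delta> x) (\<lambda>a b. a u \<otimes> b w) \<oplus> tsum K (\<Delta> y) (\<lambda>a b. a u \<otimes> b w)"
      by (rule K.tsum_append) (use mv that in auto)
    then show "tsum K (\<Delta> (x \<oplus>\<^bsub>?B\<^esub> y)) (\<lambda>a b. a u \<otimes> b w) = tsum K (\<Delta> x @ \<Delta> y) (\<lambda>a b. a u \<otimes> b w)"
      using that add_in_U[OF that] by (simp add: comult_props(2)[symmetric])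
  qed (use that add_in_U[OF that] comult_props(1) in auto)
  have 2: "tensor_eq K ?B ?B (\<Delta> (c \<odot>\<^bsub>?B\<^esub> x)) (map (\<lambda>(x1, x2). (c \<odot>\<^bsub>?B\<^esub> x1, x2)) (\<Delta> x))"
    if "c \<in> carrier K" "x \<in> U" for c x
  proof (rule U_tensor_eqI)
    fix u w
    have "tsum K (map (\<lambda>(x1, x2). (c \<odot>\<^bsub>?B\<^esub> x1, x2)) (\<Delta> x)) (\<lambda>a b. a u \<otimes> b w) =
        tsum K (\<Delta> x) (\<lambda>a b. (c \<odot>\<^bsub>?B\<^esub> a) u \<otimes> b w)"
      by (rule tsum_map)
    also have "\<dots> = tsum K (\<Delta> x) (\<lambda>a b. c \<otimes> (a u \<otimes> b w))"
      by (rule tsum_cong) (use cs that in \<open>auto simp: v K.m_assoc\<close>)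
    also have "\<dots> = c \<otimes> tsum K (\<Delta> x) (\<lambda>a b. a u \<otimes> b w)"
      by (rule K.tsum_r_distr[symmetric]) (use mv that in auto)
    finally show "tsum K (\<Delta> (c \<odot>\<^bsub>?B\<^esub> x)) (\<lambda>a b. a u \<otimes> b w) =
        tsum K (map (\<lambda>(x1, x2). (c \<odot>\<^bsub>?B\<^esub> x1, x2)) (\<Delta> x)) (\<lambda>a b. a u \<otimes> b w)"
      using that smult_in_U[OF that] by (simp add: comult_props(2)[symmetric])
  next
    show "set (map (\<lambda>(x1, x2). (c \<odot>\<^bsub>?B\<^esub> x1, x2)) (\<Delta> x)) \<subseteq> U \<times> U"
      using cs that smult_in_U by fastforce
  qed (use that smult_in_U[OF that] comult_props(1) in auto)
  have 3: "tensor3_eq K ?B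
      (concat (map (\<lambda>(x1, x2). map (\<lambda>(y1, y2). (y1, y2, x2)) (\<Delta> x1)) (\<Delta> x)))
      (concat (map (\<lambda>(x1, x2). map (\<lambda>(y1, y2). (x1, y1, y2)) (\<Delta> x2)) (\<Delta> x)))"
    (is "tensor3_eq K ?B ?l ?r") if x: "x \<in> U" for x
  proof (rule tensor3_eqI_separating[OF field_K module_U separating_eval])
    show l: "set ?l \<subseteq> carrier ?B \<times> carrier ?B \<times> carrier ?B"
      using x by (clarsimp, blast dest: cs)
    show r: "set ?r \<subseteq> carrier ?B \<times> carrier ?B \<times> carrier ?B"
      using x by (clarsimp, blast dest: cs)
    fix e e' e'' :: "('k, 't, 'a) univ_carrier \<Rightarrow> 'k"
    assume "e \<in> range (\<lambda>w y. y w)" "e' \<in> range (\<lambda>w y. y w)" "e'' \<in> range (\<lambda>w y. y w)"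
    then obtain p q s where e: "e = (\<lambda>y. y p)" "e' = (\<lambda>y. y q)" "e'' = (\<lambda>y. y s)" by blast
    let ?F = "\<lambda>a (b, c). a p \<otimes> b q \<otimes> c s"
    have "tsum K ?l ?F = tsum K (\<Delta> x) (\<lambda>a b. tsum K (map (\<lambda>(y1, y2). (y1, y2, b)) (\<Delta> a)) ?F)"
      by (rule K.tsum_concat) (use x in \<open>clarsimp, blast intro: v K.m_closed dest: cs\<close>)
    also have "\<dots> = tsum K (\<Delta> x) (\<lambda>a b. tsum K (\<Delta> a) (\<lambda>c d. c p \<otimes> d q) \<otimes> b s)"
    proof (rule tsum_cong)
      fix a b assume "(a, b) \<in> set (\<Delta> x)"
      then have ab: "a \<in> U" "b \<in> U" using cs x by blast+
      show "tsum K (map (\<lambda>(y1, y2). (y1, y2, b)) (\<Delta> a)) ?F = tsum K (\<Delta> a) (\<lambda>c d. c p \<otimes> d q) \<otimes> b s"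
        by (subst tsum_map, subst K.tsum_l_distr) (use ab mv v in auto)
    qed
    also have "\<dots> = tsum K (\<Delta> x) (\<lambda>a b. a (p @ q) \<otimes> b s)"
      by (rule tsum_cong) (use x cs in \<open>auto simp: comult_props(2)[symmetric]\<close>)
    also have "\<dots> = tsum K (\<Delta> x) (\<lambda>a b. a p \<otimes> b (q @ s))"
      using comult_props(2)[OF x, of "p @ q" s] comult_props(2)[OF x, of p "q @ s"] by simp
    also have "\<dots> = tsum K (\<Delta> x) (\<lambda>a b. a p \<otimes> tsum K (\<Delta> b) (\<lambda>c d. c q \<otimes> d s))"
      by (rule tsum_cong) (use x cs in \<open>auto simp: comult_props(2)[symmetric]\<close>)
    also have "\<dots> = tsum K (\<Delta> x) (\<lambda>a b. tsum K (map (\<lambda>(y1, y2). (a, y1, y2)) (\<Delta> b)) ?F)"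
    proof (rule tsum_cong)
      fix a b assume "(a, b) \<in> set (\<Delta> x)"
      then have ab: "a \<in> U" "b \<in> U" using cs x by blast+
      have "tsum K (map (\<lambda>(y1, y2). (a, y1, y2)) (\<Delta> b)) ?F = tsum K (\<Delta> b) (\<lambda>c d. a p \<otimes> c q \<otimes> d s)"
        by (simp add: comp_def case_prod_unfold)
      also have "\<dots> = tsum K (\<Delta> b) (\<lambda>c d. a p \<otimes> (c q \<otimes> d s))"
        by (rule tsum_cong) (use ab cs v in \<open>auto simp: K.m_assoc\<close>)
      also have "\<dots> = a p \<otimes> tsum K (\<Delta> b) (\<lambda>c d. c q \<otimes> d s)"
        by (rule K.tsum_r_distr[symmetric]) (use ab mv v in auto)
      finally show "a p \<otimes> tsum K (\<Delta> b) (\<lambda>c d. c q \<otimes> d s) = tsum K (map (\<lambda>(y1, y2). (a, y1, y2)) (\<Delta> b)) ?F" ..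
    qed
    also have "\<dots> = tsum K ?r ?F"
      by (rule K.tsum_concat[symmetric]) (use x in \<open>clarsimp, blast intro: v K.m_closed dest: cs\<close>)
    finally show "tsum K ?l (\<lambda>a (b, c). e a \<otimes> e' b \<otimes> e'' c) = tsum K ?r (\<lambda>a (b, c). e a \<otimes> e' b \<otimes> e'' c)"
      by (simp add: e)
  qed
  have 4: "tsum ?B (\<Delta> x) (\<lambda>x1 x2. x1 [] \<odot>\<^bsub>?B\<^esub> x2) = x \<and> tsum ?B (\<Delta> x) (\<lambda>x1 x2. x2 [] \<odot>\<^bsub>?B\<^esub> x1) = x"
    if x: "x \<in> U" for x
  proof (intro conjI ext)
    fix w
    have "tsum ?B (\<Delta> x) (\<lambda>x1 x2. x1 [] \<odot>\<^bsub>?B\<^esub> x2) w = tsum K (\<Delta> x) (\<lambda>x1 x2. (x1 [] \<odot>\<^bsub>?B\<^esub> x2) w)"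
      by (rule U_sum_apply) (use cs x v in \<open>auto intro!: smult_in_U\<close>)
    then show "tsum ?B (\<Delta> x) (\<lambda>x1 x2. x1 [] \<odot>\<^bsub>?B\<^esub> x2) w = x w"
      using comult_props(2)[OF x, of "[]" w] by simp
    have "tsum ?B (\<Delta> x) (\<lambda>x1 x2. x2 [] \<odot>\<^bsub>?B\<^esub> x1) w = tsum K (\<Delta> x) (\<lambda>x1 x2. (x2 [] \<odot>\<^bsub>?B\<^esub> x1) w)"
      by (rule U_sum_apply) (use cs x v in \<open>auto intro!: smult_in_U\<close>)
    also have "\<dots> = tsum K (\<Delta> x) (\<lambda>x1 x2. x1 w \<otimes> x2 [])"
      by (rule tsum_cong) (use cs x v in \<open>auto intro: K.m_comm\<close>)
    finally show "tsum ?B (\<Delta> x) (\<lambda>x1 x2. x2 [] \<odot>\<^bsub>?B\<^esub> x1) w = x w"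
      using comult_props(2)[OF x, of w "[]"] by simp
  qed
  show ?thesis
    unfolding coalgebra_def B(1,7,8)
    by (intro conjI ballI module_U 1 2 3)
      (use 4 comult_props(1) v in \<open>auto\<close>)
qed

end

section \<open>Sums over pairs of formal tensors\<close>

text \<open>
  The comultiplication of a tensor product of two coalgebras, on elements \<open>x \<otimes> y\<close>.
\<close>

definition pair_splits :: "('a \<times> 'b) list \<Rightarrow> ('c \<times> 'd) list \<Rightarrow> (('a \<times> 'c) \<times> ('b \<times> 'd)) list" where
  "pair_splits xs ys = concat (map (\<lambda>(a, b). map (\<lambda>(c, d). ((a, c), (b, d))) ys) xs)"

lemma set_pair_splits:
  "set xs \<subseteq> A \<times> B \<Longrightarrow> set ys \<subseteq> C \<times> D \<Longrightarrow> set (pair_splits xs ys) \<subseteq> (A \<times> C) \<times> (B \<times> D)"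
  by (fastforce simp: pair_splits_def)

lemma (in abelian_monoid) tsum_pair_splits:
  assumes "\<And>a b c d. (a, b) \<in> set xs \<Longrightarrow> (c, d) \<in> set ys \<Longrightarrow> F (a, c) (b, d) \<in> carrier G"
  shows "tsum G (pair_splits xs ys) F = tsum G xs (\<lambda>a b. tsum G ys (\<lambda>c d. F (a, c) (b, d)))"
proof -
  have "tsum G (pair_splits xs ys) F = tsum G xs (\<lambda>a b. tsum G (map (\<lambda>(c, d). ((a, c), (b, d))) ys) F)"
    unfolding pair_splits_def by (rule tsum_concat) (use assms in auto)
  then show ?thesis by (simp only: tsum_map)
qed

lemma (in abelian_monoid) tsum_swap_pairs:
  assumes cl: "\<And>a b c d e f g h. (a, b) \<in> set xs \<Longrightarrow> (c, d) \<in> set ys \<Longrightarrow> (e, f) \<in> set zs \<Longrightarrow> (g, h) \<in> set ws \<Longrightarrow>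
    F a b c d e f g h \<in> carrier G"
  shows "tsum G xs (\<lambda>a b. tsum G ys (\<lambda>c d. tsum G zs (\<lambda>e f. tsum G ws (\<lambda>g h. F a b c d e f g h)))) =
    tsum G zs (\<lambda>e f. tsum G ws (\<lambda>g h. tsum G xs (\<lambda>a b. tsum G ys (\<lambda>c d. F a b c d e f g h))))"
proof -
  let ?F = "\<lambda>(a, c) (b, d) (e, g) (f, h). F a b c d e f g h"
  have mem: "((a, c), (b, d)) \<in> set (pair_splits xs' ys') \<longleftrightarrow> (a, b) \<in> set xs' \<and> (c, d) \<in> set ys'" for a b c d xs' ys'
    by (force simp: pair_splits_def)
  have in1: "tsum G (pair_splits zs ws) (?F (a, c) (b, d)) = tsum G zs (\<lambda>e f. tsum G ws (\<lambda>g h. F a b c d e f g h))"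
    if "(a, b) \<in> set xs" "(c, d) \<in> set ys" for a b c d
    by (subst tsum_pair_splits) (use that cl in auto)
  have in2: "tsum G (pair_splits xs ys) (\<lambda>p q. ?F p q (e, g) (f, h)) = tsum G xs (\<lambda>a b. tsum G ys (\<lambda>c d. F a b c d e f g h))"
    if "(e, f) \<in> set zs" "(g, h) \<in> set ws" for e f g h
    by (subst tsum_pair_splits) (use that cl in auto)
  have "tsum G xs (\<lambda>a b. tsum G ys (\<lambda>c d. tsum G zs (\<lambda>e f. tsum G ws (\<lambda>g h. F a b c d e f g h)))) =
      tsum G xs (\<lambda>a b. tsum G ys (\<lambda>c d. tsum G (pair_splits zs ws) (?F (a, c) (b, d))))"
    by (intro tsum_cong) (simp only: in1)
  also have "\<dots> = tsum G (pair_splits xs ys) (\<lambda>p q. tsum G (pair_splits zs ws) (?F p q))"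
    by (rule tsum_pair_splits[symmetric]) (auto simp: mem intro!: tsum_closed cl)
  also have "\<dots> = tsum G (pair_splits zs ws) (\<lambda>r s. tsum G (pair_splits xs ys) (\<lambda>p q. ?F p q r s))"
    by (rule tsum_swap) (auto simp: mem intro!: cl)
  also have "\<dots> = tsum G zs (\<lambda>e f. tsum G ws (\<lambda>g h. tsum G (pair_splits xs ys) (\<lambda>p q. ?F p q (e, g) (f, h))))"
    by (rule tsum_pair_splits) (auto simp: mem intro!: tsum_closed cl)
  also have "\<dots> = tsum G zs (\<lambda>e f. tsum G ws (\<lambda>g h. tsum G xs (\<lambda>a b. tsum G ys (\<lambda>c d. F a b c d e f g h))))"
    by (intro tsum_cong) (simp only: in2)
  finally show ?thesis .
qed

section \<open>Convolution of bilinear maps and bialgebras\<close>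

lemma linear_conv_eval:
  "y \<in> carrier D \<Longrightarrow> linear_map K (conv_alg K D V) V (\<lambda>f. f y)"
  by (rule linear_mapI) (auto simp: conv_alg_simps linear_mapD(1))

text \<open>
  By currying, the bilinear maps on \<open>C\<close> and \<open>D\<close> are the iterated convolution algebra; this is the
  convolution algebra of the tensor product of \<open>C\<close> and \<open>D\<close>.
\<close>

lemma conv2_carrier:
  assumes "coalgebra K C" "coalgebra K D" "bilinear K C D V F"
  shows "(\<lambda>x\<in>carrier C. \<lambda>y\<in>carrier D. F x y) \<in> carrier (conv_alg K C (conv_alg K D V))"
proof -
  note C = coalgebraD(1)[OF assms(1)] and D = coalgebraD(1)[OF assms(2)]
  interpret C: module K C by (rule C)
  interpret D: module K D by (rule D)
  have "linear_map K C (conv_alg K D V) (\<lambda>x. \<lambda>y\<in>carrier D. F x y)"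
  proof (rule linear_mapI)
    fix x assume "x \<in> carrier C"
    then show "(\<lambda>y\<in>carrier D. F x y) \<in> carrier (conv_alg K D V)"
      using bilinearD(1)[OF assms(3)] by (simp add: conv_alg_simps linear_map_restrict[OF D])
  qed (auto simp: conv_alg_simps fun_eq_iff linear_mapD(2,3)[OF bilinearD(2)[OF assms(3)]])
  then show ?thesis by (simp add: conv_alg_simps(1) linear_map_restrict[OF C])
qed

lemma conv2_bilinear:
  assumes "r \<in> carrier (conv_alg K C (conv_alg K D V))"
  shows "bilinear K C D V r"
proof (rule bilinearI)
  fix x assume "x \<in> carrier C"
  then show "linear_map K D V (r x)" using assms by (auto simp: conv_alg_simps dest: linear_mapD(1))
next
  fix y assume "y \<in> carrier D"
  then show "linear_map K C V (\<lambda>x. r x y)"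
    using linear_map_comp[OF _ linear_conv_eval] assms by (auto simp: conv_alg_simps)
qed

lemma conv2_mult:
  assumes "coalgebra K C" "coalgebra K D" "k_algebra K V"
    and r: "r \<in> carrier (conv_alg K C (conv_alg K D V))" and s: "s \<in> carrier (conv_alg K C (conv_alg K D V))"
    and x: "x \<in> carrier C" and y: "y \<in> carrier D"
  shows "(r \<otimes>\<^bsub>conv_alg K C (conv_alg K D V)\<^esub> s) x y =
    tsum V (comult C x) (\<lambda>a b. tsum V (comult D y) (\<lambda>c d. r a c \<otimes>\<^bsub>V\<^esub> s b d))"
proof -
  let ?R = "conv_alg K D V"
  note R = k_algebra_conv_alg[OF assms(2,3)]
  interpret R: ring ?R by (rule k_algebraD(2)[OF R])
  have m: "f \<in> carrier (conv_alg K C ?R) \<Longrightarrow> a \<in> carrier C \<Longrightarrow> f a \<in> carrier ?R" for f a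
    by (rule linear_mapD(1)[of K C ?R f a]) (simp_all add: conv_alg_simps(1)[of f])
  have "(r \<otimes>\<^bsub>conv_alg K C ?R\<^esub> s) x y = (tsum ?R (comult C x) (\<lambda>a b. r a \<otimes>\<^bsub>?R\<^esub> s b)) y"
    using x by (simp add: conv_alg_simps(2))
  also have "\<dots> = tsum V (comult C x) (\<lambda>a b. (r a \<otimes>\<^bsub>?R\<^esub> s b) y)"
    by (rule linear_map_tsum[OF k_algebraD(1)[OF R] k_algebraD(1)[OF assms(3)] linear_conv_eval[OF y]])
      (use comult_closed[OF assms(1) _ x] m r s in auto)
  also have "\<dots> = tsum V (comult C x) (\<lambda>a b. tsum V (comult D y) (\<lambda>c d. r a c \<otimes>\<^bsub>V\<^esub> s b d))"
    by (rule tsum_cong) (use y in \<open>simp add: conv_alg_simps(2)\<close>)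
  finally show ?thesis .
qed

lemma bialgebraD:
  assumes "bialgebra K H"
  shows "k_algebra K H" "coalgebra K H" "module K H" "ring H"
    and "x \<in> carrier H \<Longrightarrow> y \<in> carrier H \<Longrightarrow> counit H (x \<otimes>\<^bsub>H\<^esub> y) = counit H x \<otimes>\<^bsub>K\<^esub> counit H y"
    and "counit H \<one>\<^bsub>H\<^esub> = \<one>\<^bsub>K\<^esub>"
  using assms k_algebraD(1,2) unfolding bialgebra_def by blast+

lemma bialgebra_comult_mult:
  fixes H (structure)
  assumes "bialgebra K H" "module K V" "bilinear K H H V F" "x \<in> carrier H" "y \<in> carrier H"
  shows "tsum V (comult H (x \<otimes> y)) F =
    tsum V (comult H x) (\<lambda>a b. tsum V (comult H y) (\<lambda>c d. F (a \<otimes> c) (b \<otimes> d)))"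
proof -
  note H = bialgebraD[OF assms(1)]
  interpret H: ring H by (rule H(4))
  interpret V: module K V by fact
  have "tsum V (comult H (x \<otimes> y)) F = tsum V (concat (map (\<lambda>(x1, x2).
      map (\<lambda>(y1, y2). (x1 \<otimes> y1, x2 \<otimes> y2)) (comult H y)) (comult H x))) F"
    by (rule tensor_eq_tsum[OF _ H(3,3) assms(2,3)]) (use assms(1,4,5) in \<open>unfold bialgebra_def, blast\<close>)
  also have "\<dots> = tsum V (comult H x) (\<lambda>a b. tsum V (map (\<lambda>(y1, y2). (a \<otimes> y1, b \<otimes> y2)) (comult H y)) F)"
    by (rule V.tsum_concat) (use assms(4,5) in
      \<open>clarsimp, blast intro: bilinearD(3)[OF assms(3)] dest: comult_closed[OF H(2)]\<close>)
  finally show ?thesis by (simp only: tsum_map)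
qed

lemma bialgebra_comult_one:
  fixes H (structure)
  assumes "bialgebra K H" "module K V" "bilinear K H H V F"
  shows "tsum V (comult H \<one>) F = F \<one> \<one>"
proof -
  note H = bialgebraD[OF assms(1)]
  interpret H: ring H by (rule H(4))
  interpret V: module K V by fact
  have "tsum V (comult H \<one>) F = tsum V [(\<one>, \<one>)] F"
    by (rule tensor_eq_tsum[OF _ H(3,3) assms(2,3)]) (use assms(1) in \<open>unfold bialgebra_def, blast\<close>)
  then show ?thesis using bilinearD(3)[OF assms(3) H.one_closed H.one_closed] by simp
qed

section \<open>Lifting measurings to functions on words\<close>

text \<open>
  A word is sent to the product in the monoid \<open>R\<close> of the values \<open>F\<close> at its letters, and then evaluated by
  \<open>ev\<close>. In the uses \<open>R\<close> is a convolution algebra or the opposite of one, with \<open>ev\<close> the evaluation at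
  a point; for the unit of \<open>U\<close>, it is \<open>K\<close> itself.
\<close>

definition word_lift ::
    "'k ring \<Rightarrow> ('k, 'a) module \<Rightarrow> ('k, 't) bialg \<Rightarrow> ('r, 'm) monoid_scheme \<Rightarrow> ('t \<times> ('a \<Rightarrow> 'k) \<Rightarrow> 'r)
      \<Rightarrow> ('r \<Rightarrow> 'k) \<Rightarrow> ('k, 't, 'a) univ_carrier" where
  "word_lift K A T R F ev w =
    (if w \<in> lists (letters K A T) then ev (foldr (\<lambda>l r. F l \<otimes>\<^bsub>R\<^esub> r) w \<one>\<^bsub>R\<^esub>) else \<zero>\<^bsub>K\<^esub>)"

context measuring_data
begin

text \<open>
  Multiplicativity \<open>ev_mult\<close> of the functionals makes concatenation of words split along \<open>d\<close>, so the image of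
  \<open>X\<close> is a set of functions that splits inside itself, and \<open>U_coinduct\<close> applies.
\<close>

lemma word_lift:
  fixes R :: "('r, 'm) monoid_scheme" and ev :: "'x \<Rightarrow> 'r \<Rightarrow> 'k"
  assumes R: "monoid R"
    and ev: "\<And>x r. x \<in> X \<Longrightarrow> r \<in> carrier R \<Longrightarrow> ev x r \<in> carrier K"
    and d: "\<And>x. x \<in> X \<Longrightarrow> set (d x) \<subseteq> X \<times> X"
    and ev_mult: "\<And>x r s. x \<in> X \<Longrightarrow> r \<in> carrier R \<Longrightarrow> s \<in> carrier R \<Longrightarrow>
      ev x (r \<otimes>\<^bsub>R\<^esub> s) = tsum K (d x) (\<lambda>a b. ev a r \<otimes> ev b s)"
    and F: "\<And>t \<phi>. t \<in> carrier T \<Longrightarrow> \<phi> \<in> forms K A \<Longrightarrow> F (t, \<phi>) \<in> carrier R"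
    and ev_F: "\<And>x t \<phi>. x \<in> X \<Longrightarrow> t \<in> carrier T \<Longrightarrow> \<phi> \<in> forms K A \<Longrightarrow> ev x (F (t, \<phi>)) = \<phi> (f x t)"
    and lin: "\<And>x. x \<in> X \<Longrightarrow> linear_map K T A (f x)"
    and f_one: "\<And>x. x \<in> X \<Longrightarrow> f x \<one>\<^bsub>T\<^esub> = ev x \<one>\<^bsub>R\<^esub> \<odot>\<^bsub>A\<^esub> \<one>\<^bsub>A\<^esub>"
    and f_mult: "\<And>x t s. x \<in> X \<Longrightarrow> t \<in> carrier T \<Longrightarrow> s \<in> carrier T \<Longrightarrow>
      f x (t \<otimes>\<^bsub>T\<^esub> s) = tsum A (d x) (\<lambda>a b. f a t \<otimes>\<^bsub>A\<^esub> f b s)"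
    and x: "x \<in> X"
  shows "word_lift K A T R F (ev x) \<in> U"
    and "word_lift K A T R F (ev x) (u @ v) =
      tsum K (d x) (\<lambda>a b. word_lift K A T R F (ev a) u \<otimes> word_lift K A T R F (ev b) v)"
    and "t \<in> carrier T \<Longrightarrow> \<theta> (word_lift K A T R F (ev x)) t = f x t"
    and "word_lift K A T R F (ev x) [] = ev x \<one>\<^bsub>R\<^esub>"
proof -
  interpret R: monoid R by fact
  define g where "g x = word_lift K A T R F (ev x)" for x
  define P where "P w = foldr (\<lambda>l r. F l \<otimes>\<^bsub>R\<^esub> r) w \<one>\<^bsub>R\<^esub>" for w
  have P: "P w \<in> carrier R" if "w \<in> lists (letters K A T)" for w
    using that by (induction w) (auto simp: P_def F)
  have P_append: "P (u @ v) = P u \<otimes>\<^bsub>R\<^esub> P v" if "u \<in> lists (letters K A T)" "v \<in> lists (letters K A T)" for u v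
    using that(1)
  proof (induction u)
    case Nil
    show ?case using P[OF that(2)] by (simp add: P_def)
  next
    case (Cons l u)
    then show ?case using P[of u] P[OF that(2)] F by (auto simp: P_def R.m_assoc)
  qed
  have g: "g x w = (if w \<in> lists (letters K A T) then ev x (P w) else \<zero>)" for x w
    by (simp add: g_def word_lift_def P_def)
  have gK: "g x w \<in> carrier K" if "x \<in> X" for x w using that ev P by (simp add: g)
  have dX: "a \<in> X" "b \<in> X" if "(a, b) \<in> set (d x)" "x \<in> X" for a b x using d that by blast+
  have split: "g x (u @ v) = tsum K (d x) (\<lambda>a b. g a u \<otimes> g b v)" if x: "x \<in> X" for x u v
  proof (cases "u \<in> lists (letters K A T) \<and> v \<in> lists (letters K A T)")
    case True
    then show ?thesis using x by (simp add: g P_append ev_mult P)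
  next
    case False
    have "tsum K (d x) (\<lambda>a b. g a u \<otimes> g b v) = tsum K (d x) (\<lambda>a b. \<zero>)"
    proof (rule tsum_cong)
      fix a b assume "(a, b) \<in> set (d x)"
      then have "g a u \<in> carrier K" "g b v \<in> carrier K" using dX x gK by blast+
      moreover have "g a u = \<zero> \<or> g b v = \<zero>" using False by (auto simp: g)
      ultimately show "g a u \<otimes> g b v = \<zero>" by auto
    qed
    also have "\<dots> = \<zero>" by (rule K.tsum_zero)
    finally show ?thesis using False by (auto simp: g)
  qed
  have letter: "g x [(t, \<phi>)] = \<phi> (f x t)" if "x \<in> X" "t \<in> carrier T" "\<phi> \<in> forms K A" for x t \<phi>
    using that F by (simp add: g P_def ev_F)
  have g_Nil: "g x [] = ev x \<one>\<^bsub>R\<^esub>" for x by (simp add: g P_def)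
  have th: "\<theta> (g x) t = f x t" if "x \<in> X" "t \<in> carrier T" for x t
    by (rule theta_eqI) (use that letter linear_mapD(1)[OF lin] in auto)
  have "g x \<in> U"
  proof (rule U_coinduct[where D = "g ` X"])
    fix y assume "y \<in> g ` X"
    then obtain x where x: "x \<in> X" and y: "y = g x" by blast
    show "measuring_functional K A T y" unfolding y
      by (rule measuring_functionalI[where h = "f x"])
        (use x gK letter lin f_one g_Nil in \<open>auto simp: g\<close>)
    let ?xs = "map (\<lambda>(a, b). (g a, g b)) (d x)"
    have "measuring_splitting K A T y ?xs"
      unfolding measuring_splitting_def tsum_map
    proof (intro conjI allI ballI)
      fix u v show "y (u @ v) = tsum K (d x) (\<lambda>a b. g a u \<otimes> g b v)"
        using split[OF x] by (simp add: y)
    next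
      fix t s assume ts: "t \<in> carrier T" "s \<in> carrier T"
      have "tsum A (d x) (\<lambda>a b. \<theta> (g a) t \<otimes>\<^bsub>A\<^esub> \<theta> (g b) s) = tsum A (d x) (\<lambda>a b. f a t \<otimes>\<^bsub>A\<^esub> f b s)"
        by (rule tsum_cong) (use dX x ts th in simp)
      then show "\<theta> y (t \<otimes>\<^bsub>T\<^esub> s) = tsum A (d x) (\<lambda>a b. \<theta> (g a) t \<otimes>\<^bsub>A\<^esub> \<theta> (g b) s)"
        using x ts by (simp add: y th f_mult)
    qed
    moreover have "set ?xs \<subseteq> g ` X \<times> g ` X" using dX x by auto
    ultimately show "\<exists>xs. set xs \<subseteq> (g ` X \<union> U) \<times> (g ` X \<union> U) \<and> measuring_splitting K A T y xs"
      by (intro exI[of _ ?xs]) blast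
  qed (use x in blast)
  then show "word_lift K A T R F (ev x) \<in> U"
    "word_lift K A T R F (ev x) (u @ v) =
      tsum K (d x) (\<lambda>a b. word_lift K A T R F (ev a) u \<otimes> word_lift K A T R F (ev b) v)"
    "t \<in> carrier T \<Longrightarrow> \<theta> (word_lift K A T R F (ev x)) t = f x t"
    "word_lift K A T R F (ev x) [] = ev x \<one>\<^bsub>R\<^esub>"
    using split[OF x] th[OF x] g_Nil[of x] by (simp_all add: g_def)
qed

text \<open>
  A letter \<open>l\<close> can be split off: \<open>g x (l w)\<close> is a sum of terms \<open>g a [l] \<cdot> g b w\<close>. As the values at letters
  are determined by \<open>\<theta>\<close>, induction along the word gives equality.
\<close>

lemma word_maps_eqI:
  assumes gU: "\<And>x. x \<in> X \<Longrightarrow> g x \<in> U" and hU: "\<And>x. x \<in> X \<Longrightarrow> h x \<in> U"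
    and d: "\<And>x. x \<in> X \<Longrightarrow> set (d x) \<subseteq> X \<times> X"
    and g: "\<And>x u v. x \<in> X \<Longrightarrow> g x (u @ v) = tsum K (d x) (\<lambda>a b. g a u \<otimes> g b v)"
    and h: "\<And>x u v. x \<in> X \<Longrightarrow> h x (u @ v) = tsum K (d x) (\<lambda>a b. h a u \<otimes> h b v)"
    and Nil: "\<And>x. x \<in> X \<Longrightarrow> g x [] = h x []"
    and th: "\<And>x t. x \<in> X \<Longrightarrow> t \<in> carrier T \<Longrightarrow> \<theta> (g x) t = \<theta> (h x) t"
    and x: "x \<in> X"
  shows "g x = h x"
proof
  fix w show "g x w = h x w"
    using x
  proof (induction w arbitrary: x)
    case Nil
    then show ?case by (rule assms(6))
  next
    case (Cons l w)
    have l: "g a [l] = h a [l]" if a: "a \<in> X" for a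
    proof (cases "l \<in> letters K A T")
      case True
      then show ?thesis using U_props(4)[OF gU[OF a]] U_props(4)[OF hU[OF a]] th[OF a] by (cases l) auto
    next
      case False
      then have "[l] \<notin> lists (letters K A T)" by simp
      then show ?thesis using U_props(2)[OF gU[OF a]] U_props(2)[OF hU[OF a]] by metis
    qed
    have "g x ([l] @ w) = tsum K (d x) (\<lambda>a b. g a [l] \<otimes> g b w)" by (rule g[OF Cons.prems])
    also have "\<dots> = tsum K (d x) (\<lambda>a b. h a [l] \<otimes> h b w)"
    proof (rule tsum_cong)
      fix a b assume "(a, b) \<in> set (d x)"
      then have "a \<in> X" "b \<in> X" using d[OF Cons.prems] by auto
      then show "g a [l] \<otimes> g b w = h a [l] \<otimes> h b w" using l Cons.IH by simp
    qed
    also have "\<dots> = h x ([l] @ w)" by (rule h[OF Cons.prems, symmetric])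
    finally show ?case by simp
  qed
qed

text \<open>
  Any splitting of \<open>y\<close> inside \<open>U\<close> may replace the chosen one in a Sweedler sum.
\<close>

lemma comult_tsum_eqI:
  assumes "y \<in> U" "set ys \<subseteq> U \<times> U" "module K V"
    and "bilinear K (measuring_bialg K A T m e) (measuring_bialg K A T m e) V F"
    and "\<And>u v. y (u @ v) = tsum K ys (\<lambda>a b. a u \<otimes> b v)"
  shows "tsum V (\<Delta> y) F = tsum V ys F"
  by (rule tensor_eq_tsum[OF U_tensor_eqI module_U module_U assms(3,4)])
    (use assms(1,2,5) comult_props(1,2) in auto)

end

section \<open>The bialgebra structure\<close>

text \<open>
  Product and unit are unspecified: this is only a coalgebra.
\<close>

definition word_coalg :: "'k ring \<Rightarrow> ('k, 'a) module \<Rightarrow> ('k, 't) bialg \<Rightarrow> ('k, ('k, 't, 'a) univ_carrier) bialg" where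
  "word_coalg K A T = measuring_bialg K A T undefined undefined"

text \<open>
  The lift of the measuring \<open>(x, y, t) \<mapsto> \<theta>(x, t1) \<theta>(y, t2)\<close> of the tensor square of the coalgebra.
\<close>

definition word_prod :: "'k ring \<Rightarrow> ('k, 'a) module \<Rightarrow> ('k, 't) bialg \<Rightarrow> ('k, 't, 'a) univ_carrier
      \<Rightarrow> ('k, 't, 'a) univ_carrier \<Rightarrow> ('k, 't, 'a) univ_carrier" where
  "word_prod K A T x y = word_lift K A T
    (conv_alg K (word_coalg K A T) (conv_alg K (word_coalg K A T) (ground K)))
    (\<lambda>(t, \<phi>). \<lambda>x\<in>measuring_space K A T. \<lambda>y\<in>measuring_space K A T.
      \<phi> (tsum A (comult T t) (\<lambda>t1 t2. theta K A x t1 \<otimes>\<^bsub>A\<^esub> theta K A y t2)))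
    (\<lambda>r. r x y)"

definition word_one :: "'k ring \<Rightarrow> ('k, 'a) module \<Rightarrow> ('k, 't) bialg \<Rightarrow> ('k, 't, 'a) univ_carrier" where
  "word_one K A T = word_lift K A T (ground K) (\<lambda>(t, \<phi>). \<phi> (counit T t \<odot>\<^bsub>A\<^esub> \<one>\<^bsub>A\<^esub>)) (\<lambda>r. r)"

definition word_bialg :: "'k ring \<Rightarrow> ('k, 'a) module \<Rightarrow> ('k, 't) bialg \<Rightarrow> ('k, ('k, 't, 'a) univ_carrier) bialg" where
  "word_bialg K A T = measuring_bialg K A T (word_prod K A T) (word_one K A T)"

context measuring_data
begin

abbreviation "C \<equiv> word_coalg K A T"
abbreviation "B \<equiv> word_bialg K A T"
abbreviation "mul \<equiv> word_prod K A T"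
abbreviation "unit \<equiv> word_one K A T"

lemma coalgebra_C: "coalgebra K C" and module_C: "module K C"
  by (simp_all add: word_coalg_def coalgebra_U module_U)

lemma C_simps [simp]:
  "carrier C = U" "comult C = \<Delta>" "counit C = (\<lambda>y. y [])"
  "add C = (\<lambda>x y w. x w \<oplus> y w)" "smult C = (\<lambda>c x w. c \<otimes> x w)"
  by (simp_all add: word_coalg_def)

lemma linear_C:
  "linear_map K C (ground K) (\<lambda>y. y w)" "t \<in> carrier T \<Longrightarrow> linear_map K C A (\<lambda>y. \<theta> y t)"
  by (simp_all add: word_coalg_def linear_eval linear_theta)

lemma bilinear_theta_product:
  assumes "t \<in> carrier T"
  shows "bilinear K C C A (\<lambda>x y. tsum A (comult T t) (\<lambda>t1 t2. \<theta> x t1 \<otimes>\<^bsub>A\<^esub> \<theta> y t2))"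
proof (rule bilinearI; rule linear_map_sum[OF module_A])
  fix x t1 t2 assume x: "x \<in> carrier C" and "(t1, t2) \<in> set (comult T t)"
  then have t: "t1 \<in> carrier T" "t2 \<in> carrier T" using comult_closed[OF coalgebra_T _ assms] by auto
  show "linear_map K C A (\<lambda>y. \<theta> x t1 \<otimes>\<^bsub>A\<^esub> \<theta> y t2)"
    by (rule linear_map_mult_r[OF k_algebra_A linear_C(2)]) (use x t U_props(6) in auto)
next
  fix y t1 t2 assume y: "y \<in> carrier C" and "(t1, t2) \<in> set (comult T t)"
  then have t: "t1 \<in> carrier T" "t2 \<in> carrier T" using comult_closed[OF coalgebra_T _ assms] by auto
  show "linear_map K C A (\<lambda>x. \<theta> x t1 \<otimes>\<^bsub>A\<^esub> \<theta> y t2)"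
    by (rule linear_map_mult_l[OF k_algebra_A linear_C(2)]) (use y t U_props(6) in auto)
qed

lemma theta_product_in_conv:
  assumes "t \<in> carrier T" "\<phi> \<in> forms K A"
  shows "(\<lambda>x\<in>U. \<lambda>y\<in>U. \<phi> (tsum A (comult T t) (\<lambda>t1 t2. \<theta> x t1 \<otimes>\<^bsub>A\<^esub> \<theta> y t2)))
    \<in> carrier (conv_alg K C (conv_alg K C (ground K)))"
  using conv2_carrier[OF coalgebra_C coalgebra_C
    linear_map_bilinear_comp[OF bilinear_theta_product[OF assms(1)] form_linear[OF assms(2)]]]
  by simp

text \<open>
  The measuring identity for \<open>(x, y, t) \<mapsto> \<theta>(x, t1) \<theta>(y, t2)\<close>. Expanding the left side gives the factors
  \<open>\<theta>(x1, t1) \<theta>(x2, s1) \<theta>(y1, t2) \<theta>(y2, s2)\<close>; commutativity of \<open>A\<close> exchanges the two in the middle.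
\<close>

lemma theta_product_mult:
  assumes x: "x \<in> U" and y: "y \<in> U" and t: "t \<in> carrier T" and s: "s \<in> carrier T"
  shows "tsum A (comult T (t \<otimes>\<^bsub>T\<^esub> s)) (\<lambda>a b. \<theta> x a \<otimes>\<^bsub>A\<^esub> \<theta> y b) =
    tsum A (\<Delta> x) (\<lambda>x1 x2. tsum A (\<Delta> y) (\<lambda>y1 y2.
      tsum A (comult T t) (\<lambda>t1 t2. \<theta> x1 t1 \<otimes>\<^bsub>A\<^esub> \<theta> y1 t2) \<otimes>\<^bsub>A\<^esub>
      tsum A (comult T s) (\<lambda>s1 s2. \<theta> x2 s1 \<otimes>\<^bsub>A\<^esub> \<theta> y2 s2)))"
proof -
  note th = U_props(6)
  note Tc = comult_closed[OF coalgebra_T]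
  have "tsum A (comult T (t \<otimes>\<^bsub>T\<^esub> s)) (\<lambda>a b. \<theta> x a \<otimes>\<^bsub>A\<^esub> \<theta> y b) =
      tsum A (comult T t) (\<lambda>t1 t2. tsum A (comult T s) (\<lambda>s1 s2.
        \<theta> x (t1 \<otimes>\<^bsub>T\<^esub> s1) \<otimes>\<^bsub>A\<^esub> \<theta> y (t2 \<otimes>\<^bsub>T\<^esub> s2)))"
    by (rule bialgebra_comult_mult[OF bialgebra_T module_A bilinear_mult[OF k_algebra_A] t s]) (use x y U_props(3) in auto)
  also have "\<dots> = tsum A (comult T t) (\<lambda>t1 t2. tsum A (comult T s) (\<lambda>s1 s2.
        tsum A (\<Delta> x) (\<lambda>x1 x2. tsum A (\<Delta> y) (\<lambda>y1 y2.
          (\<theta> x1 t1 \<otimes>\<^bsub>A\<^esub> \<theta> y1 t2) \<otimes>\<^bsub>A\<^esub> (\<theta> x2 s1 \<otimes>\<^bsub>A\<^esub> \<theta> y2 s2)))))"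
  proof (intro tsum_cong)
    fix t1 t2 s1 s2 assume "(t1, t2) \<in> set (comult T t)" "(s1, s2) \<in> set (comult T s)"
    then have c: "t1 \<in> carrier T" "t2 \<in> carrier T" "s1 \<in> carrier T" "s2 \<in> carrier T" using Tc t s by blast+
    have "\<theta> x (t1 \<otimes>\<^bsub>T\<^esub> s1) \<otimes>\<^bsub>A\<^esub> \<theta> y (t2 \<otimes>\<^bsub>T\<^esub> s2) =
        tsum A (\<Delta> x) (\<lambda>x1 x2. tsum A (\<Delta> y) (\<lambda>y1 y2.
          (\<theta> x1 t1 \<otimes>\<^bsub>A\<^esub> \<theta> x2 s1) \<otimes>\<^bsub>A\<^esub> (\<theta> y1 t2 \<otimes>\<^bsub>A\<^esub> \<theta> y2 s2)))"
      unfolding comult_props(3)[OF x c(1,3)] comult_props(3)[OF y c(2,4)]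
      by (rule A.tsum_mult) (use comult_in_U x y c th in blast)+
    also have "\<dots> = tsum A (\<Delta> x) (\<lambda>x1 x2. tsum A (\<Delta> y) (\<lambda>y1 y2.
          (\<theta> x1 t1 \<otimes>\<^bsub>A\<^esub> \<theta> y1 t2) \<otimes>\<^bsub>A\<^esub> (\<theta> x2 s1 \<otimes>\<^bsub>A\<^esub> \<theta> y2 s2)))"
    proof (intro tsum_cong)
      fix x1 x2 y1 y2 assume "(x1, x2) \<in> set (\<Delta> x)" "(y1, y2) \<in> set (\<Delta> y)"
      then have "x1 \<in> U" "x2 \<in> U" "y1 \<in> U" "y2 \<in> U" using comult_in_U x y by blast+
      then show "(\<theta> x1 t1 \<otimes>\<^bsub>A\<^esub> \<theta> x2 s1) \<otimes>\<^bsub>A\<^esub> (\<theta> y1 t2 \<otimes>\<^bsub>A\<^esub> \<theta> y2 s2) =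
          (\<theta> x1 t1 \<otimes>\<^bsub>A\<^esub> \<theta> y1 t2) \<otimes>\<^bsub>A\<^esub> (\<theta> x2 s1 \<otimes>\<^bsub>A\<^esub> \<theta> y2 s2)"
        using c by (simp add: th A.m_ac)
    qed
    finally show "\<theta> x (t1 \<otimes>\<^bsub>T\<^esub> s1) \<otimes>\<^bsub>A\<^esub> \<theta> y (t2 \<otimes>\<^bsub>T\<^esub> s2) = \<dots>" .
  qed
  also have "\<dots> = tsum A (\<Delta> x) (\<lambda>x1 x2. tsum A (\<Delta> y) (\<lambda>y1 y2.
      tsum A (comult T t) (\<lambda>t1 t2. tsum A (comult T s) (\<lambda>s1 s2.
          (\<theta> x1 t1 \<otimes>\<^bsub>A\<^esub> \<theta> y1 t2) \<otimes>\<^bsub>A\<^esub> (\<theta> x2 s1 \<otimes>\<^bsub>A\<^esub> \<theta> y2 s2)))))"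
    by (rule A.tsum_swap_pairs) (use comult_in_U x y Tc t s th in \<open>blast intro: A.m_closed\<close>)
  also have "\<dots> = tsum A (\<Delta> x) (\<lambda>x1 x2. tsum A (\<Delta> y) (\<lambda>y1 y2.
      tsum A (comult T t) (\<lambda>t1 t2. \<theta> x1 t1 \<otimes>\<^bsub>A\<^esub> \<theta> y1 t2) \<otimes>\<^bsub>A\<^esub>
      tsum A (comult T s) (\<lambda>s1 s2. \<theta> x2 s1 \<otimes>\<^bsub>A\<^esub> \<theta> y2 s2)))"
    by (intro tsum_cong A.tsum_mult[symmetric]; use comult_in_U x y Tc t s th in \<open>blast intro: A.m_closed\<close>)
  finally show ?thesis .
qed

lemma word_prod:
  assumes "x \<in> U" "y \<in> U"
  shows "mul x y \<in> U"
    and "mul x y (u @ v) = tsum K (\<Delta> x) (\<lambda>a b. tsum K (\<Delta> y) (\<lambda>c d. mul a c u \<otimes> mul b d v))"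
    and "t \<in> carrier T \<Longrightarrow> \<theta> (mul x y) t = tsum A (comult T t) (\<lambda>t1 t2. \<theta> x t1 \<otimes>\<^bsub>A\<^esub> \<theta> y t2)"
    and "mul x y [] = x [] \<otimes> y []"
proof -
  let ?R = "conv_alg K C (conv_alg K C (ground K))"
  let ?X = "U \<times> U"
  let ?d = "\<lambda>(x, y). pair_splits (\<Delta> x) (\<Delta> y)"
  let ?f = "\<lambda>(x, y) t. tsum A (comult T t) (\<lambda>t1 t2. \<theta> x t1 \<otimes>\<^bsub>A\<^esub> \<theta> y t2)"
  let ?F = "\<lambda>(t, \<phi>). \<lambda>x\<in>U. \<lambda>y\<in>U. \<phi> (tsum A (comult T t) (\<lambda>t1 t2. \<theta> x t1 \<otimes>\<^bsub>A\<^esub> \<theta> y t2))"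
  let ?ev = "\<lambda>(x, y) r. r x y"
  have R: "k_algebra K ?R" by (intro k_algebra_conv_alg coalgebra_C k_algebra_ground)
  interpret R: ring ?R by (rule k_algebraD(2)[OF R])
  have rK: "r x y \<in> carrier K" if "r \<in> carrier ?R" "x \<in> U" "y \<in> U" for r x y
    using bilinearD(3)[OF conv2_bilinear[OF that(1)]] that by simp
  have fA: "?f (x, y) t \<in> carrier A" if "x \<in> U" "y \<in> U" "t \<in> carrier T" for x y t
    using bilinearD(3)[OF bilinear_theta_product[OF that(3)]] that by simp
  have one: "\<one>\<^bsub>?R\<^esub> x y = x [] \<otimes> y []" if "x \<in> U" "y \<in> U" for x y
    using that by (simp add: conv_alg_simps U_props(1))
  have 1: "monoid ?R" by (rule R.is_monoid)
  have 2: "?ev p r \<in> carrier K" if "p \<in> ?X" "r \<in> carrier ?R" for p r using that rK by auto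
  have 3: "set (?d p) \<subseteq> ?X \<times> ?X" if "p \<in> ?X" for p
    using that set_pair_splits[OF comult_props(1) comult_props(1)] by (cases p) simp
  have 4: "?ev p (r \<otimes>\<^bsub>?R\<^esub> s) = tsum K (?d p) (\<lambda>a b. ?ev a r \<otimes> ?ev b s)"
    if "p \<in> ?X" "r \<in> carrier ?R" "s \<in> carrier ?R" for p r s
  proof -
    obtain x y where p: "p = (x, y)" "x \<in> U" "y \<in> U" using \<open>p \<in> ?X\<close> by blast
    have "tsum K (pair_splits (\<Delta> x) (\<Delta> y)) (\<lambda>a b. ?ev a r \<otimes> ?ev b s) =
        tsum K (\<Delta> x) (\<lambda>a b. tsum K (\<Delta> y) (\<lambda>c d. ?ev (a, c) r \<otimes> ?ev (b, d) s))"
    proof (rule K.tsum_pair_splits)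
      fix a b c d assume "(a, b) \<in> set (\<Delta> x)" "(c, d) \<in> set (\<Delta> y)"
      then have "a \<in> U" "b \<in> U" "c \<in> U" "d \<in> U" using comult_in_U p by blast+
      then show "?ev (a, c) r \<otimes> ?ev (b, d) s \<in> carrier K" using rK that(2,3) by simp
    qed
    then show ?thesis
      using conv2_mult[OF coalgebra_C coalgebra_C k_algebra_ground that(2,3), of x y] p by simp
  qed
  have 5: "?F (t, \<phi>) \<in> carrier ?R" if "t \<in> carrier T" "\<phi> \<in> forms K A" for t \<phi>
    using theta_product_in_conv[OF that] by simp
  have 6: "?ev p (?F (t, \<phi>)) = \<phi> (?f p t)"
    if "p \<in> ?X" "t \<in> carrier T" "\<phi> \<in> forms K A" for p t \<phi>
    using that by auto
  have 7: "linear_map K T A (?f p)" if "p \<in> ?X" for p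
    using that U_props(3) by (auto intro!: linear_map_comult[OF coalgebra_T module_A] bilinear_mult[OF k_algebra_A])
  have 8: "?f p \<one>\<^bsub>T\<^esub> = ?ev p \<one>\<^bsub>?R\<^esub> \<odot>\<^bsub>A\<^esub> \<one>\<^bsub>A\<^esub>" if "p \<in> ?X" for p
  proof -
    obtain x y where p: "p = (x, y)" "x \<in> U" "y \<in> U" using \<open>p \<in> ?X\<close> by blast
    have "?f (x, y) \<one>\<^bsub>T\<^esub> = \<theta> x \<one>\<^bsub>T\<^esub> \<otimes>\<^bsub>A\<^esub> \<theta> y \<one>\<^bsub>T\<^esub>"
      unfolding prod.case
      by (rule bialgebra_comult_one[OF bialgebra_T module_A bilinear_mult[OF k_algebra_A]]) (use p U_props(3) in auto)
    then show ?thesis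
      using p by (simp add: one U_props(1,5) A.smult_assoc2 A.smult_assoc1)
  qed
  have 9: "?f p (t \<otimes>\<^bsub>T\<^esub> s) = tsum A (?d p) (\<lambda>a b. ?f a t \<otimes>\<^bsub>A\<^esub> ?f b s)"
    if "p \<in> ?X" "t \<in> carrier T" "s \<in> carrier T" for p t s
  proof -
    obtain x y where p: "p = (x, y)" "x \<in> U" "y \<in> U" using \<open>p \<in> ?X\<close> by blast
    have "tsum A (pair_splits (\<Delta> x) (\<Delta> y)) (\<lambda>a b. ?f a t \<otimes>\<^bsub>A\<^esub> ?f b s) =
        tsum A (\<Delta> x) (\<lambda>a b. tsum A (\<Delta> y) (\<lambda>c d. ?f (a, c) t \<otimes>\<^bsub>A\<^esub> ?f (b, d) s))"
      by (rule A.tsum_pair_splits, rule A.m_closed; rule fA) (use p that(2,3) comult_in_U in blast)+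
    then show ?thesis
      using theta_product_mult[OF p(2,3) that(2,3)] p by simp
  qed
  have m: "mul x y = word_lift K A T ?R ?F (?ev (x, y))" for x y by (simp add: word_prod_def)
  have xy: "(x, y) \<in> ?X" using assms by simp
  note wl = word_lift[where R = ?R and ev = ?ev and X = ?X and d = ?d and f = ?f and F = ?F]
  note prems = 1 2 3 4 5 6 7 8 9
  have mU: "mul x y \<in> U" if xy: "(x, y) \<in> ?X" for x y
    unfolding m by (rule wl(1)) (fact prems xy)+
  show "mul x y \<in> U" by (rule mU) (fact xy)
  have "mul x y (u @ v) = tsum K (?d (x, y)) (\<lambda>a b. word_lift K A T ?R ?F (?ev a) u \<otimes> word_lift K A T ?R ?F (?ev b) v)"
    unfolding m by (rule wl(2)) (fact prems xy)+
  also have "\<dots> = tsum K (\<Delta> x) (\<lambda>a b. tsum K (\<Delta> y) (\<lambda>c d. mul a c u \<otimes> mul b d v))"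
    unfolding prod.case(1)[of _ x y] m
    by (rule K.tsum_pair_splits, unfold m[symmetric], rule K.m_closed; rule U_props(1), rule mU)
      (use comult_in_U assms in blast)+
  finally show "mul x y (u @ v) = tsum K (\<Delta> x) (\<lambda>a b. tsum K (\<Delta> y) (\<lambda>c d. mul a c u \<otimes> mul b d v))" .
  have "\<theta> (mul x y) t = ?f (x, y) t" if "t \<in> carrier T"
    unfolding m by (rule wl(3)) (fact prems xy that)+
  then show "t \<in> carrier T \<Longrightarrow> \<theta> (mul x y) t = tsum A (comult T t) (\<lambda>t1 t2. \<theta> x t1 \<otimes>\<^bsub>A\<^esub> \<theta> y t2)"
    by simp
  have "mul x y [] = ?ev (x, y) \<one>\<^bsub>?R\<^esub>"
    unfolding m by (rule wl(4)) (fact prems xy)+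
  then show "mul x y [] = x [] \<otimes> y []" using one assms by simp
qed

lemma word_lift_is_eval:
  assumes "monoid R" "w \<in> lists (letters K A T)" "\<And>t \<phi>. t \<in> carrier T \<Longrightarrow> \<phi> \<in> forms K A \<Longrightarrow> F (t, \<phi>) \<in> carrier R"
  shows "\<exists>r\<in>carrier R. \<forall>ev. word_lift K A T R F ev w = ev r"
proof -
  interpret R: monoid R by fact
  have "foldr (\<lambda>l r. F l \<otimes>\<^bsub>R\<^esub> r) w \<one>\<^bsub>R\<^esub> \<in> carrier R"
    using assms(2) by (induction w) (auto simp: assms(3))
  then show ?thesis using assms(2) by (auto simp: word_lift_def)
qed

text \<open>
  The value at a word is an element of the iterated convolution algebra, hence bilinear.
\<close>

lemma bilinear_mul_eval: "bilinear K C C (ground K) (\<lambda>x y. mul x y w)"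
proof (cases "w \<in> lists (letters K A T)")
  case True
  let ?R = "conv_alg K C (conv_alg K C (ground K))"
  have "k_algebra K ?R" by (intro k_algebra_conv_alg coalgebra_C k_algebra_ground)
  then interpret R: ring ?R by (rule k_algebraD(2))
  obtain r where r: "r \<in> carrier ?R" "mul x y w = r x y" for x y
    using word_lift_is_eval[OF R.is_monoid True, of "\<lambda>(t, \<phi>). \<lambda>x\<in>U. \<lambda>y\<in>U.
      \<phi> (tsum A (comult T t) (\<lambda>t1 t2. \<theta> x t1 \<otimes>\<^bsub>A\<^esub> \<theta> y t2))"] theta_product_in_conv
    by (auto simp: word_prod_def)
  show ?thesis unfolding r(2) by (rule conv2_bilinear[OF r(1)])
next
  case False
  then have "mul x y w = \<zero>" for x y by (simp add: word_prod_def word_lift_def)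
  then show ?thesis using linear_map_const_zero[OF module_ground] by (auto intro!: bilinearI)
qed

lemma bilinear_mul: "bilinear K (measuring_bialg K A T m e) (measuring_bialg K A T m e) (measuring_bialg K A T m e) mul"
proof -
  note l = bilinearD(1)[OF bilinear_mul_eval, THEN linear_mapD(2)] bilinearD(1)[OF bilinear_mul_eval, THEN linear_mapD(3)]
    bilinearD(2)[OF bilinear_mul_eval, THEN linear_mapD(2)] bilinearD(2)[OF bilinear_mul_eval, THEN linear_mapD(3)]
  show ?thesis
    by (intro bilinearI linear_mapI ext) (use l in \<open>simp_all add: word_prod(1)\<close>)
qed

lemma word_one:
  shows "unit \<in> U" "unit (u @ v) = unit u \<otimes> unit v"
    and "t \<in> carrier T \<Longrightarrow> \<theta> unit t = counit T t \<odot>\<^bsub>A\<^esub> \<one>\<^bsub>A\<^esub>" "unit [] = \<one>"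
proof -
  let ?f = "\<lambda>_::unit. \<lambda>t. counit T t \<odot>\<^bsub>A\<^esub> \<one>\<^bsub>A\<^esub>"
  let ?F = "\<lambda>(t, \<phi>). \<phi> (counit T t \<odot>\<^bsub>A\<^esub> \<one>\<^bsub>A\<^esub>)"
  interpret G: ring "ground K" by (rule k_algebraD(2)[OF k_algebra_ground])
  note e = coalgebraD(5)[OF coalgebra_T]
  note wl = word_lift[where R = "ground K" and ev = "\<lambda>_::unit. \<lambda>r. r" and X = UNIV and d = "\<lambda>_. [((), ())]"
    and f = ?f and F = ?F and x = "()"]
  have 1: "monoid (ground K)" by (rule G.is_monoid)
  have 2: "F \<in> UNIV \<Longrightarrow> r \<in> carrier (ground K) \<Longrightarrow> r \<in> carrier K" for F :: unit and r by simp
  have 3: "F \<in> UNIV \<Longrightarrow> set [((), ())] \<subseteq> UNIV \<times> UNIV" for F :: unit by simp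
  have 4: "r \<otimes>\<^bsub>ground K\<^esub> s = tsum K [((), ())] (\<lambda>_ _. r \<otimes> s)"
    if "x \<in> UNIV" "r \<in> carrier (ground K)" "s \<in> carrier (ground K)" for x :: unit and r s
    using that by simp
  have 5: "?F (t, \<phi>) \<in> carrier (ground K)" if "t \<in> carrier T" "\<phi> \<in> forms K A" for t \<phi>
    using that e by (simp add: form_simps)
  have 6: "?F (t, \<phi>) = \<phi> (?f x t)" if "x \<in> UNIV" "t \<in> carrier T" "\<phi> \<in> forms K A" for x t \<phi> by simp
  have 7: "linear_map K T A (?f x)" if "x \<in> UNIV" for x
    by (rule linear_map_smult_const[OF module_A coalgebraD(6)[OF coalgebra_T]]) simp
  have 8: "?f x \<one>\<^bsub>T\<^esub> = \<one>\<^bsub>ground K\<^esub> \<odot>\<^bsub>A\<^esub> \<one>\<^bsub>A\<^esub>" if "x \<in> UNIV" for x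
    by (simp add: bialgebraD(6)[OF bialgebra_T])
  have 9: "?f x (t \<otimes>\<^bsub>T\<^esub> s) = tsum A [((), ())] (\<lambda>a b. ?f a t \<otimes>\<^bsub>A\<^esub> ?f b s)"
    if "x \<in> UNIV" "t \<in> carrier T" "s \<in> carrier T" for x t s
    using that e by (simp add: bialgebraD(5)[OF bialgebra_T] A.smult_assoc1 A.smult_assoc2)
  note prems = 1 2 3 4 5 6 7 8 9 UNIV_I
  show U: "unit \<in> U" unfolding word_one_def by (rule wl(1)) (fact prems)+
  have "unit (u @ v) = tsum K [((), ())] (\<lambda>a b. unit u \<otimes> unit v)"
    unfolding word_one_def by (rule wl(2)) (fact prems)+
  then show "unit (u @ v) = unit u \<otimes> unit v" using U_props(1)[OF U] by simp
  have "\<theta> unit t = counit T t \<odot>\<^bsub>A\<^esub> \<one>\<^bsub>A\<^esub>" if "t \<in> carrier T"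
    unfolding word_one_def by (rule wl(3)) (fact prems that)+
  then show "t \<in> carrier T \<Longrightarrow> \<theta> unit t = counit T t \<odot>\<^bsub>A\<^esub> \<one>\<^bsub>A\<^esub>" .
  have "unit [] = \<one>\<^bsub>ground K\<^esub>" unfolding word_one_def by (rule wl(4)) (fact prems)+
  then show "unit [] = \<one>" by simp
qed

lemma comult_mul:
  assumes "x \<in> U" "y \<in> U" "module K V" "bilinear K C C V F"
  shows "tsum V (\<Delta> (mul x y)) F = tsum V (\<Delta> x) (\<lambda>a b. tsum V (\<Delta> y) (\<lambda>c d. F (mul a c) (mul b d)))"
proof -
  interpret V: module K V by fact
  \<comment> \<open>The splitting of the product into the products of the components.\<close>
  let ?ys = "map (\<lambda>(p, q). (mul (fst p) (snd p), mul (fst q) (snd q))) (pair_splits (\<Delta> x) (\<Delta> y))"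
  have ps: "set (pair_splits (\<Delta> x) (\<Delta> y)) \<subseteq> (U \<times> U) \<times> (U \<times> U)"
    by (rule set_pair_splits) (use assms comult_props(1) in auto)
  have ys: "set ?ys \<subseteq> U \<times> U" using ps word_prod(1) by fastforce
  note F = bilinearD(3)[OF assms(4), simplified]
  have cm: "a \<in> U" "b \<in> U" "c \<in> U" "d \<in> U" if "(a, b) \<in> set (\<Delta> x)" "(c, d) \<in> set (\<Delta> y)" for a b c d
    using that comult_in_U assms by blast+
  have "tsum V (\<Delta> (mul x y)) F = tsum V ?ys F"
  proof (rule comult_tsum_eqI[OF word_prod(1)[OF assms(1,2)] ys assms(3) assms(4)[unfolded word_coalg_def]])
    fix u v
    have "tsum K ?ys (\<lambda>a b. a u \<otimes> b v) =
        tsum K (\<Delta> x) (\<lambda>a b. tsum K (\<Delta> y) (\<lambda>c d. mul a c u \<otimes> mul b d v))"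
      unfolding tsum_map
      by (subst K.tsum_pair_splits) (use cm word_prod(1) U_props(1) in \<open>auto\<close>)
    then show "mul x y (u @ v) = tsum K ?ys (\<lambda>a b. a u \<otimes> b v)"
      using word_prod(2)[OF assms(1,2)] by simp
  qed
  also have "\<dots> = tsum V (\<Delta> x) (\<lambda>a b. tsum V (\<Delta> y) (\<lambda>c d. F (mul a c) (mul b d)))"
    unfolding tsum_map
    by (subst V.tsum_pair_splits) (use cm word_prod(1) F in \<open>auto\<close>)
  finally show ?thesis .
qed

lemma comult_one:
  assumes "module K V" "bilinear K C C V F"
  shows "tsum V (\<Delta> unit) F = F unit unit"
proof -
  interpret V: module K V by fact
  have "tsum V (\<Delta> unit) F = tsum V [(unit, unit)] F"
    by (rule comult_tsum_eqI[OF word_one(1) _ assms(1) assms(2)[unfolded word_coalg_def]])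
      (use word_one U_props(1)[OF word_one(1)] in auto)
  then show ?thesis using bilinearD(3)[OF assms(2), of unit unit] word_one(1) by simp
qed

text \<open>
  The map \<open>x \<mapsto> \<theta>(x, _)\<close> turns the product of \<open>U\<close> into convolution, so that identities between values of
  \<open>\<theta>\<close> reduce to the ring axioms of the convolution algebra of \<open>T\<close> and \<open>A\<close>.
\<close>

lemma theta_conv:
  assumes "x \<in> U" "y \<in> U"
  shows "(\<lambda>t\<in>carrier T. \<theta> x t) \<in> carrier (conv_alg K T A)"
    and "(\<lambda>t\<in>carrier T. \<theta> (mul x y) t) =
      (\<lambda>t\<in>carrier T. \<theta> x t) \<otimes>\<^bsub>conv_alg K T A\<^esub> (\<lambda>t\<in>carrier T. \<theta> y t)"
    and "(\<lambda>t\<in>carrier T. \<theta> unit t) = \<one>\<^bsub>conv_alg K T A\<^esub>"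
  using assms U_props(3) by (auto simp: conv_alg_simps linear_map_restrict[OF module_T] word_one(3) word_prod(3)
    intro!: restrict_ext comult_cong[OF coalgebra_T])

text \<open>
  The shape of a product evaluated at a concatenation of words, as a function of the left factor.
\<close>

lemma bilinear_mul_splits:
  assumes "set ys \<subseteq> U \<times> U"
  shows "bilinear K C C (ground K) (\<lambda>p q. tsum (ground K) ys (\<lambda>e g. mul p e u \<otimes>\<^bsub>ground K\<^esub> mul q g v))"
proof (rule bilinearI; rule linear_map_sum[OF module_ground])
  fix p e g assume "p \<in> carrier C" "(e, g) \<in> set ys"
  then have *: "p \<in> U" "e \<in> U" "g \<in> U" using assms by auto
  show "linear_map K C (ground K) (\<lambda>q. mul p e u \<otimes>\<^bsub>ground K\<^esub> mul q g v)"
    by (rule linear_map_mult_r[OF k_algebra_ground bilinearD(2)[OF bilinear_mul_eval]])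
      (use * U_props(1)[OF word_prod(1)[OF *(1,2)]] in auto)
  show "linear_map K C (ground K) (\<lambda>q. mul q e u \<otimes>\<^bsub>ground K\<^esub> mul p g v)"
    by (rule linear_map_mult_l[OF k_algebra_ground bilinearD(2)[OF bilinear_mul_eval]])
      (use * U_props(1)[OF word_prod(1)[OF *(1,3)]] in auto)
qed

text \<open>
  Both bracketings are maps from the threefold tensor power of the coalgebra that split along its
  comultiplication, and they have the same \<open>\<theta>\<close>.
\<close>

lemma mul_assoc:
  assumes "x \<in> U" "y \<in> U" "z \<in> U"
  shows "mul (mul x y) z = mul x (mul y z)"
proof -
  let ?R = "conv_alg K T A"
  interpret R: ring ?R by (rule k_algebraD(2)[OF k_algebra_conv_alg[OF coalgebra_T k_algebra_A]])
  let ?X = "U \<times> U \<times> U"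
  let ?d = "\<lambda>(x, y, z). pair_splits (\<Delta> x) (pair_splits (\<Delta> y) (\<Delta> z))"
  let ?g = "\<lambda>(x, y, z). mul (mul x y) z"
  let ?h = "\<lambda>(x, y, z). mul x (mul y z)"
  note m = word_prod(1)
  note lin = linear_C(1)
  have sum3: "tsum K (?d (x, y, z)) (\<lambda>a b. f a u \<otimes> f b v) =
      tsum K (\<Delta> x) (\<lambda>a b. tsum K (\<Delta> y) (\<lambda>c d. tsum K (\<Delta> z) (\<lambda>e g. f (a, c, e) u \<otimes> f (b, d, g) v)))"
    if xyz: "x \<in> U" "y \<in> U" "z \<in> U" and f: "\<And>x y z. x \<in> U \<Longrightarrow> y \<in> U \<Longrightarrow> z \<in> U \<Longrightarrow> f (x, y, z) \<in> U" for x y z u v f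
  proof -
    have cl: "f (a, c, e) u \<otimes> f (b, d, g) v \<in> carrier K"
      if "(a, b) \<in> set (\<Delta> x)" "(c, d) \<in> set (\<Delta> y)" "(e, g) \<in> set (\<Delta> z)" for a b c d e g
      using that comult_in_U xyz f U_props(1) by (meson K.m_closed)
    have "((c, e), (d, g)) \<in> set (pair_splits (\<Delta> y) (\<Delta> z)) \<Longrightarrow> (c, d) \<in> set (\<Delta> y) \<and> (e, g) \<in> set (\<Delta> z)" for c d e g
      by (auto simp: pair_splits_def)
    then have "tsum K (?d (x, y, z)) (\<lambda>a b. f a u \<otimes> f b v) = tsum K (\<Delta> x) (\<lambda>a b.
        tsum K (pair_splits (\<Delta> y) (\<Delta> z)) (\<lambda>p q. f (a, p) u \<otimes> f (b, q) v))"
      unfolding prod.case by (intro K.tsum_pair_splits) (auto intro!: cl)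
    also have "\<dots> = tsum K (\<Delta> x) (\<lambda>a b. tsum K (\<Delta> y) (\<lambda>c d. tsum K (\<Delta> z) (\<lambda>e g. f (a, c, e) u \<otimes> f (b, d, g) v)))"
      by (intro tsum_cong K.tsum_pair_splits cl)
    finally show ?thesis .
  qed
  have "?g (x, y, z) = ?h (x, y, z)"
  proof (rule word_maps_eqI[where X = ?X and d = ?d])
    fix p assume p: "p \<in> ?X"
    then obtain x y z where p': "p = (x, y, z)" and xyz: "x \<in> U" "y \<in> U" "z \<in> U" by blast
    have cm: "a \<in> U" "b \<in> U" if "(a, b) \<in> set (\<Delta> x) \<union> set (\<Delta> y) \<union> set (\<Delta> z)" for a b
      using that comult_in_U xyz by blast+
    show "?g p \<in> U" "?h p \<in> U" using p m by auto
    show "set (?d p) \<subseteq> ?X \<times> ?X"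
      unfolding p' prod.case by (intro set_pair_splits comult_props(1) xyz)
    show "?g p [] = ?h p []" using xyz by (simp add: p' m word_prod(4) U_props(1) K.m_assoc)
    fix u v
    have "mul (mul x y) z (u @ v) =
        tsum K (\<Delta> (mul x y)) (\<lambda>p q. tsum K (\<Delta> z) (\<lambda>e g. mul p e u \<otimes> mul q g v))"
      by (rule word_prod(2)) (use xyz m in auto)
    also have "\<dots> = tsum (ground K) (\<Delta> (mul x y)) (\<lambda>p q. tsum (ground K) (\<Delta> z) (\<lambda>e g. mul p e u \<otimes>\<^bsub>ground K\<^esub> mul q g v))"
      by simp
    also have "\<dots> = tsum (ground K) (\<Delta> x) (\<lambda>a b. tsum (ground K) (\<Delta> y) (\<lambda>c d.
        tsum (ground K) (\<Delta> z) (\<lambda>e g. mul (mul a c) e u \<otimes>\<^bsub>ground K\<^esub> mul (mul b d) g v)))"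
      by (rule comult_mul[OF xyz(1,2) module_ground bilinear_mul_splits[OF comult_props(1)[OF xyz(3)]]])
    also have "\<dots> = tsum K (?d p) (\<lambda>a b. ?g a u \<otimes> ?g b v)"
      unfolding p' by (subst sum3) (use xyz m in auto)
    finally show "?g p (u @ v) = tsum K (?d p) (\<lambda>a b. ?g a u \<otimes> ?g b v)" by (simp add: p')
    have "mul x (mul y z) (u @ v) =
        tsum K (\<Delta> x) (\<lambda>a b. tsum K (\<Delta> (mul y z)) (\<lambda>p q. mul a p u \<otimes> mul b q v))"
      by (rule word_prod(2)) (use xyz m in auto)
    also have "\<dots> = tsum K (\<Delta> x) (\<lambda>a b. tsum K (\<Delta> y) (\<lambda>c d.
        tsum K (\<Delta> z) (\<lambda>e g. mul a (mul c e) u \<otimes> mul b (mul d g) v)))"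
    proof (rule tsum_cong)
      fix a b assume ab: "(a, b) \<in> set (\<Delta> x)"
      have "bilinear K C C (ground K) (\<lambda>p q. mul a p u \<otimes>\<^bsub>ground K\<^esub> mul b q v)"
        by (rule bilinear_mult[OF k_algebra_ground]; rule bilinearD(1)[OF bilinear_mul_eval]) (use ab cm in auto)
      from comult_mul[OF xyz(2,3) module_ground this]
      show "tsum K (\<Delta> (mul y z)) (\<lambda>p q. mul a p u \<otimes> mul b q v) =
          tsum K (\<Delta> y) (\<lambda>c d. tsum K (\<Delta> z) (\<lambda>e g. mul a (mul c e) u \<otimes> mul b (mul d g) v))" by simp
    qed
    also have "\<dots> = tsum K (?d p) (\<lambda>a b. ?h a u \<otimes> ?h b v)"
      unfolding p' by (subst sum3) (use xyz m in auto)
    finally show "?h p (u @ v) = tsum K (?d p) (\<lambda>a b. ?h a u \<otimes> ?h b v)" by (simp add: p')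
  next
    fix p t assume p: "p \<in> ?X" and t: "t \<in> carrier T"
    then obtain x y z where p': "p = (x, y, z)" and xyz: "x \<in> U" "y \<in> U" "z \<in> U" by blast
    have "(\<lambda>t\<in>carrier T. \<theta> (mul (mul x y) z) t) = (\<lambda>t\<in>carrier T. \<theta> (mul x (mul y z)) t)"
      using xyz m by (simp add: theta_conv R.m_assoc)
    then show "\<theta> (?g p) t = \<theta> (?h p) t" using t unfolding p' prod.case by (metis restrict_apply')
  qed (use assms in auto)
  then show ?thesis by simp
qed

lemma mul_one:
  assumes "x \<in> U"
  shows "mul unit x = x" "mul x unit = x"
proof -
  let ?R = "conv_alg K T A"
  interpret R: ring ?R by (rule k_algebraD(2)[OF k_algebra_conv_alg[OF coalgebra_T k_algebra_A]])
  note m = word_prod(1) and u1 = word_one(1)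
  have cm: "a \<in> U" "b \<in> U" if "(a, b) \<in> set (\<Delta> x)" "x \<in> U" for a b x
    using that comult_in_U by blast+
  show "mul unit x = x"
  proof (rule word_maps_eqI[where X = U and d = \<Delta> and g = "mul unit" and h = "\<lambda>x. x"])
    fix x u v assume x: "x \<in> U"
    have "mul unit x (u @ v) = tsum (ground K) (\<Delta> unit) (\<lambda>a b. tsum (ground K) (\<Delta> x) (\<lambda>c d. mul a c u \<otimes>\<^bsub>ground K\<^esub> mul b d v))"
      using word_prod(2)[OF u1 x, of u v] by simp
    also have "\<dots> = tsum (ground K) (\<Delta> x) (\<lambda>c d. mul unit c u \<otimes>\<^bsub>ground K\<^esub> mul unit d v)"
      by (rule comult_one[OF module_ground bilinear_mul_splits[OF comult_props(1)[OF x]]])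
    finally show "mul unit x (u @ v) = tsum K (\<Delta> x) (\<lambda>a b. mul unit a u \<otimes> mul unit b v)" by simp
  next
    fix x t assume x: "x \<in> U" and t: "t \<in> carrier T"
    have "(\<lambda>t\<in>carrier T. \<theta> (mul unit x) t) = (\<lambda>t\<in>carrier T. \<theta> x t)"
      using x u1 by (simp add: theta_conv)
    then show "\<theta> (mul unit x) t = \<theta> x t" using t by (metis restrict_apply')
  qed (use assms m u1 comult_props(1,2) in \<open>auto simp: word_prod(4) word_one(4) U_props(1)\<close>)
  show "mul x unit = x"
  proof (rule word_maps_eqI[where X = U and d = \<Delta> and g = "\<lambda>x. mul x unit" and h = "\<lambda>x. x"])
    fix x u v assume x: "x \<in> U"
    have "mul x unit (u @ v) = tsum (ground K) (\<Delta> x) (\<lambda>a b. tsum (ground K) (\<Delta> unit) (\<lambda>c d. mul a c u \<otimes>\<^bsub>ground K\<^esub> mul b d v))"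
      using word_prod(2)[OF x u1, of u v] by simp
    also have "\<dots> = tsum (ground K) (\<Delta> x) (\<lambda>a b. mul a unit u \<otimes>\<^bsub>ground K\<^esub> mul b unit v)"
      by (intro tsum_cong comult_one[OF module_ground] bilinear_mult[OF k_algebra_ground] bilinearD(1)[OF bilinear_mul_eval])
        (use cm[OF _ x] in auto)
    finally show "mul x unit (u @ v) = tsum K (\<Delta> x) (\<lambda>a b. mul a unit u \<otimes> mul b unit v)" by simp
  next
    fix x t assume x: "x \<in> U" and t: "t \<in> carrier T"
    have "(\<lambda>t\<in>carrier T. \<theta> (mul x unit) t) = (\<lambda>t\<in>carrier T. \<theta> x t)"
      using x u1 by (simp add: theta_conv)
    then show "\<theta> (mul x unit) t = \<theta> x t" using t by (metis restrict_apply')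
  qed (use assms m u1 comult_props(1,2) in \<open>auto simp: word_prod(4) word_one(4) U_props(1)\<close>)
qed

lemma B_simps [simp]:
  "carrier B = U" "mult B = mul" "one B = unit" "zero B = (\<lambda>w. \<zero>)" "comult B = \<Delta>" "counit B = (\<lambda>y. y [])"
  "add B = (\<lambda>x y w. x w \<oplus> y w)" "smult B = (\<lambda>c x w. c \<otimes> x w)"
  by (simp_all add: word_bialg_def)

lemma coalgebra_B: "coalgebra K B" by (simp add: word_bialg_def coalgebra_U)

lemma module_B: "module K B" by (rule coalgebraD(1)[OF coalgebra_B])

lemma k_algebra_B: "k_algebra K B"
proof -
  interpret M: module K B by (rule module_B)
  have bil: "bilinear K B B B mul" unfolding word_bialg_def by (rule bilinear_mul)
  note l = linear_mapD(2,3)[OF bilinearD(1)[OF bil]] linear_mapD(2,3)[OF bilinearD(2)[OF bil]]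
  have "ring B"
  proof (rule ringI)
    show "monoid B" by (rule monoidI) (auto simp: word_prod(1) word_one(1) mul_assoc mul_one)
  qed (use l M.M.abelian_group_axioms in auto)
  then show ?thesis using module_B l by (auto simp: k_algebra_def)
qed

lemma bialgebra_B: "bialgebra K B"
proof -
  have bil: "bilinear K C C C mul" unfolding word_coalg_def by (rule bilinear_mul)
  have ps: "set (concat (map (\<lambda>(x1, x2). map (\<lambda>(y1, y2). (mul x1 y1, mul x2 y2)) (\<Delta> y)) (\<Delta> x))) \<subseteq> U \<times> U"
    if "x \<in> U" "y \<in> U" for x y
    using that by (clarsimp, blast intro: word_prod(1) dest: comult_in_U)
  have "tensor_eq K B B (\<Delta> (mul x y)) (concat (map (\<lambda>(x1, x2). map (\<lambda>(y1, y2). (mul x1 y1, mul x2 y2)) (\<Delta> y)) (\<Delta> x)))"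
    (is "tensor_eq K B B _ ?ys") if xy: "x \<in> U" "y \<in> U" for x y
    unfolding word_bialg_def
  proof (rule U_tensor_eqI)
    fix u v
    have "tsum K ?ys (\<lambda>a b. a u \<otimes> b v) =
        tsum K (\<Delta> x) (\<lambda>a b. tsum K (map (\<lambda>(y1, y2). (mul a y1, mul b y2)) (\<Delta> y)) (\<lambda>a b. a u \<otimes> b v))"
      by (rule K.tsum_concat) (use xy in \<open>clarsimp, blast intro: K.m_closed U_props(1) word_prod(1) dest: comult_in_U\<close>)
    also have "\<dots> = mul x y (u @ v)" using word_prod(2)[OF xy, of u v] by (simp only: tsum_map)
    finally show "tsum K (\<Delta> (mul x y)) (\<lambda>a b. a u \<otimes> b v) = tsum K ?ys (\<lambda>a b. a u \<otimes> b v)"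
      using comult_props(2)[OF word_prod(1)[OF xy], of u v] by simp
  qed (use xy ps comult_props(1)[OF word_prod(1)[OF xy]] in auto)
  moreover have "tensor_eq K B B (\<Delta> unit) [(unit, unit)]"
    unfolding word_bialg_def
    by (rule U_tensor_eqI)
      (use word_one(1) comult_props(1)[OF word_one(1)] comult_props(2)[OF word_one(1)] U_props(1)[OF word_one(1)] in
        \<open>auto simp: comult_props(2)[OF word_one(1), symmetric] word_one(2)\<close>)
  ultimately show ?thesis
    using k_algebra_B coalgebra_B by (simp add: bialgebra_def word_prod(4) word_one(4))
qed

lemma bimeasuring_theta: "bimeasuring K B T A \<theta>"
  unfolding bimeasuring_def B_simps
  by (intro conjI ballI)
    (use linear_theta in \<open>auto simp: U_props(3,5) word_prod(3) word_one(3) comult_props(3) word_bialg_def\<close>)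

end

section \<open>Bialgebra maps\<close>

lemma tensor_eq_map_prod:
  assumes "tensor_eq K M N xs ys" "module K M" "module K N" "module K M'" "module K N'"
    and f: "linear_map K M M' f" and g: "linear_map K N N' g"
  shows "tensor_eq K M' N' (map (map_prod f g) xs) (map (map_prod f g) ys)"
  using assms(1)
proof induction
  case (refl xs)
  show ?case by (rule tensor_eq.refl) (use refl linear_mapD(1)[OF f] linear_mapD(1)[OF g] in auto)
next
  case (comm xs ys)
  show ?case unfolding map_append
    by (rule tensor_eq.comm) (use comm linear_mapD(1)[OF f] linear_mapD(1)[OF g] in auto)
next
  case (sym xs ys)
  show ?case by (rule tensor_eq.sym[OF sym(2)])
next
  case (trans xs ys zs)
  then show ?case by (blast intro: tensor_eq.trans)
next
  case (append xs xs' ys ys')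
  then show ?case unfolding map_append by (blast intro: tensor_eq.append)
qed (simp_all add: linear_mapD[OF f] linear_mapD[OF g] linear_map_zero[OF assms(2,4) f] tensor_eq.intros)

lemma BialgD:
  assumes "f \<in> Bialg K X Y"
  shows "x \<in> carrier X \<Longrightarrow> f x \<in> carrier Y" "linear_map K X Y f" "f \<in> extensional (carrier X)"
    and "x \<in> carrier X \<Longrightarrow> y \<in> carrier X \<Longrightarrow> f (x \<otimes>\<^bsub>X\<^esub> y) = f x \<otimes>\<^bsub>Y\<^esub> f y"
    and "f \<one>\<^bsub>X\<^esub> = \<one>\<^bsub>Y\<^esub>"
    and "x \<in> carrier X \<Longrightarrow> tensor_eq K Y Y (comult Y (f x)) (map (map_prod f f) (comult X x))"
    and "x \<in> carrier X \<Longrightarrow> counit Y (f x) = counit X x"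
  using assms by (auto simp: Bialg_def ring_hom_def)

lemma Bialg_comult:
  assumes "f \<in> Bialg K X Y" "bialgebra K Y" "module K V" "bilinear K Y Y V F" "x \<in> carrier X"
  shows "tsum V (comult Y (f x)) F = tsum V (comult X x) (\<lambda>a b. F (f a) (f b))"
proof -
  note Y = bialgebraD(3)[OF assms(2)]
  show ?thesis
    using tensor_eq_tsum[OF BialgD(6)[OF assms(1,5)] Y Y assms(3,4)] by (simp only: tsum_map_prod)
qed

lemma BialgI:
  assumes "linear_map K X Y f" "f \<in> extensional (carrier X)"
    and "\<And>x y. x \<in> carrier X \<Longrightarrow> y \<in> carrier X \<Longrightarrow> f (x \<otimes>\<^bsub>X\<^esub> y) = f x \<otimes>\<^bsub>Y\<^esub> f y"
    and "f \<one>\<^bsub>X\<^esub> = \<one>\<^bsub>Y\<^esub>"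
    and "\<And>x. x \<in> carrier X \<Longrightarrow> tensor_eq K Y Y (comult Y (f x)) (map (map_prod f f) (comult X x))"
    and "\<And>x. x \<in> carrier X \<Longrightarrow> counit Y (f x) = counit X x"
  shows "f \<in> Bialg K X Y"
  using assms linear_mapD(1,2)[OF assms(1)] by (auto simp: Bialg_def ring_hom_def)

lemma Bialg_id:
  assumes "bialgebra K X"
  shows "(\<lambda>x\<in>carrier X. x) \<in> Bialg K X X"
proof (rule BialgI)
  note X = bialgebraD[OF assms]
  interpret X: ring X by (rule X(4))
  show "linear_map K X X (\<lambda>x\<in>carrier X. x)"
    by (simp add: linear_map_restrict[OF X(3)] linear_map_ident)
  fix x assume x: "x \<in> carrier X"
  have "map (map_prod (\<lambda>x\<in>carrier X. x) (\<lambda>x\<in>carrier X. x)) (comult X x) = comult X x"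
    by (rule map_idI) (use comult_closed[OF X(2) _ x] in auto)
  then show "tensor_eq K X X (comult X ((\<lambda>x\<in>carrier X. x) x)) (map (map_prod (\<lambda>x\<in>carrier X. x) (\<lambda>x\<in>carrier X. x)) (comult X x))"
    using x coalgebraD(2)[OF X(2) x] by (simp add: tensor_eq.refl)
qed (use bialgebraD(4)[OF assms] in \<open>auto simp: ring.ring_simprules monoid.m_closed ring.is_monoid\<close>)

lemma Bialg_compose:
  assumes "bialgebra K X" "bialgebra K Y" "bialgebra K Z" and f: "f \<in> Bialg K X Y" and g: "g \<in> Bialg K Y Z"
  shows "compose (carrier X) g f \<in> Bialg K X Z"
proof (rule BialgI)
  note X = bialgebraD[OF assms(1)] and Y = bialgebraD[OF assms(2)] and Z = bialgebraD[OF assms(3)]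
  interpret X: ring X by (rule X(4))
  note fD = BialgD[OF f] and gD = BialgD[OF g]
  show "linear_map K X Z (compose (carrier X) g f)"
    unfolding compose_def linear_map_restrict[OF X(3)] by (rule linear_map_comp[OF fD(2) gD(2)])
  fix x assume x: "x \<in> carrier X"
  have eq: "map (map_prod g g) (map (map_prod f f) (comult X x)) =
      map (map_prod (compose (carrier X) g f) (compose (carrier X) g f)) (comult X x)"
    using comult_closed[OF X(2) _ x] by (auto simp: compose_def)
  have "tensor_eq K Z Z (comult Z (g (f x))) (map (map_prod g g) (map (map_prod f f) (comult X x)))"
    by (rule tensor_eq.trans[OF gD(6)[OF fD(1)[OF x]]
      tensor_eq_map_prod[OF fD(6)[OF x] Y(3) Y(3) Z(3) Z(3) gD(2) gD(2)]])
  then show "tensor_eq K Z Z (comult Z (compose (carrier X) g f x))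
      (map (map_prod (compose (carrier X) g f) (compose (carrier X) g f)) (comult X x))"
    unfolding eq compose_eq[OF x] .
qed (use bialgebraD(4)[OF assms(1)] BialgD(1,4,5,7)[OF f] BialgD(4,5,7)[OF g] in
  \<open>auto simp: compose_eq ring.ring_simprules\<close>)

section \<open>Universality\<close>

lemma bimeasuringD:
  fixes A (structure)
  assumes "bimeasuring K N T A f"
  shows "n \<in> carrier N \<Longrightarrow> linear_map K T A (f n)"
    and "t \<in> carrier T \<Longrightarrow> linear_map K N A (\<lambda>n. f n t)"
    and "n \<in> carrier N \<Longrightarrow> m \<in> carrier N \<Longrightarrow> t \<in> carrier T \<Longrightarrow>
      f (n \<otimes>\<^bsub>N\<^esub> m) t = tsum A (comult T t) (\<lambda>t1 t2. f n t1 \<otimes> f m t2)"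
    and "t \<in> carrier T \<Longrightarrow> f \<one>\<^bsub>N\<^esub> t = counit T t \<odot> \<one>"
    and "n \<in> carrier N \<Longrightarrow> t \<in> carrier T \<Longrightarrow> s \<in> carrier T \<Longrightarrow>
      f n (t \<otimes>\<^bsub>T\<^esub> s) = tsum A (comult N n) (\<lambda>n1 n2. f n1 t \<otimes> f n2 s)"
    and "n \<in> carrier N \<Longrightarrow> f n \<one>\<^bsub>T\<^esub> = counit N n \<odot> \<one>"
  using assms by (simp_all add: bimeasuring_def)

context measuring_data
begin

text \<open>
  With \<open>d\<close> the comultiplication of \<open>N\<close>, the monoid \<open>R\<close> is the convolution algebra; with the opposite
  comultiplication it is the opposite of the convolution algebra, on the same functionals.
\<close>

lemma measuring_lift:
  fixes N :: "('k, 'n) bialg" and R :: "('n \<Rightarrow> 'k, 'm) monoid_scheme"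
  assumes N: "coalgebra K N"
    and f_lin: "\<And>n. n \<in> carrier N \<Longrightarrow> linear_map K T A (f n)" "\<And>t. t \<in> carrier T \<Longrightarrow> linear_map K N A (\<lambda>n. f n t)"
    and f_one: "\<And>n. n \<in> carrier N \<Longrightarrow> f n \<one>\<^bsub>T\<^esub> = counit N n \<odot>\<^bsub>A\<^esub> \<one>\<^bsub>A\<^esub>"
    and f_mult: "\<And>n t s. n \<in> carrier N \<Longrightarrow> t \<in> carrier T \<Longrightarrow> s \<in> carrier T \<Longrightarrow>
      f n (t \<otimes>\<^bsub>T\<^esub> s) = tsum A (d n) (\<lambda>a b. f a t \<otimes>\<^bsub>A\<^esub> f b s)"
    and R: "monoid R" "carrier R = carrier (conv_alg K N (ground K))" "\<one>\<^bsub>R\<^esub> = \<one>\<^bsub>conv_alg K N (ground K)\<^esub>"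
    and d: "\<And>n. n \<in> carrier N \<Longrightarrow> set (d n) \<subseteq> carrier N \<times> carrier N"
    and R_mult: "\<And>n r s. n \<in> carrier N \<Longrightarrow> r \<in> carrier R \<Longrightarrow> s \<in> carrier R \<Longrightarrow>
      (r \<otimes>\<^bsub>R\<^esub> s) n = tsum K (d n) (\<lambda>a b. r a \<otimes> s b)"
  obtains g where "\<And>n. n \<in> carrier N \<Longrightarrow> g n \<in> U"
    and "\<And>n u v. n \<in> carrier N \<Longrightarrow> g n (u @ v) = tsum K (d n) (\<lambda>a b. g a u \<otimes> g b v)"
    and "\<And>n t. n \<in> carrier N \<Longrightarrow> t \<in> carrier T \<Longrightarrow> \<theta> (g n) t = f n t"
    and "\<And>n. n \<in> carrier N \<Longrightarrow> g n [] = counit N n"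
    and "\<And>w. linear_map K N (ground K) (\<lambda>n. g n w)"
proof -
  note NC = coalgebraD[OF N]
  let ?F = "\<lambda>(t, \<phi>). \<lambda>n\<in>carrier N. \<phi> (f n t)"
  let ?ev = "\<lambda>n r. r n"
  define g where "g n = word_lift K A T R ?F (?ev n)" for n
  have F: "?F (t, \<phi>) \<in> carrier R" if "t \<in> carrier T" "\<phi> \<in> forms K A" for t \<phi>
    using linear_map_comp[OF f_lin(2) form_linear] that
    by (simp add: R(2) conv_alg_simps(1) linear_map_restrict[OF NC(1)])
  have lin: "linear_map K N (ground K) r" if "r \<in> carrier R" for r
    using that by (simp add: R(2) conv_alg_simps(1))
  note wl = word_lift[where R = R and ev = ?ev and X = "carrier N" and d = d and f = f and F = ?F]
  have 2: "?ev n r \<in> carrier K" if "n \<in> carrier N" "r \<in> carrier R" for n r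
    using linear_mapD(1)[OF lin] that by simp
  have 6: "?ev n (?F (t, \<phi>)) = \<phi> (f n t)" if "n \<in> carrier N" "t \<in> carrier T" "\<phi> \<in> forms K A" for n t \<phi>
    using that by simp
  have one: "?ev n \<one>\<^bsub>R\<^esub> = counit N n" if "n \<in> carrier N" for n
    using that NC(5) by (simp add: R(3) conv_alg_simps(3))
  have 8: "f n \<one>\<^bsub>T\<^esub> = ?ev n \<one>\<^bsub>R\<^esub> \<odot>\<^bsub>A\<^esub> \<one>\<^bsub>A\<^esub>" if "n \<in> carrier N" for n
    using that f_one one by simp
  note prems = R(1) 2 d R_mult F 6 f_lin(1) 8 f_mult
  show thesis
  proof (rule that[of g])
    fix n assume n: "n \<in> carrier N"
    show "g n \<in> U" unfolding g_def by (rule wl(1)) (fact prems n)+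
    show "g n (u @ v) = tsum K (d n) (\<lambda>a b. g a u \<otimes> g b v)" for u v
      unfolding g_def by (rule wl(2)) (fact prems n)+
    show "\<theta> (g n) t = f n t" if "t \<in> carrier T" for t
      unfolding g_def by (rule wl(3)) (fact prems n that)+
    have "g n [] = ?ev n \<one>\<^bsub>R\<^esub>"
      unfolding g_def by (rule wl(4)) (fact prems n)+
    then show "g n [] = counit N n" using one[OF n] by simp
  next
    fix w
    show "linear_map K N (ground K) (\<lambda>n. g n w)"
    proof (cases "w \<in> lists (letters K A T)")
      case True
      obtain r where "r \<in> carrier R" "\<And>n. g n w = r n"
        using word_lift_is_eval[OF R(1) True, of ?F, OF F] by (auto simp: g_def)
      then show ?thesis using lin by simp
    next
      case False
      then have "g n w = \<zero>" for n by (simp add: g_def word_lift_def)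
      then show ?thesis using linear_map_const_zero[OF module_ground] by simp
    qed
  qed
qed

lemma Bialg_split:
  assumes "g \<in> Bialg K N B" "n \<in> carrier N"
  shows "g n (u @ v) = tsum K (comult N n) (\<lambda>a b. g a u \<otimes> g b v)"
proof -
  have "g n (u @ v) = tsum (ground K) (comult B (g n)) (\<lambda>a b. a u \<otimes>\<^bsub>ground K\<^esub> b v)"
    using comult_props(2)[of "g n" u v] BialgD(1)[OF assms] by simp
  also have "\<dots> = tsum (ground K) (comult N n) (\<lambda>a b. g a u \<otimes>\<^bsub>ground K\<^esub> g b v)"
    using linear_eval by (intro Bialg_comult[OF assms(1) bialgebra_B module_ground bilinear_mult[OF k_algebra_ground] assms(2)])
      (simp_all add: word_bialg_def)
  finally show ?thesis by simp
qed

lemma Bialg_eqI: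
  assumes N: "bialgebra K N" and g: "g \<in> Bialg K N B" and h: "h \<in> Bialg K N B"
    and th: "\<And>n t. n \<in> carrier N \<Longrightarrow> t \<in> carrier T \<Longrightarrow> \<theta> (g n) t = \<theta> (h n) t"
  shows "g = h"
proof (rule extensionalityI[OF BialgD(3)[OF g] BialgD(3)[OF h]])
  fix n assume n: "n \<in> carrier N"
  show "g n = h n"
    by (rule word_maps_eqI[where X = "carrier N" and d = "comult N"])
      (use n th BialgD(1,7)[OF g] BialgD(1,7)[OF h] Bialg_split[OF g] Bialg_split[OF h]
        coalgebraD(2)[OF bialgebraD(2)[OF N]] in auto)
qed

text \<open>
  The lift of \<open>f\<close> as a measuring is a coalgebra map. It is multiplicative because \<open>g(nm)\<close> and \<open>g(n) g(m)\<close>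
  both split along the comultiplication of the tensor square of \<open>N\<close>, and their \<open>\<theta>\<close> agree by the
  bimeasuring identity for products in \<open>N\<close>.
\<close>

lemma bimeasuring_Bialg:
  fixes N :: "('k, 'n) bialg"
  assumes N: "bialgebra K N" and f: "bimeasuring K N T A f"
  shows "\<exists>g\<in>Bialg K N B. \<forall>n\<in>carrier N. \<forall>t\<in>carrier T. f n t = \<theta> (g n) t"
proof -
  note ND = bialgebraD[OF N] and fD = bimeasuringD[OF f]
  note NC = coalgebraD[OF ND(2)]
  interpret N: ring N by (rule ND(4))
  let ?R = "conv_alg K N (ground K)"
  interpret R: ring ?R by (rule k_algebraD(2)[OF k_algebra_conv_alg[OF ND(2) k_algebra_ground]])
  obtain g where gU: "\<And>n. n \<in> carrier N \<Longrightarrow> g n \<in> U"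
    and split: "\<And>n u v. n \<in> carrier N \<Longrightarrow> g n (u @ v) = tsum K (comult N n) (\<lambda>a b. g a u \<otimes> g b v)"
    and th: "\<And>n t. n \<in> carrier N \<Longrightarrow> t \<in> carrier T \<Longrightarrow> \<theta> (g n) t = f n t"
    and Nil: "\<And>n. n \<in> carrier N \<Longrightarrow> g n [] = counit N n"
    and lin: "\<And>w. linear_map K N (ground K) (\<lambda>n. g n w)"
    by (rule measuring_lift[OF ND(2) fD(1,2,6,5) R.is_monoid HOL.refl HOL.refl NC(2)])
      (auto simp: conv_alg_simps(2))
  have gm: "linear_map K N C g"
    using linear_mapD(2,3)[OF lin] gU by (intro linear_mapI) auto
  have gB: "linear_map K N B g"
    using linear_mapD(2,3)[OF lin] gU by (intro linear_mapI) auto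
  have map_U: "set (map (map_prod g g) (comult N n)) \<subseteq> U \<times> U" if "n \<in> carrier N" for n
    using comult_closed[OF ND(2) _ that] gU by auto
  have comult_g: "tsum V (\<Delta> (g n)) F = tsum V (comult N n) (\<lambda>a b. F (g a) (g b))"
    if "n \<in> carrier N" "module K V" "bilinear K C C V F" for n and V :: "('k, 'v, 'w) module_scheme" and F
  proof -
    have "tsum V (\<Delta> (g n)) F = tsum V (map (map_prod g g) (comult N n)) F"
      by (rule comult_tsum_eqI[OF gU[OF that(1)] map_U[OF that(1)] that(2) that(3)[unfolded word_coalg_def]])
        (simp only: tsum_map_prod split[OF that(1)])
    then show ?thesis by (simp only: tsum_map_prod)
  qed
  have mult: "g (n \<otimes>\<^bsub>N\<^esub> m) = mul (g n) (g m)" if nm: "n \<in> carrier N" "m \<in> carrier N" for n m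
  proof -
    let ?d = "\<lambda>(n, m). pair_splits (comult N n) (comult N m)"
    let ?g = "\<lambda>(n, m). g (n \<otimes>\<^bsub>N\<^esub> m)" and ?h = "\<lambda>(n, m). mul (g n) (g m)"
    have "?g (n, m) = ?h (n, m)"
    proof (rule word_maps_eqI[where X = "carrier N \<times> carrier N" and d = ?d])
      fix p assume "p \<in> carrier N \<times> carrier N"
      then obtain n m where p: "p = (n, m)" and nm: "n \<in> carrier N" "m \<in> carrier N" by blast
      have cm: "a \<in> carrier N" "b \<in> carrier N" if "(a, b) \<in> set (comult N n) \<union> set (comult N m)" for a b
        using that comult_closed[OF ND(2)] nm by blast+
      show "?g p \<in> U" "?h p \<in> U" using nm by (auto simp: p gU word_prod(1))
      show "set (?d p) \<subseteq> (carrier N \<times> carrier N) \<times> (carrier N \<times> carrier N)"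
        unfolding p prod.case by (intro set_pair_splits NC(2) nm)
      show "?g p [] = ?h p []" using nm by (simp add: p Nil word_prod(4) gU ND(5))
      show "\<theta> (?g p) t = \<theta> (?h p) t" if t: "t \<in> carrier T" for t
        unfolding p prod.case th[OF N.m_closed[OF nm] t] fD(3)[OF nm t] word_prod(3)[OF gU[OF nm(1)] gU[OF nm(2)] t]
        by (rule comult_cong[OF coalgebra_T t]) (simp add: th nm)
      fix u v
      have ps: "tsum K (?d p) (\<lambda>a b. k a u \<otimes> k b v) =
          tsum K (comult N n) (\<lambda>a b. tsum K (comult N m) (\<lambda>c d. k (a, c) u \<otimes> k (b, d) v))"
        if k: "\<And>a b. a \<in> carrier N \<Longrightarrow> b \<in> carrier N \<Longrightarrow> k (a, b) \<in> U" for k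
        unfolding p prod.case
      proof (rule K.tsum_pair_splits)
        fix a b c d assume "(a, b) \<in> set (comult N n)" "(c, d) \<in> set (comult N m)"
        then have "a \<in> carrier N" "b \<in> carrier N" "c \<in> carrier N" "d \<in> carrier N"
          using cm[of a b] cm[of c d] by auto
        then show "k (a, c) u \<otimes> k (b, d) v \<in> carrier K" using U_props(1)[OF k] by simp
      qed
      have "g (n \<otimes>\<^bsub>N\<^esub> m) (u @ v) = tsum (ground K) (comult N (n \<otimes>\<^bsub>N\<^esub> m)) (\<lambda>a b. g a u \<otimes>\<^bsub>ground K\<^esub> g b v)"
        using split nm by simp
      also have "\<dots> = tsum (ground K) (comult N n) (\<lambda>a b. tsum (ground K) (comult N m)
          (\<lambda>c d. g (a \<otimes>\<^bsub>N\<^esub> c) u \<otimes>\<^bsub>ground K\<^esub> g (b \<otimes>\<^bsub>N\<^esub> d) v))"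
        by (rule bialgebra_comult_mult[OF N module_ground bilinear_mult[OF k_algebra_ground lin lin] nm])
      also have "\<dots> = tsum K (?d p) (\<lambda>a b. ?g a u \<otimes> ?g b v)"
        by (subst ps) (auto simp: gU)
      finally show "?g p (u @ v) = tsum K (?d p) (\<lambda>a b. ?g a u \<otimes> ?g b v)" by (simp add: p)
      have "mul (g n) (g m) (u @ v) = tsum (ground K) (\<Delta> (g n)) (\<lambda>a b. tsum (ground K) (\<Delta> (g m))
          (\<lambda>c d. mul a c u \<otimes>\<^bsub>ground K\<^esub> mul b d v))"
        using word_prod(2)[OF gU[OF nm(1)] gU[OF nm(2)]] by simp
      also have "\<dots> = tsum (ground K) (comult N n) (\<lambda>a b. tsum (ground K) (\<Delta> (g m))
          (\<lambda>c d. mul (g a) c u \<otimes>\<^bsub>ground K\<^esub> mul (g b) d v))"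
        by (rule comult_g[OF nm(1) module_ground bilinear_mul_splits]) (rule comult_props(1)[OF gU[OF nm(2)]])
      also have "\<dots> = tsum (ground K) (comult N n) (\<lambda>a b. tsum (ground K) (comult N m)
          (\<lambda>c d. mul (g a) (g c) u \<otimes>\<^bsub>ground K\<^esub> mul (g b) (g d) v))"
        by (intro tsum_cong comult_g[OF nm(2) module_ground] bilinear_mult[OF k_algebra_ground] bilinearD(1)[OF bilinear_mul_eval])
          (use comult_closed[OF ND(2) _ nm(1)] gU in auto)
      also have "\<dots> = tsum K (?d p) (\<lambda>a b. ?h a u \<otimes> ?h b v)"
        by (subst ps) (auto simp: gU word_prod(1))
      finally show "?h p (u @ v) = tsum K (?d p) (\<lambda>a b. ?h a u \<otimes> ?h b v)" by (simp add: p)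
    qed (use nm in auto)
    then show ?thesis by simp
  qed
  have one: "g \<one>\<^bsub>N\<^esub> = unit"
  proof -
    have "(\<lambda>_::unit. g \<one>\<^bsub>N\<^esub>) () = (\<lambda>_. unit) ()"
    proof (rule word_maps_eqI[where X = UNIV and d = "\<lambda>_. [((), ())]"])
      fix u v
      have "g \<one>\<^bsub>N\<^esub> (u @ v) = tsum (ground K) (comult N \<one>\<^bsub>N\<^esub>) (\<lambda>a b. g a u \<otimes>\<^bsub>ground K\<^esub> g b v)"
        using split by simp
      also have "\<dots> = g \<one>\<^bsub>N\<^esub> u \<otimes>\<^bsub>ground K\<^esub> g \<one>\<^bsub>N\<^esub> v"
        by (rule bialgebra_comult_one[OF N module_ground bilinear_mult[OF k_algebra_ground lin lin]])
      finally show "g \<one>\<^bsub>N\<^esub> (u @ v) = tsum K [((), ())] (\<lambda>a b. g \<one>\<^bsub>N\<^esub> u \<otimes> g \<one>\<^bsub>N\<^esub> v)"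
        using U_props(1)[OF gU] by simp
    qed (use gU word_one Nil th fD(4) ND(6) U_props(1)[OF word_one(1)] in auto)
    then show ?thesis by simp
  qed
  let ?g = "\<lambda>n\<in>carrier N. g n"
  have "?g \<in> Bialg K N B"
  proof (rule BialgI)
    show "linear_map K N B ?g" using gB by (simp add: linear_map_restrict[OF ND(3)])
    fix n assume n: "n \<in> carrier N"
    have eq: "map (map_prod ?g ?g) (comult N n) = map (map_prod g g) (comult N n)"
      using comult_closed[OF ND(2) _ n] by auto
    have "tensor_eq K B B (\<Delta> (g n)) (map (map_prod g g) (comult N n))"
      unfolding word_bialg_def
      by (rule U_tensor_eqI[OF comult_props(1)[OF gU[OF n]] map_U[OF n]])
        (simp only: tsum_map_prod split[OF n] comult_props(2)[OF gU[OF n], symmetric])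
    then show "tensor_eq K B B (comult B (?g n)) (map (map_prod ?g ?g) (comult N n))"
      by (simp only: eq B_simps restrict_apply'[OF n])
  qed (use mult one Nil in auto)
  then show ?thesis using th by (intro bexI[of _ ?g]) auto
qed

lemma universal_bimeasuring_B: "universal_bimeasuring TYPE('n) K A T B \<theta>"
  unfolding universal_bimeasuring_def
proof (intro conjI allI impI bialgebra_B bimeasuring_theta)
  fix N :: "('k, 'n) bialg" and f
  assume N: "bialgebra K N" and f: "bimeasuring K N T A f"
  obtain g where g: "g \<in> Bialg K N B" "\<forall>n\<in>carrier N. \<forall>t\<in>carrier T. f n t = \<theta> (g n) t"
    using bimeasuring_Bialg[OF N f] by blast
  show "\<exists>!g. g \<in> Bialg K N B \<and> (\<forall>n\<in>carrier N. \<forall>t\<in>carrier T. f n t = \<theta> (g n) t)"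
    by (rule ex1I[of _ g]) (use g Bialg_eqI[OF N] in auto)
qed

end

section \<open>Antipodes\<close>

lemma antipodeD:
  fixes H (structure)
  assumes "antipode K H S"
  shows "linear_map K H H S"
    and "x \<in> carrier H \<Longrightarrow> tsum H (comult H x) (\<lambda>a b. S a \<otimes> b) = counit H x \<odot> \<one>"
    and "x \<in> carrier H \<Longrightarrow> tsum H (comult H x) (\<lambda>a b. a \<otimes> S b) = counit H x \<odot> \<one>"
  using assms by (simp_all add: antipode_def)

lemma antipode_one:
  fixes H (structure)
  assumes "bialgebra K H" "antipode K H S"
  shows "S \<one> = \<one>"
proof -
  note H = bialgebraD[OF assms(1)] and S = antipodeD[OF assms(2)]
  interpret H: ring H by (rule H(4))
  interpret M: module K H by (rule H(3))
  have "S \<one> \<otimes> \<one> = tsum H (comult H \<one>) (\<lambda>a b. S a \<otimes> b)"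
    by (rule bialgebra_comult_one[OF assms(1) H(3) bilinear_mult[OF H(1) S(1) linear_map_ident], symmetric])
  then show ?thesis using S(2) H(6) linear_mapD(1)[OF S(1)] by simp
qed

text \<open>
  In the convolution algebra of bilinear maps \<open>H \<times> H \<rightarrow> H\<close>, the map \<open>S(xy)\<close> is a left inverse and
  \<open>S(y) S(x)\<close> is a right inverse of the multiplication.
\<close>

lemma antipode_mult:
  fixes H (structure)
  assumes "bialgebra K H" "antipode K H S" and x: "x \<in> carrier H" and y: "y \<in> carrier H"
  shows "S (x \<otimes> y) = S y \<otimes> S x"
proof -
  note H = bialgebraD[OF assms(1)] and S = antipodeD[OF assms(2)]
  interpret H: ring H by (rule H(4))
  interpret M: module K H by (rule H(3))
  note Sc = linear_mapD(1)[OF S(1)] and id = linear_map_ident[of K H]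
  note cm = comult_closed[OF H(2)]
  let ?R = "conv_alg K H (conv_alg K H H)"
  have "k_algebra K ?R" by (intro k_algebra_conv_alg H(1,2))
  then interpret R: ring ?R by (rule k_algebraD(2))
  have mulb: "bilinear K H H H (\<lambda>x y. x \<otimes> y)" by (rule bilinear_mult[OF H(1) id id])
  have Sr: "bilinear K H H H (\<lambda>x y. S y \<otimes> S x)"
    by (intro bilinearI linear_map_mult_l[OF H(1) S(1)] linear_map_mult_r[OF H(1) S(1)] Sc)
  let ?c = "\<lambda>F. \<lambda>x\<in>carrier H. \<lambda>y\<in>carrier H. F x y"
  let ?p = "?c (\<lambda>x y. S (x \<otimes> y))" and ?q = "?c (\<lambda>x y. x \<otimes> y)" and ?r = "?c (\<lambda>x y. S y \<otimes> S x)"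
  have p: "?p \<in> carrier ?R" by (rule conv2_carrier[OF H(2,2) linear_map_bilinear_comp[OF mulb S(1)]])
  have q: "?q \<in> carrier ?R" by (rule conv2_carrier[OF H(2,2) mulb])
  have r: "?r \<in> carrier ?R" by (rule conv2_carrier[OF H(2,2) Sr])
  have eqI: "f = g" if f: "f \<in> carrier ?R" and g: "g \<in> carrier ?R"
      and eq: "\<And>x y. x \<in> carrier H \<Longrightarrow> y \<in> carrier H \<Longrightarrow> f x y = g x y" for f g
  proof (rule extensionalityI[where A = "carrier H"])
    show "f \<in> extensional (carrier H)" "g \<in> extensional (carrier H)" using f g by (simp_all add: conv_alg_simps(1))
    fix x assume x: "x \<in> carrier H"
    have "f x \<in> carrier (conv_alg K H H)" "g x \<in> carrier (conv_alg K H H)"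
      using f g x linear_mapD(1)[of K H "conv_alg K H H"] conv_alg_simps(1)[of _ K H "conv_alg K H H"] by blast+
    then show "f x = g x" using eq[OF x] by (intro extensionalityI[of "f x" "carrier H"]) (simp_all add: conv_alg_simps(1))
  qed
  have one: "\<one>\<^bsub>?R\<^esub> x y = (counit H x \<otimes>\<^bsub>K\<^esub> counit H y) \<odot> \<one>" if "x \<in> carrier H" "y \<in> carrier H" for x y
    using that coalgebraD(5)[OF H(2)] by (simp add: conv_alg_simps M.smult_assoc1)
  have pq: "?p \<otimes>\<^bsub>?R\<^esub> ?q = \<one>\<^bsub>?R\<^esub>"
  proof (rule eqI)
    fix x y assume xy: "x \<in> carrier H" "y \<in> carrier H"
    have "(?p \<otimes>\<^bsub>?R\<^esub> ?q) x y = tsum H (comult H x) (\<lambda>a b. tsum H (comult H y) (\<lambda>c d. S (a \<otimes> c) \<otimes> (b \<otimes> d)))"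
      unfolding conv2_mult[OF H(2,2,1) p q xy]
      by (intro comult_cong[OF H(2) xy(1)] comult_cong[OF H(2) xy(2)]) simp
    also have "\<dots> = tsum H (comult H (x \<otimes> y)) (\<lambda>a b. S a \<otimes> b)"
      by (rule bialgebra_comult_mult[OF assms(1) H(3) bilinear_mult[OF H(1) S(1) id] xy, symmetric])
    also have "\<dots> = \<one>\<^bsub>?R\<^esub> x y" using xy by (simp add: S(2) H(5) one)
    finally show "(?p \<otimes>\<^bsub>?R\<^esub> ?q) x y = \<one>\<^bsub>?R\<^esub> x y" .
  qed (use p q in auto)
  have qr: "?q \<otimes>\<^bsub>?R\<^esub> ?r = \<one>\<^bsub>?R\<^esub>"
  proof (rule eqI)
    fix x y assume xy: "x \<in> carrier H" "y \<in> carrier H"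
    have e: "counit H x \<in> carrier K" "counit H y \<in> carrier K" using xy coalgebraD(5)[OF H(2)] by auto
    have "(?q \<otimes>\<^bsub>?R\<^esub> ?r) x y = tsum H (comult H x) (\<lambda>a b. tsum H (comult H y) (\<lambda>c d. (a \<otimes> c) \<otimes> (S d \<otimes> S b)))"
      unfolding conv2_mult[OF H(2,2,1) q r xy]
      by (intro comult_cong[OF H(2) xy(1)] comult_cong[OF H(2) xy(2)]) simp
    also have "\<dots> = tsum H (comult H x) (\<lambda>a b. a \<otimes> tsum H (comult H y) (\<lambda>c d. c \<otimes> S d) \<otimes> S b)"
    proof (rule comult_cong[OF H(2) xy(1)])
      fix a b assume ab: "a \<in> carrier H" "b \<in> carrier H"
      have "tsum H (comult H y) (\<lambda>c d. (a \<otimes> c) \<otimes> (S d \<otimes> S b)) = tsum H (comult H y) (\<lambda>c d. a \<otimes> (c \<otimes> S d) \<otimes> S b)"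
        by (rule comult_cong[OF H(2) xy(2)]) (simp add: ab Sc H.m_assoc)
      also have "\<dots> = tsum H (comult H y) (\<lambda>c d. a \<otimes> (c \<otimes> S d)) \<otimes> S b"
        by (rule H.tsum_l_distr[symmetric]) (use ab Sc cm[OF _ xy(2)] in auto)
      also have "tsum H (comult H y) (\<lambda>c d. a \<otimes> (c \<otimes> S d)) = a \<otimes> tsum H (comult H y) (\<lambda>c d. c \<otimes> S d)"
        by (rule H.tsum_r_distr[symmetric]) (use ab Sc cm[OF _ xy(2)] in auto)
      finally show "tsum H (comult H y) (\<lambda>c d. (a \<otimes> c) \<otimes> (S d \<otimes> S b)) =
          a \<otimes> tsum H (comult H y) (\<lambda>c d. c \<otimes> S d) \<otimes> S b" .
    qed
    also have "\<dots> = tsum H (comult H x) (\<lambda>a b. counit H y \<odot> (a \<otimes> S b))"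
      by (rule comult_cong[OF H(2) xy(1)]) (simp add: S(3) xy e Sc k_algebraD(3,4)[OF H(1)])
    also have "\<dots> = counit H y \<odot> tsum H (comult H x) (\<lambda>a b. a \<otimes> S b)"
      by (rule M.tsum_smult[symmetric]) (use e Sc cm[OF _ xy(1)] in auto)
    also have "\<dots> = \<one>\<^bsub>?R\<^esub> x y" using xy e by (simp add: S(3) one M.smult_assoc1[symmetric] M.R.m_comm)
    finally show "(?q \<otimes>\<^bsub>?R\<^esub> ?r) x y = \<one>\<^bsub>?R\<^esub> x y" .
  qed (use q r in auto)
  have "?p = ?r" by (rule R.inv_unique[OF pq qr q p r])
  then have "?p x y = ?r x y" by simp
  then show ?thesis using x y by simp
qed

text \<open>
  In the convolution algebra of \<open>X\<close> and \<open>Y\<close>, the map \<open>f \<circ> S\<close> is a left inverse and \<open>S' \<circ> f\<close> is a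
  right inverse of \<open>f\<close>.
\<close>

lemma Bialg_antipode:
  fixes Y (structure)
  assumes "bialgebra K X" "bialgebra K Y" and f: "f \<in> Bialg K X Y"
    and "antipode K X S" "antipode K Y S'" and x: "x \<in> carrier X"
  shows "f (S x) = S' (f x)"
proof -
  note X = bialgebraD[OF assms(1)] and Y = bialgebraD[OF assms(2)] and fD = BialgD[OF f]
  note S = antipodeD[OF assms(4)] and S' = antipodeD[OF assms(5)]
  interpret X: ring X by (rule X(4))
  interpret Y: ring Y by (rule Y(4))
  note Sc = linear_mapD(1)[OF S(1)] and Sc' = linear_mapD(1)[OF S'(1)]
  let ?R = "conv_alg K X Y"
  interpret R: ring ?R by (rule k_algebraD(2)[OF k_algebra_conv_alg[OF X(2) Y(1)]])
  let ?p = "\<lambda>x\<in>carrier X. f (S x)" and ?r = "\<lambda>x\<in>carrier X. S' (f x)"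
  have p: "?p \<in> carrier ?R" and r: "?r \<in> carrier ?R" and q: "f \<in> carrier ?R"
    using linear_map_comp[OF S(1) fD(2)] linear_map_comp[OF fD(2) S'(1)] fD(2,3)
    by (simp_all add: conv_alg_simps(1) linear_map_restrict[OF X(3)])
  have pq: "?p \<otimes>\<^bsub>?R\<^esub> f = \<one>\<^bsub>?R\<^esub>" unfolding conv_alg_simps
  proof (rule restrict_ext)
    fix x assume x: "x \<in> carrier X"
    have "tsum Y (comult X x) (\<lambda>a b. ?p a \<otimes> f b) = tsum Y (comult X x) (\<lambda>a b. f (S a \<otimes>\<^bsub>X\<^esub> b))"
      by (rule comult_cong[OF X(2) x]) (simp add: fD(4) Sc)
    also have "\<dots> = f (tsum X (comult X x) (\<lambda>a b. S a \<otimes>\<^bsub>X\<^esub> b))"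
      by (rule linear_map_tsum[OF X(3) Y(3) fD(2), symmetric]) (use comult_closed[OF X(2) _ x] Sc in auto)
    finally show "tsum Y (comult X x) (\<lambda>a b. ?p a \<otimes> f b) = counit X x \<odot> \<one>"
      using x coalgebraD(5)[OF X(2) x] by (simp add: S(2) linear_mapD(3)[OF fD(2)] fD(5))
  qed
  have qr: "f \<otimes>\<^bsub>?R\<^esub> ?r = \<one>\<^bsub>?R\<^esub>" unfolding conv_alg_simps
  proof (rule restrict_ext)
    fix x assume x: "x \<in> carrier X"
    have "tsum Y (comult X x) (\<lambda>a b. f a \<otimes> ?r b) = tsum Y (comult X x) (\<lambda>a b. f a \<otimes> S' (f b))"
      by (rule comult_cong[OF X(2) x]) simp
    also have "\<dots> = tsum Y (comult Y (f x)) (\<lambda>a b. a \<otimes> S' b)"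
      by (rule Bialg_comult[OF f assms(2) Y(3) bilinear_mult[OF Y(1) linear_map_ident S'(1)] x, symmetric])
    finally show "tsum Y (comult X x) (\<lambda>a b. f a \<otimes> ?r b) = counit X x \<odot> \<one>"
      using x by (simp add: S'(3) fD(1,7))
  qed
  have "?p x = ?r x" using R.inv_unique[OF pq qr q p r] by simp
  then show ?thesis using x by simp
qed

text \<open>
  In Sweedler notation the left side is \<open>H(b2, b3) G(b1, b4)\<close>. By coassociativity the middle pair is a
  comultiplication, which \<open>mid\<close> replaces by a counit, and the counit law then merges the
  remaining components. This is the step that shortens a word by one letter in the proof that
  the lifted map is an antipode.
\<close>

lemma collapse_middle:
  fixes K (structure)
  assumes "coalgebra K C" and G: "bilinear K C C (ground K) G" and H: "bilinear K C C (ground K) H"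
    and mid: "\<And>m. m \<in> carrier C \<Longrightarrow> tsum K (comult C m) H = counit C m \<otimes> h" and h: "h \<in> carrier K"
    and b: "b \<in> carrier C"
  shows "tsum K (comult C b) (\<lambda>a c. tsum K (comult C a) (\<lambda>a1 a2. tsum K (comult C c)
      (\<lambda>c1 c2. H a2 c1 \<otimes> G a1 c2))) = h \<otimes> tsum K (comult C b) G"
proof -
  note C = coalgebraD[OF assms(1)]
  interpret C: module K C by (rule C(1))
  have kg: "k_algebra K (ground K)" by (rule algebra_k_algebra[OF algebra_ground[OF C.R.cring_axioms]])
  note mg = k_algebraD(1)[OF kg]
  note cm = comult_closed[OF assms(1)]
  note Gc = bilinearD(3)[OF G, simplified] and Hc = bilinearD(3)[OF H, simplified]
  note G1 = bilinearD(1)[OF G] and G2 = bilinearD(2)[OF G] and H1 = bilinearD(1)[OF H] and H2 = bilinearD(2)[OF H]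
  let ?T = "\<lambda>a1 a2 c. tsum (ground K) (comult C c) (\<lambda>c1 c2. H a2 c1 \<otimes>\<^bsub>ground K\<^esub> G a1 c2)"
  have T: "trilinear K C (ground K) ?T"
    unfolding trilinear_def
  proof (intro conjI ballI bilinearI)
    fix a1 a2 assume a: "a1 \<in> carrier C" "a2 \<in> carrier C"
    show "linear_map K C (ground K) (?T a1 a2)"
      by (rule linear_map_comult[OF assms(1) mg bilinear_mult[OF kg H1[OF a(2)] G1[OF a(1)]]])
  next
    fix a c assume ac: "a \<in> carrier C" "c \<in> carrier C"
    show l: "linear_map K C (ground K) (\<lambda>x. ?T a x c)"
      by (rule linear_map_sum[OF mg], rule linear_map_mult_l[OF kg H2]) (use ac cm[OF _ ac(2)] Gc in auto)
    show "linear_map K C (ground K) (\<lambda>x. ?T x a c)"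
      by (rule linear_map_sum[OF mg], rule linear_map_mult_r[OF kg G2]) (use ac cm[OF _ ac(2)] Hc in auto)
  next
    fix c a assume ac: "c \<in> carrier C" "a \<in> carrier C"
    show "linear_map K C (ground K) (\<lambda>x. ?T a x c)"
      by (rule linear_map_sum[OF mg], rule linear_map_mult_l[OF kg H2]) (use ac cm[OF _ ac(1)] Gc in auto)
  qed
  have T': "trilinear K C (ground K) (\<lambda>p q z. H p q \<otimes>\<^bsub>ground K\<^esub> G x z)" if x: "x \<in> carrier C" for x
    unfolding trilinear_def
    by (intro conjI ballI bilinear_mult[OF kg H1 G1[OF x]] bilinearI linear_map_mult_l[OF kg H1] linear_map_mult_l[OF kg H2])
      (use x Gc in auto)
  have "tsum (ground K) (comult C b) (\<lambda>a c. tsum (ground K) (comult C a) (\<lambda>a1 a2. ?T a1 a2 c)) =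
      tsum (ground K) (comult C b) (\<lambda>x y. tsum (ground K) (comult C y) (?T x))"
    by (rule coalgebra_coassoc[OF assms(1) mg T b])
  also have "\<dots> = tsum (ground K) (comult C b) (\<lambda>x y. tsum (ground K) (comult C y) (\<lambda>m z.
      tsum (ground K) (comult C m) (\<lambda>p q. H p q \<otimes>\<^bsub>ground K\<^esub> G x z)))"
    by (intro comult_cong[OF assms(1) b] coalgebra_coassoc[OF assms(1) mg T', symmetric])
  also have "\<dots> = tsum (ground K) (comult C b) (\<lambda>x y. h \<otimes> G x y)"
  proof (rule comult_cong[OF assms(1) b])
    fix x y assume xy: "x \<in> carrier C" "y \<in> carrier C"
    have "tsum (ground K) (comult C y) (\<lambda>m z. tsum (ground K) (comult C m) (\<lambda>p q. H p q \<otimes>\<^bsub>ground K\<^esub> G x z)) =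
        tsum (ground K) (comult C y) (\<lambda>m z. counit C m \<odot>\<^bsub>ground K\<^esub> (h \<otimes>\<^bsub>ground K\<^esub> G x z))"
    proof (rule comult_cong[OF assms(1) xy(2)])
      fix m z assume mz: "m \<in> carrier C" "z \<in> carrier C"
      have "tsum K (comult C m) (\<lambda>p q. H p q \<otimes> G x z) = tsum K (comult C m) H \<otimes> G x z"
        by (rule C.R.tsum_l_distr[symmetric]) (use cm[OF _ mz(1)] Hc Gc xy mz in auto)
      then show "tsum (ground K) (comult C m) (\<lambda>p q. H p q \<otimes>\<^bsub>ground K\<^esub> G x z) =
          counit C m \<odot>\<^bsub>ground K\<^esub> (h \<otimes>\<^bsub>ground K\<^esub> G x z)"
        using mz xy h C(5) Gc by (simp add: mid C.R.m_assoc)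
    qed
    also have "\<dots> = h \<otimes>\<^bsub>ground K\<^esub> G x y"
      by (rule coalgebra_counit(1)[OF assms(1) mg linear_map_mult_r[OF kg G1[OF xy(1)]] xy(2)]) (use h in simp)
    finally show "tsum (ground K) (comult C y) (\<lambda>m z. tsum (ground K) (comult C m) (\<lambda>p q. H p q \<otimes>\<^bsub>ground K\<^esub> G x z)) =
        h \<otimes> G x y" by simp
  qed
  also have "\<dots> = h \<otimes> tsum K (comult C b) G"
    unfolding list_sum_ground by (rule C.R.tsum_r_distr[symmetric]) (use cm[OF _ b] Gc h in auto)
  finally show ?thesis by simp
qed

context measuring_data
begin

text \<open>
  The map \<open>(b, t) \<mapsto> \<theta>(b, S t)\<close> measures along the opposite comultiplication: \<open>S\<close> reverses products and
  \<open>A\<close> is commutative. So it lifts through the opposite of the convolution algebra.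
\<close>

lemma antipode_lift:
  assumes S: "antipode K T S"
  obtains g where "linear_map K C C g"
    and "\<And>b u v. b \<in> U \<Longrightarrow> g b (u @ v) = tsum K (\<Delta> b) (\<lambda>a c. g c u \<otimes> g a v)"
    and "\<And>b t. b \<in> U \<Longrightarrow> t \<in> carrier T \<Longrightarrow> \<theta> (g b) t = \<theta> b (S t)"
    and "\<And>b. b \<in> U \<Longrightarrow> g b [] = b []"
proof -
  note SD = antipodeD[OF S]
  note Sc = linear_mapD(1)[OF SD(1)]
  let ?R = "conv_alg K C (ground K)"
  interpret R: ring ?R by (rule k_algebraD(2)[OF k_algebra_conv_alg[OF coalgebra_C k_algebra_ground]])
  \<comment> \<open>Reversed multiplication of functionals corresponds to the swapped comultiplication \<open>?d\<close>.\<close>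
  let ?Rop = "\<lparr>carrier = carrier ?R, mult = (\<lambda>r s. s \<otimes>\<^bsub>?R\<^esub> r), one = \<one>\<^bsub>?R\<^esub>\<rparr>"
  let ?d = "\<lambda>b. map (\<lambda>(a, c). (c, a)) (\<Delta> b)"
  have Rop: "monoid ?Rop" by (rule monoidI) (auto simp: R.m_assoc)
  have c1: "linear_map K T A (\<lambda>t. \<theta> b (S t))" if "b \<in> carrier C" for b
    using linear_map_comp[OF SD(1) U_props(3)] that by simp
  have c2: "linear_map K C A (\<lambda>b. \<theta> b (S t))" if "t \<in> carrier T" for t
    by (rule linear_C(2)[OF Sc[OF that]])
  have c3: "\<theta> b (S \<one>\<^bsub>T\<^esub>) = counit C b \<odot>\<^bsub>A\<^esub> \<one>\<^bsub>A\<^esub>" if "b \<in> carrier C" for b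
    using that by (simp add: antipode_one[OF bialgebra_T S] U_props(5))
  have c4: "\<theta> b (S (t \<otimes>\<^bsub>T\<^esub> s)) = tsum A (?d b) (\<lambda>a c. \<theta> a (S t) \<otimes>\<^bsub>A\<^esub> \<theta> c (S s))"
    if "b \<in> carrier C" "t \<in> carrier T" "s \<in> carrier T" for b t s
  proof -
    have b: "b \<in> U" using that(1) by simp
    have "\<theta> b (S (t \<otimes>\<^bsub>T\<^esub> s)) = tsum A (\<Delta> b) (\<lambda>a c. \<theta> a (S s) \<otimes>\<^bsub>A\<^esub> \<theta> c (S t))"
      unfolding antipode_mult[OF bialgebra_T S that(2,3)]
      by (rule comult_props(3)[OF b Sc[OF that(3)] Sc[OF that(2)]])
    also have "\<dots> = tsum A (\<Delta> b) (\<lambda>a c. \<theta> c (S t) \<otimes>\<^bsub>A\<^esub> \<theta> a (S s))"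
    proof (rule tsum_cong)
      fix a c assume "(a, c) \<in> set (\<Delta> b)"
      then have "a \<in> U" "c \<in> U" using comult_in_U b by blast+
      then show "\<theta> a (S s) \<otimes>\<^bsub>A\<^esub> \<theta> c (S t) = \<theta> c (S t) \<otimes>\<^bsub>A\<^esub> \<theta> a (S s)"
        using U_props(6) Sc that by (simp add: A.m_comm)
    qed
    finally show ?thesis by (simp only: tsum_map)
  qed
  have c5: "set (?d b) \<subseteq> carrier C \<times> carrier C" if "b \<in> carrier C" for b
    using comult_props(1)[of b] that by auto
  have c6: "(r \<otimes>\<^bsub>?Rop\<^esub> s) b = tsum K (?d b) (\<lambda>a c. r a \<otimes> s c)"
    if "b \<in> carrier C" "r \<in> carrier ?Rop" "s \<in> carrier ?Rop" for b r s
  proof -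
    have b: "b \<in> U" using that(1) by simp
    have "(r \<otimes>\<^bsub>?Rop\<^esub> s) b = tsum K (\<Delta> b) (\<lambda>a c. s a \<otimes> r c)"
      using b by (simp add: conv_alg_simps(2))
    also have "\<dots> = tsum K (\<Delta> b) (\<lambda>a c. r c \<otimes> s a)"
    proof (rule tsum_cong)
      fix a c assume "(a, c) \<in> set (\<Delta> b)"
      then have "a \<in> carrier C" "c \<in> carrier C" using comult_in_U[OF _ b] by auto
      then show "s a \<otimes> r c = r c \<otimes> s a"
        using that(2,3) linear_mapD(1)[of K C "ground K"] by (simp add: conv_alg_simps(1) K.m_comm)
    qed
    finally show ?thesis by (simp only: tsum_map)
  qed
  have R1: "carrier ?Rop = carrier ?R" "\<one>\<^bsub>?Rop\<^esub> = \<one>\<^bsub>?R\<^esub>" by simp_all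
  show thesis
  proof (rule measuring_lift[where N = C and R = ?Rop and d = ?d and f = "\<lambda>b t. \<theta> b (S t)"])
    fix g
    assume gU: "\<And>n. n \<in> carrier C \<Longrightarrow> g n \<in> U"
      and split: "\<And>n u v. n \<in> carrier C \<Longrightarrow> g n (u @ v) = tsum K (?d n) (\<lambda>a b. g a u \<otimes> g b v)"
      and th: "\<And>n t. n \<in> carrier C \<Longrightarrow> t \<in> carrier T \<Longrightarrow> \<theta> (g n) t = \<theta> n (S t)"
      and Nil: "\<And>n. n \<in> carrier C \<Longrightarrow> g n [] = counit C n"
      and lin: "\<And>w. linear_map K C (ground K) (\<lambda>n. g n w)"
    have "linear_map K C C g"
      using linear_mapD(2,3)[OF lin] gU by (intro linear_mapI) auto
    moreover have "g b (u @ v) = tsum K (\<Delta> b) (\<lambda>a c. g c u \<otimes> g a v)" if "b \<in> U" for b u v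
      using split[of b u v] that by (simp only: tsum_map C_simps)
    ultimately show thesis using that th Nil by simp
  qed (fact coalgebra_C c1 c2 c3 c4 Rop R1 c5 c6)+
qed

text \<open>
  At a single letter the convolution of two maps is governed by the identity \<open>p(t1) q(t2) = \<epsilon>(t) 1\<close> in \<open>T\<close>,
  applied under \<open>\<theta>(b, _)\<close>.
\<close>

lemma letter_collapse:
  assumes b: "b \<in> U" and F: "\<And>a c. a \<in> U \<Longrightarrow> c \<in> U \<Longrightarrow> F a c \<in> U"
    and th: "\<And>a c t. a \<in> U \<Longrightarrow> c \<in> U \<Longrightarrow> t \<in> carrier T \<Longrightarrow>
      \<theta> (F a c) t = tsum A (comult T t) (\<lambda>t1 t2. \<theta> a (p t1) \<otimes>\<^bsub>A\<^esub> \<theta> c (q t2))"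
    and p: "\<And>t. t \<in> carrier T \<Longrightarrow> p t \<in> carrier T" and q: "\<And>t. t \<in> carrier T \<Longrightarrow> q t \<in> carrier T"
    and pq: "\<And>t. t \<in> carrier T \<Longrightarrow> tsum T (comult T t) (\<lambda>t1 t2. p t1 \<otimes>\<^bsub>T\<^esub> q t2) = counit T t \<odot>\<^bsub>T\<^esub> \<one>\<^bsub>T\<^esub>"
  shows "tsum K (\<Delta> b) (\<lambda>a c. F a c [l]) = b [] \<otimes> unit [l]"
proof (cases "l \<in> letters K A T")
  case True
  then obtain t \<phi> where l: "l = (t, \<phi>)" and t: "t \<in> carrier T" and \<phi>: "\<phi> \<in> forms K A" by blast
  note e = coalgebraD(5)[OF coalgebra_T t] and tm = comult_closed[OF coalgebra_T _ t]
  note cm = comult_in_U[OF _ b]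
  have cl: "\<theta> a (p t1) \<otimes>\<^bsub>A\<^esub> \<theta> c (q t2) \<in> carrier A"
    if "(t1, t2) \<in> set (comult T t)" "(a, c) \<in> set (\<Delta> b)" for t1 t2 a c
    using tm[OF that(1)] cm[OF that(2)] U_props(6) p q by auto
  have "tsum K (\<Delta> b) (\<lambda>a c. F a c [l]) =
      tsum K (\<Delta> b) (\<lambda>a c. \<phi> (tsum A (comult T t) (\<lambda>t1 t2. \<theta> a (p t1) \<otimes>\<^bsub>A\<^esub> \<theta> c (q t2))))"
    by (rule tsum_cong) (use U_props(4)[OF F t \<phi>] cm in \<open>simp add: l th t\<close>)
  also have "\<dots> = \<phi> (tsum A (\<Delta> b) (\<lambda>a c. tsum A (comult T t) (\<lambda>t1 t2. \<theta> a (p t1) \<otimes>\<^bsub>A\<^esub> \<theta> c (q t2))))"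
    by (rule linear_map_tsum[OF module_A module_ground form_linear[OF \<phi>], unfolded list_sum_ground, symmetric])
      (rule A.tsum_closed, rule cl)
  also have "tsum A (\<Delta> b) (\<lambda>a c. tsum A (comult T t) (\<lambda>t1 t2. \<theta> a (p t1) \<otimes>\<^bsub>A\<^esub> \<theta> c (q t2))) =
      tsum A (comult T t) (\<lambda>t1 t2. tsum A (\<Delta> b) (\<lambda>a c. \<theta> a (p t1) \<otimes>\<^bsub>A\<^esub> \<theta> c (q t2)))"
    by (rule A.tsum_swap) (rule cl)
  also have "\<dots> = tsum A (comult T t) (\<lambda>t1 t2. \<theta> b (p t1 \<otimes>\<^bsub>T\<^esub> q t2))"
    by (rule comult_cong[OF coalgebra_T t]) (simp add: comult_props(3)[OF b] p q)
  also have "\<dots> = \<theta> b (counit T t \<odot>\<^bsub>T\<^esub> \<one>\<^bsub>T\<^esub>)"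
    unfolding pq[OF t, symmetric]
    by (rule linear_map_tsum[OF module_T module_A U_props(3)[OF b], symmetric]) (use tm p q in auto)
  finally show ?thesis
    using b t e \<phi> by (simp add: l linear_mapD(3)[OF U_props(3)] U_props(1,4,5) word_one(1,3) form_simps K.m_ac)
next
  case False
  then have z: "y [l] = \<zero>" if "y \<in> U" for y using U_props(2)[OF that, of "[l]"] by simp
  have "tsum K (\<Delta> b) (\<lambda>a c. F a c [l]) = tsum K (\<Delta> b) (\<lambda>_ _. \<zero>)"
    by (rule tsum_cong) (use comult_in_U[OF _ b] F z in blast)
  then show ?thesis using z[OF word_one(1)] U_props(1)[OF b] by (simp add: K.tsum_zero)
qed

text \<open>
  The convolution \<open>g(b1) b2\<close> has, at a word \<open>l w\<close>, the value \<open>(g(b2) b3)(l) \<cdot> (g(b1) b4)(w)\<close>, because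
  \<open>g\<close> reverses the comultiplication. The inner pair collapses by the antipode law of \<open>T\<close>
  (\<open>letter_collapse\<close>), and the outer one by induction. For \<open>b1 g(b2)\<close> the value is \<open>(b1 g(b4))(l) \<cdot> (b2 g(b3))(w)\<close>, where
  the inner pair collapses by induction and the outer one by the antipode law.
\<close>

lemma antipode_B:
  assumes S: "antipode K T S"
  shows "\<exists>S'. antipode K B S'"
proof -
  note SD = antipodeD[OF S]
  note Sc = linear_mapD(1)[OF SD(1)]
  obtain g where gC: "linear_map K C C g"
    and split: "\<And>b u v. b \<in> U \<Longrightarrow> g b (u @ v) = tsum K (\<Delta> b) (\<lambda>a c. g c u \<otimes> g a v)"
    and th: "\<And>b t. b \<in> U \<Longrightarrow> t \<in> carrier T \<Longrightarrow> \<theta> (g b) t = \<theta> b (S t)"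
    and g_Nil: "\<And>b. b \<in> U \<Longrightarrow> g b [] = b []"
    using antipode_lift[OF S] by blast
  have gU: "b \<in> U \<Longrightarrow> g b \<in> U" for b using linear_mapD(1)[OF gC] by simp
  note m = word_prod(1) and uU = word_one(1)
  let ?L = "\<lambda>w a c. mul (g a) c w" and ?R = "\<lambda>w a c. mul a (g c) w"
  have bL: "bilinear K C C (ground K) (?L w)" for w
    by (intro bilinearI bilinearD(1)[OF bilinear_mul_eval] linear_map_comp[OF gC bilinearD(2)[OF bilinear_mul_eval]])
      (use gU in auto)
  have bR: "bilinear K C C (ground K) (?R w)" for w
    by (intro bilinearI bilinearD(2)[OF bilinear_mul_eval] linear_map_comp[OF gC bilinearD(1)[OF bilinear_mul_eval]])
      (use gU in auto)
  have cm: "a \<in> U" "c \<in> U" if "(a, c) \<in> set (\<Delta> b)" "b \<in> U" for a b c using comult_in_U that by blast+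
  have Lc: "?L w a c \<in> carrier K" and Rc: "?R w a c \<in> carrier K" if "a \<in> U" "c \<in> U" for w a c
    using that m gU U_props(1) by auto
  have comult_g: "tsum V (\<Delta> (g b)) F = tsum V (\<Delta> b) (\<lambda>a c. F (g c) (g a))"
    if b: "b \<in> U" and V: "module K V" "bilinear K C C V F" for b and V :: "('k, 'v, 'w) module_scheme" and F
  proof -
    have "tsum V (\<Delta> (g b)) F = tsum V (map (\<lambda>(a, c). (g c, g a)) (\<Delta> b)) F"
    proof (rule comult_tsum_eqI[OF gU[OF b] _ V(1) V(2)[unfolded word_coalg_def]])
      show "set (map (\<lambda>(a, c). (g c, g a)) (\<Delta> b)) \<subseteq> U \<times> U" using cm[OF _ b] gU by auto
    qed (simp only: tsum_map split[OF b])
    then show ?thesis by (simp only: tsum_map)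
  qed
  have letter: "tsum K (\<Delta> b) (?L [l]) = b [] \<otimes> unit [l] \<and> tsum K (\<Delta> b) (?R [l]) = b [] \<otimes> unit [l]"
    if b: "b \<in> U" for b l
  proof
    show "tsum K (\<Delta> b) (?L [l]) = b [] \<otimes> unit [l]"
    proof (rule letter_collapse[OF b, where p = S and q = "\<lambda>t. t"])
      fix a c t assume ac: "a \<in> U" "c \<in> U" and t: "t \<in> carrier T"
      show "\<theta> (mul (g a) c) t = tsum A (comult T t) (\<lambda>t1 t2. \<theta> a (S t1) \<otimes>\<^bsub>A\<^esub> \<theta> c t2)"
        unfolding word_prod(3)[OF gU[OF ac(1)] ac(2) t]
        by (rule comult_cong[OF coalgebra_T t]) (simp add: th ac)
    qed (use m gU Sc SD(2) in auto)
    show "tsum K (\<Delta> b) (?R [l]) = b [] \<otimes> unit [l]"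
    proof (rule letter_collapse[OF b, where p = "\<lambda>t. t" and q = S])
      fix a c t assume ac: "a \<in> U" "c \<in> U" and t: "t \<in> carrier T"
      show "\<theta> (mul a (g c)) t = tsum A (comult T t) (\<lambda>t1 t2. \<theta> a t1 \<otimes>\<^bsub>A\<^esub> \<theta> c (S t2))"
        unfolding word_prod(3)[OF ac(1) gU[OF ac(2)] t]
        by (rule comult_cong[OF coalgebra_T t]) (simp add: th ac)
    qed (use m gU Sc SD(3) in auto)
  qed
  have word: "tsum K (\<Delta> b) (?L w) = b [] \<otimes> unit w \<and> tsum K (\<Delta> b) (?R w) = b [] \<otimes> unit w"
    if "b \<in> U" for b w
    using that
  proof (induction w arbitrary: b)
    case Nil
    have "tsum K (\<Delta> b) (?L []) = tsum K (\<Delta> b) (\<lambda>a c. a [] \<otimes> c [])" "tsum K (\<Delta> b) (?R []) = tsum K (\<Delta> b) (\<lambda>a c. a [] \<otimes> c [])"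
      by (rule tsum_cong, use cm[OF _ Nil] gU in \<open>simp add: word_prod(4) g_Nil\<close>)+
    then show ?case using comult_props(2)[OF Nil, of "[]" "[]", symmetric] U_props(1)[OF Nil] by (simp add: word_one(4))
  next
    case (Cons l w)
    note b = Cons.prems
    have u: "unit (l # w) = unit [l] \<otimes> unit w" using word_one(2)[of "[l]" w] by simp
    note uK = U_props(1)[OF uU] and bK = U_props(1)[OF b]
    have "tsum K (\<Delta> b) (?L (l # w)) = tsum K (\<Delta> b) (\<lambda>a c. tsum K (\<Delta> a) (\<lambda>a1 a2. tsum K (\<Delta> c)
        (\<lambda>c1 c2. ?L [l] a2 c1 \<otimes> ?L w a1 c2)))"
    proof (rule tsum_cong)
      fix a c assume "(a, c) \<in> set (\<Delta> b)"
      then have ac: "a \<in> U" "c \<in> U" using cm b by blast+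
      have "mul (g a) c ([l] @ w) = tsum (ground K) (\<Delta> (g a)) (\<lambda>p q. tsum (ground K) (\<Delta> c)
          (\<lambda>c1 c2. mul p c1 [l] \<otimes>\<^bsub>ground K\<^esub> mul q c2 w))"
        unfolding word_prod(2)[OF gU[OF ac(1)] ac(2)] by simp
      also have "\<dots> = tsum (ground K) (\<Delta> a) (\<lambda>a1 a2. tsum (ground K) (\<Delta> c)
          (\<lambda>c1 c2. mul (g a2) c1 [l] \<otimes>\<^bsub>ground K\<^esub> mul (g a1) c2 w))"
        by (rule comult_g[OF ac(1) module_ground bilinear_mul_splits[OF comult_props(1)[OF ac(2)]]])
      finally show "?L (l # w) a c = tsum K (\<Delta> a) (\<lambda>a1 a2. tsum K (\<Delta> c) (\<lambda>c1 c2. ?L [l] a2 c1 \<otimes> ?L w a1 c2))"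
        by simp
    qed
    also have "\<dots> = unit [l] \<otimes> tsum K (\<Delta> b) (?L w)"
      using collapse_middle[OF coalgebra_C bL[of w] bL[of "[l]"], of "unit [l]" b] letter uK b by simp
    finally have 1: "tsum K (\<Delta> b) (?L (l # w)) = b [] \<otimes> unit (l # w)"
      using Cons.IH[OF b] uK bK by (simp add: u K.m_ac)
    have "tsum K (\<Delta> b) (?R (l # w)) = tsum K (\<Delta> b) (\<lambda>a c. tsum K (\<Delta> a) (\<lambda>a1 a2. tsum K (\<Delta> c)
        (\<lambda>c1 c2. ?R w a2 c1 \<otimes> ?R [l] a1 c2)))"
    proof (rule tsum_cong)
      fix a c assume "(a, c) \<in> set (\<Delta> b)"
      then have ac: "a \<in> U" "c \<in> U" using cm b by blast+
      have "mul a (g c) ([l] @ w) = tsum (ground K) (\<Delta> a) (\<lambda>a1 a2. tsum (ground K) (\<Delta> (g c))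
          (\<lambda>p q. mul a1 p [l] \<otimes>\<^bsub>ground K\<^esub> mul a2 q w))"
        unfolding word_prod(2)[OF ac(1) gU[OF ac(2)]] by simp
      also have "\<dots> = tsum (ground K) (\<Delta> a) (\<lambda>a1 a2. tsum (ground K) (\<Delta> c)
          (\<lambda>c1 c2. mul a1 (g c2) [l] \<otimes>\<^bsub>ground K\<^esub> mul a2 (g c1) w))"
        by (intro tsum_cong comult_g[OF ac(2) module_ground] bilinear_mult[OF k_algebra_ground] bilinearD(1)[OF bilinear_mul_eval])
          (use cm[OF _ ac(1)] in auto)
      also have "\<dots> = tsum (ground K) (\<Delta> a) (\<lambda>a1 a2. tsum (ground K) (\<Delta> c)
          (\<lambda>c1 c2. ?R w a2 c1 \<otimes>\<^bsub>ground K\<^esub> ?R [l] a1 c2))"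
      proof (intro tsum_cong)
        fix a1 a2 c1 c2 assume "(a1, a2) \<in> set (\<Delta> a)" "(c1, c2) \<in> set (\<Delta> c)"
        then have "a1 \<in> U" "a2 \<in> U" "c1 \<in> U" "c2 \<in> U" using cm ac by blast+
        then show "mul a1 (g c2) [l] \<otimes>\<^bsub>ground K\<^esub> mul a2 (g c1) w = ?R w a2 c1 \<otimes>\<^bsub>ground K\<^esub> ?R [l] a1 c2"
          using Rc by (simp add: K.m_comm)
      qed
      finally show "?R (l # w) a c = tsum K (\<Delta> a) (\<lambda>a1 a2. tsum K (\<Delta> c) (\<lambda>c1 c2. ?R w a2 c1 \<otimes> ?R [l] a1 c2))"
        by simp
    qed
    also have "\<dots> = unit w \<otimes> tsum K (\<Delta> b) (?R [l])"
      using collapse_middle[OF coalgebra_C bR[of "[l]"] bR[of w], of "unit w" b] Cons.IH uK b by simp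
    finally have 2: "tsum K (\<Delta> b) (?R (l # w)) = b [] \<otimes> unit (l # w)"
      using letter[OF b] uK bK by (simp add: u K.m_ac)
    show ?case using 1 2 by simp
  qed
  have "antipode K B g"
    unfolding antipode_def
  proof (intro conjI ballI)
    show "linear_map K B B g" using gC by (simp add: linear_map_def)
    fix b assume "b \<in> carrier B"
    then have b: "b \<in> U" by simp
    have "tsum B (\<Delta> b) (\<lambda>a c. mul (g a) c) w = (b [] \<odot>\<^bsub>B\<^esub> unit) w" "tsum B (\<Delta> b) (\<lambda>a c. mul a (g c)) w = (b [] \<odot>\<^bsub>B\<^esub> unit) w" for w
      unfolding word_bialg_def
      by (subst U_sum_apply, use cm[OF _ b] m gU word[OF b, of w] in auto)+
    then show "tsum B (comult B b) (\<lambda>a c. g a \<otimes>\<^bsub>B\<^esub> c) = counit B b \<odot>\<^bsub>B\<^esub> \<one>\<^bsub>B\<^esub>"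
      "tsum B (comult B b) (\<lambda>a c. a \<otimes>\<^bsub>B\<^esub> g c) = counit B b \<odot>\<^bsub>B\<^esub> \<one>\<^bsub>B\<^esub>"
      by auto
  qed
  then show ?thesis by blast
qed

end

section \<open>The chosen universal bimeasuring\<close>

lemma universal_bimeasuringD:
  assumes "universal_bimeasuring TYPE('n) K A T B \<theta>"
  shows "bialgebra K B" "bimeasuring K B T A \<theta>"
    and "bialgebra K (N :: ('k, 'n) bialg) \<Longrightarrow> bimeasuring K N T A f \<Longrightarrow>
      \<exists>!g. g \<in> Bialg K N B \<and> (\<forall>n\<in>carrier N. \<forall>t\<in>carrier T. f n t = \<theta> (g n) t)"
  using assms by (simp_all add: universal_bimeasuring_def)

text \<open>
  The algebra map \<open>v\<close> carries the antipode laws of \<open>X\<close> at \<open>u y\<close> over to \<open>Y\<close>, and the coalgebra map \<open>u\<close>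
  matches the Sweedler components.
\<close>

lemma antipode_transport:
  fixes Y (structure)
  assumes X: "bialgebra K X" and Y: "bialgebra K Y" and u: "u \<in> Bialg K Y X" and v: "v \<in> Bialg K X Y"
    and vu: "\<And>y. y \<in> carrier Y \<Longrightarrow> v (u y) = y" and S: "antipode K X S"
  shows "antipode K Y (\<lambda>y. v (S (u y)))"
proof -
  note XD = bialgebraD[OF X] and YD = bialgebraD[OF Y] and uD = BialgD[OF u] and vD = BialgD[OF v]
  note SD = antipodeD[OF S]
  interpret X: ring X by (rule XD(4))
  interpret Y: ring Y by (rule YD(4))
  note Sc = linear_mapD(1)[OF SD(1)]
  show ?thesis
    unfolding antipode_def
  proof (intro conjI ballI)
    show "linear_map K Y Y (\<lambda>y. v (S (u y)))"
      by (rule linear_map_comp[OF linear_map_comp[OF uD(2) SD(1)] vD(2)])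
    fix y assume y: "y \<in> carrier Y"
    have fin: "v (counit X (u y) \<odot>\<^bsub>X\<^esub> \<one>\<^bsub>X\<^esub>) = counit Y y \<odot> \<one>"
      using coalgebraD(5)[OF YD(2) y] by (simp add: uD(7)[OF y] linear_mapD(3)[OF vD(2)] vD(5))
    have pull: "tsum Y (comult Y y) (\<lambda>a b. v (F (u a) (u b))) = v (tsum X (comult X (u y)) F)"
      if F: "bilinear K X X X F" for F
    proof -
      have "tsum Y (comult Y y) (\<lambda>a b. v (F (u a) (u b))) = v (tsum X (comult Y y) (\<lambda>a b. F (u a) (u b)))"
        by (rule linear_map_tsum[OF XD(3) YD(3) vD(2), symmetric])
          (use comult_closed[OF YD(2) _ y] uD(1) bilinearD(3)[OF F] in blast)
      then show ?thesis using Bialg_comult[OF u X XD(3) F y] by simp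
    qed
    have "tsum Y (comult Y y) (\<lambda>a b. v (S (u a)) \<otimes> b) = tsum Y (comult Y y) (\<lambda>a b. v (S (u a) \<otimes>\<^bsub>X\<^esub> u b))"
      by (rule comult_cong[OF YD(2) y]) (simp add: vD(4) uD(1) Sc vu)
    also have "\<dots> = v (tsum X (comult X (u y)) (\<lambda>a b. S a \<otimes>\<^bsub>X\<^esub> b))"
      by (rule pull[OF bilinear_mult[OF XD(1) SD(1) linear_map_ident]])
    finally show "tsum Y (comult Y y) (\<lambda>a b. v (S (u a)) \<otimes> b) = counit Y y \<odot> \<one>"
      by (simp add: SD(2) uD(1) y fin)
    have "tsum Y (comult Y y) (\<lambda>a b. a \<otimes> v (S (u b))) = tsum Y (comult Y y) (\<lambda>a b. v (u a \<otimes>\<^bsub>X\<^esub> S (u b)))"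
      by (rule comult_cong[OF YD(2) y]) (simp add: vD(4) uD(1) Sc vu)
    also have "\<dots> = v (tsum X (comult X (u y)) (\<lambda>a b. a \<otimes>\<^bsub>X\<^esub> S b))"
      by (rule pull[OF bilinear_mult[OF XD(1) linear_map_ident SD(1)]])
    finally show "tsum Y (comult Y y) (\<lambda>a b. a \<otimes> v (S (u b))) = counit Y y \<odot> \<one>"
      by (simp add: SD(3) uD(1) y fin)
  qed
qed

context measuring_data
begin

lemma univ_pair_universal:
  "universal_bimeasuring TYPE(('k, 't, 'a) univ_carrier) K A T (univ_bialg K A T) (univ_theta K A T)"
proof -
  have "case univ_pair K A T of (B', \<psi>) \<Rightarrow> universal_bimeasuring TYPE(('k, 't, 'a) univ_carrier) K A T B' \<psi>"
    unfolding univ_pair_def by (rule someI[of _ "(B, \<theta>)"]) (simp add: universal_bimeasuring_B)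
  then show ?thesis by (simp add: univ_bialg_def univ_theta_def case_prod_unfold)
qed

lemmas bialgebra_univ = universal_bimeasuringD(1)[OF univ_pair_universal]
lemmas bimeasuring_univ = universal_bimeasuringD(2)[OF univ_pair_universal]

text \<open>
  Both pairs are carried by the same type and universal for it, so each maps to the other, and the
  composite on the chosen bialgebra is the identity by uniqueness.
\<close>

lemma univ_iso:
  obtains u v where "u \<in> Bialg K (univ_bialg K A T) B" "v \<in> Bialg K B (univ_bialg K A T)"
    and "\<And>b. b \<in> carrier (univ_bialg K A T) \<Longrightarrow> v (u b) = b"
    and "\<And>b t. b \<in> carrier (univ_bialg K A T) \<Longrightarrow> t \<in> carrier T \<Longrightarrow> \<theta> (u b) t = univ_theta K A T b t"
    and "\<And>b t. b \<in> U \<Longrightarrow> t \<in> carrier T \<Longrightarrow> univ_theta K A T (v b) t = \<theta> b t"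
proof -
  let ?B = "univ_bialg K A T" and ?th = "univ_theta K A T"
  note un = univ_pair_universal
  obtain u where u: "u \<in> Bialg K ?B B" "\<forall>b\<in>carrier ?B. \<forall>t\<in>carrier T. ?th b t = \<theta> (u b) t"
    using bimeasuring_Bialg[OF bialgebra_univ bimeasuring_univ] by blast
  obtain v where v: "v \<in> Bialg K B ?B" "\<forall>b\<in>carrier B. \<forall>t\<in>carrier T. \<theta> b t = ?th (v b) t"
    using universal_bimeasuringD(3)[OF un bialgebra_B bimeasuring_theta] by blast
  have "compose (carrier ?B) v u = (\<lambda>b\<in>carrier ?B. b)"
  proof (rule ex1E[OF universal_bimeasuringD(3)[OF un bialgebra_univ bimeasuring_univ]])
    fix g assume g: "\<forall>h. h \<in> Bialg K ?B ?B \<and> (\<forall>b\<in>carrier ?B. \<forall>t\<in>carrier T. ?th b t = ?th (h b) t) \<longrightarrow> h = g"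
    have "compose (carrier ?B) v u = g"
      using Bialg_compose[OF bialgebra_univ bialgebra_B bialgebra_univ u(1) v(1)] u v BialgD(1)[OF u(1)]
      by (intro g[rule_format]) (auto simp: compose_eq)
    moreover have "(\<lambda>b\<in>carrier ?B. b) = g"
      using Bialg_id[OF bialgebra_univ] by (intro g[rule_format]) auto
    ultimately show ?thesis by simp
  qed
  from fun_cong[OF this] have "v (u b) = b" if "b \<in> carrier ?B" for b
    using that compose_eq[OF that, of v u] by (metis restrict_apply')
  then show thesis using that u v by simp
qed

text \<open>
  The model \<open>B\<close> is universal for carriers in every type; universality is transported along the
  isomorphism with the chosen bialgebra.
\<close>

lemma univ_universal: "universal_bimeasuring TYPE('n) K A T (univ_bialg K A T) (univ_theta K A T)"
  unfolding universal_bimeasuring_def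
proof (intro conjI allI impI bialgebra_univ bimeasuring_univ)
  let ?B = "univ_bialg K A T" and ?th = "univ_theta K A T"
  fix N :: "('k, 'n) bialg" and f assume N: "bialgebra K N" and f: "bimeasuring K N T A f"
  obtain u v where u: "u \<in> Bialg K ?B B" and v: "v \<in> Bialg K B ?B"
    and vu: "\<And>b. b \<in> carrier ?B \<Longrightarrow> v (u b) = b"
    and thu: "\<And>b t. b \<in> carrier ?B \<Longrightarrow> t \<in> carrier T \<Longrightarrow> \<theta> (u b) t = ?th b t"
    and thv: "\<And>b t. b \<in> U \<Longrightarrow> t \<in> carrier T \<Longrightarrow> ?th (v b) t = \<theta> b t"
    using univ_iso by blast
  obtain g where g: "g \<in> Bialg K N B" "\<forall>n\<in>carrier N. \<forall>t\<in>carrier T. f n t = \<theta> (g n) t"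
    using bimeasuring_Bialg[OF N f] by blast
  show "\<exists>!g. g \<in> Bialg K N ?B \<and> (\<forall>n\<in>carrier N. \<forall>t\<in>carrier T. f n t = ?th (g n) t)"
  proof (rule ex_ex1I)
    show "\<exists>g. g \<in> Bialg K N ?B \<and> (\<forall>n\<in>carrier N. \<forall>t\<in>carrier T. f n t = ?th (g n) t)"
      using Bialg_compose[OF N bialgebra_B bialgebra_univ g(1) v] g(2) thv BialgD(1)[OF g(1)]
      by (intro exI[of _ "compose (carrier N) v g"]) (auto simp: compose_eq)
  next
    fix g h
    assume g: "g \<in> Bialg K N ?B \<and> (\<forall>n\<in>carrier N. \<forall>t\<in>carrier T. f n t = ?th (g n) t)"
      and h: "h \<in> Bialg K N ?B \<and> (\<forall>n\<in>carrier N. \<forall>t\<in>carrier T. f n t = ?th (h n) t)"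
    then have gB: "g \<in> Bialg K N ?B" and hB: "h \<in> Bialg K N ?B" by auto
    have eq: "compose (carrier N) u g = compose (carrier N) u h"
      by (rule Bialg_eqI[OF N Bialg_compose[OF N bialgebra_univ bialgebra_B gB u]
          Bialg_compose[OF N bialgebra_univ bialgebra_B hB u]])
        (use g h thu BialgD(1)[OF gB] BialgD(1)[OF hB] in \<open>simp add: compose_eq\<close>)
    show "g = h"
    proof (rule extensionalityI[OF BialgD(3)[OF gB] BialgD(3)[OF hB]])
      fix n assume n: "n \<in> carrier N"
      have "u (g n) = u (h n)" using fun_cong[OF eq, of n] n by (simp add: compose_eq)
      then show "g n = h n" using vu BialgD(1)[OF gB n] BialgD(1)[OF hB n] by metis
    qed
  qed
qed

lemma bimeasuring_lift:
  assumes "bialgebra K N" "bimeasuring K N T A f"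
  shows "bimeasuring_lift K A N T f \<in> Bialg K N (univ_bialg K A T)"
    and "n \<in> carrier N \<Longrightarrow> t \<in> carrier T \<Longrightarrow> univ_theta K A T (bimeasuring_lift K A N T f n) t = f n t"
proof -
  note l = theI'[OF universal_bimeasuringD(3)[OF univ_universal assms], folded bimeasuring_lift_def]
  show "bimeasuring_lift K A N T f \<in> Bialg K N (univ_bialg K A T)" by (rule conjunct1[OF l])
  show "n \<in> carrier N \<Longrightarrow> t \<in> carrier T \<Longrightarrow> univ_theta K A T (bimeasuring_lift K A N T f n) t = f n t"
    using conjunct2[OF l] by simp
qed

lemma univ_eqI:
  assumes N: "bialgebra K N" and g: "g \<in> Bialg K N (univ_bialg K A T)" and h: "h \<in> Bialg K N (univ_bialg K A T)"
    and eq: "\<And>n t. n \<in> carrier N \<Longrightarrow> t \<in> carrier T \<Longrightarrow> univ_theta K A T (g n) t = univ_theta K A T (h n) t"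
    and f: "bimeasuring K N T A (\<lambda>n t. univ_theta K A T (g n) t)"
  shows "g = h"
  using universal_bimeasuringD(3)[OF univ_universal N f] g h eq by (elim ex1E) metis

lemma hopf_univ:
  assumes "hopf_algebra K T"
  shows "hopf_algebra K (univ_bialg K A T)"
proof -
  obtain S where "antipode K T S" using assms by (auto simp: hopf_algebra_def)
  then obtain S' where S': "antipode K B S'" using antipode_B by blast
  obtain u v where u: "u \<in> Bialg K (univ_bialg K A T) B" and v: "v \<in> Bialg K B (univ_bialg K A T)"
    and vu: "\<And>b. b \<in> carrier (univ_bialg K A T) \<Longrightarrow> v (u b) = b"
    by (rule univ_iso) (rule that)
  from antipode_transport[OF bialgebra_B bialgebra_univ u v vu S'] show ?thesis
    using bialgebra_univ by (auto simp: hopf_algebra_def)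
qed

end

section \<open>Functoriality and self-adjointness\<close>

text \<open>
  The two pairs of bimeasuring axioms are exchanged with the two arguments; this symmetry is the
  reason for the self-adjunction.
\<close>

lemma bimeasuring_swap:
  "bimeasuring K N T A f \<Longrightarrow> bimeasuring K T N A (\<lambda>t n. f n t)"
  by (simp add: bimeasuring_def)

lemma bimeasuring_compose_right:
  assumes N: "bialgebra K N" and R: "bialgebra K R" and T: "bialgebra K T" and A: "k_algebra K A"
    and f: "bimeasuring K N T A f" and \<alpha>: "\<alpha> \<in> Bialg K R T"
  shows "bimeasuring K N R A (\<lambda>n r. f n (\<alpha> r))"
proof -
  note fD = bimeasuringD[OF f] and aD = BialgD[OF \<alpha>]
  show ?thesis
    unfolding bimeasuring_def
  proof (intro conjI ballI)
    fix n m r assume n: "n \<in> carrier N" and m: "m \<in> carrier N" and r: "r \<in> carrier R"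
    show "f (n \<otimes>\<^bsub>N\<^esub> m) (\<alpha> r) = tsum A (comult R r) (\<lambda>a b. f n (\<alpha> a) \<otimes>\<^bsub>A\<^esub> f m (\<alpha> b))"
      unfolding fD(3)[OF n m aD(1)[OF r]]
      by (rule Bialg_comult[OF \<alpha> T k_algebraD(1)[OF A] bilinear_mult[OF A fD(1)[OF n] fD(1)[OF m]] r])
  next
    fix n assume "n \<in> carrier N"
    then show "linear_map K R A (\<lambda>r. f n (\<alpha> r))" by (rule linear_map_comp[OF aD(2) fD(1)])
  qed (simp_all add: fD aD)
qed

lemma bimeasuring_compose_left:
  assumes "bialgebra K M" "bialgebra K N" "bialgebra K T" "k_algebra K A"
    and "bimeasuring K N T A f" "g \<in> Bialg K M N"
  shows "bimeasuring K M T A (\<lambda>m t. f (g m) t)"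
  using bimeasuring_swap[OF bimeasuring_compose_right[OF assms(3,1,2,4) bimeasuring_swap[OF assms(5)] assms(6)]] .

locale commutative_algebra =
  fixes K :: "'k ring" and A :: "('k, 'a) module"
  assumes field_K: "field K" and algebra_A: "algebra K A"
begin

abbreviation "\<B> T \<equiv> univ_bialg K A T"
abbreviation "\<tau> T \<equiv> univ_theta K A T"

lemma measuring_data: "bialgebra K T \<Longrightarrow> measuring_data K A T"
  by (simp add: measuring_data_def field_K algebra_A)

lemmas kA = algebra_k_algebra[OF algebra_A]
lemmas bialgebra_univ = measuring_data.bialgebra_univ[OF measuring_data]
lemmas bimeasuring_univ = measuring_data.bimeasuring_univ[OF measuring_data]
lemmas lift = measuring_data.bimeasuring_lift[OF measuring_data]

lemma univ_eqI:
  assumes T: "bialgebra K T" and N: "bialgebra K N" and g: "g \<in> Bialg K N (\<B> T)" and h: "h \<in> Bialg K N (\<B> T)"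
    and eq: "\<And>n t. n \<in> carrier N \<Longrightarrow> t \<in> carrier T \<Longrightarrow> \<tau> T (g n) t = \<tau> T (h n) t"
  shows "g = h"
  by (rule measuring_data.univ_eqI[OF measuring_data[OF T] N g h eq])
    (simp_all add: bimeasuring_compose_left[OF N bialgebra_univ[OF T] T kA bimeasuring_univ[OF T] g])

lemma univ_bialg_map:
  assumes R: "bialgebra K R" and T: "bialgebra K T" and \<alpha>: "\<alpha> \<in> Bialg K R T"
  shows "univ_bialg_map K A R T \<alpha> \<in> Bialg K (\<B> T) (\<B> R)"
    and "b \<in> carrier (\<B> T) \<Longrightarrow> r \<in> carrier R \<Longrightarrow> \<tau> R (univ_bialg_map K A R T \<alpha> b) r = \<tau> T b (\<alpha> r)"
  using lift[OF R bialgebra_univ[OF T] bimeasuring_compose_right[OF bialgebra_univ[OF T] R T kA bimeasuring_univ[OF T] \<alpha>]]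
  by (simp_all add: univ_bialg_map_def)

lemma univ_bialg_map_id:
  assumes T: "bialgebra K T"
  shows "univ_bialg_map K A T T (\<lambda>t\<in>carrier T. t) = (\<lambda>b\<in>carrier (\<B> T). b)"
  by (rule univ_eqI[OF T bialgebra_univ[OF T] univ_bialg_map(1)[OF T T Bialg_id[OF T]] Bialg_id[OF bialgebra_univ[OF T]]])
    (simp add: univ_bialg_map(2)[OF T T Bialg_id[OF T]])

lemma univ_bialg_map_compose:
  assumes Q: "bialgebra K Q" and R: "bialgebra K R" and T: "bialgebra K T"
    and \<beta>: "\<beta> \<in> Bialg K Q R" and \<alpha>: "\<alpha> \<in> Bialg K R T"
  shows "univ_bialg_map K A Q T (compose (carrier Q) \<alpha> \<beta>) =
    compose (carrier (\<B> T)) (univ_bialg_map K A Q R \<beta>) (univ_bialg_map K A R T \<alpha>)"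
proof -
  note \<alpha>\<beta> = Bialg_compose[OF Q R T \<beta> \<alpha>]
  note mQR = univ_bialg_map[OF Q R \<beta>] and mRT = univ_bialg_map[OF R T \<alpha>] and mQT = univ_bialg_map[OF Q T \<alpha>\<beta>]
  show ?thesis
    by (rule univ_eqI[OF Q bialgebra_univ[OF T] mQT(1)
        Bialg_compose[OF bialgebra_univ[OF T] bialgebra_univ[OF R] bialgebra_univ[OF Q] mRT(1) mQR(1)]])
      (simp add: mQT(2) mQR(2) mRT(2) compose_eq BialgD(1)[OF mRT(1)] BialgD(1)[OF \<beta>])
qed

lemma adjoint_transpose:
  assumes T: "bialgebra K T" and N: "bialgebra K N" and f: "f \<in> Bialg K T (\<B> N)"
  shows "adjoint_transpose K A T N f \<in> Bialg K N (\<B> T)"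
    and "n \<in> carrier N \<Longrightarrow> t \<in> carrier T \<Longrightarrow> \<tau> T (adjoint_transpose K A T N f n) t = \<tau> N (f t) n"
  using lift[OF T N bimeasuring_swap[OF bimeasuring_compose_left[OF T bialgebra_univ[OF N] N kA bimeasuring_univ[OF N] f]]]
  by (simp_all add: adjoint_transpose_def)

text \<open>
  Transposing twice exchanges the arguments of the bimeasuring twice.
\<close>

lemma adjoint_transpose_involutive:
  assumes T: "bialgebra K T" and N: "bialgebra K N" and f: "f \<in> Bialg K T (\<B> N)"
  shows "adjoint_transpose K A N T (adjoint_transpose K A T N f) = f"
  by (rule univ_eqI[OF N T adjoint_transpose(1)[OF N T adjoint_transpose(1)[OF T N f]] f])
    (simp add: adjoint_transpose(2)[OF N T adjoint_transpose(1)[OF T N f]] adjoint_transpose(2)[OF T N f])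

lemma adjoint_transpose_bij_betw:
  assumes T: "bialgebra K T" and N: "bialgebra K N"
  shows "bij_betw (adjoint_transpose K A T N) (Bialg K T (\<B> N)) (Bialg K N (\<B> T))"
  by (rule bij_betw_byWitness[where f' = "adjoint_transpose K A N T"])
    (auto simp: adjoint_transpose_involutive[OF T N] adjoint_transpose_involutive[OF N T]
      adjoint_transpose(1)[OF T N] adjoint_transpose(1)[OF N T])

text \<open>
  Both sides correspond to the bimeasuring \<open>(n, r) \<mapsto> \<theta>(f(\<alpha> r), n)\<close>.
\<close>

lemma adjoint_transpose_natural_source:
  assumes R: "bialgebra K R" and T: "bialgebra K T" and N: "bialgebra K N"
    and \<alpha>: "\<alpha> \<in> Bialg K R T" and f: "f \<in> Bialg K T (\<B> N)"
  shows "adjoint_transpose K A R N (compose (carrier R) f \<alpha>) =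
    compose (carrier N) (univ_bialg_map K A R T \<alpha>) (adjoint_transpose K A T N f)"
proof -
  note f\<alpha> = Bialg_compose[OF R T bialgebra_univ[OF N] \<alpha> f]
  note l = adjoint_transpose[OF R N f\<alpha>] and r = adjoint_transpose[OF T N f] and m = univ_bialg_map[OF R T \<alpha>]
  show ?thesis
    by (rule univ_eqI[OF R N l(1) Bialg_compose[OF N bialgebra_univ[OF T] bialgebra_univ[OF R] r(1) m(1)]])
      (simp add: l(2) m(2) r(2) compose_eq BialgD(1)[OF r(1)] BialgD(1)[OF \<alpha>])
qed

text \<open>
  Both sides correspond to the bimeasuring \<open>(p, t) \<mapsto> \<theta>(f t, \<beta> p)\<close>.
\<close>

lemma adjoint_transpose_natural_target:
  assumes T: "bialgebra K T" and P: "bialgebra K P" and N: "bialgebra K N"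
    and \<beta>: "\<beta> \<in> Bialg K P N" and f: "f \<in> Bialg K T (\<B> N)"
  shows "adjoint_transpose K A T P (compose (carrier T) (univ_bialg_map K A P N \<beta>) f) =
    compose (carrier P) (adjoint_transpose K A T N f) \<beta>"
proof -
  note m = univ_bialg_map[OF P N \<beta>]
  note mf = Bialg_compose[OF T bialgebra_univ[OF N] bialgebra_univ[OF P] f m(1)]
  note l = adjoint_transpose[OF T P mf] and r = adjoint_transpose[OF T N f]
  show ?thesis
    by (rule univ_eqI[OF T P l(1) Bialg_compose[OF P N bialgebra_univ[OF T] \<beta> r(1)]])
      (simp add: l(2) m(2) r(2) compose_eq BialgD(1)[OF f] BialgD(1)[OF \<beta>])
qed

lemma univ_bialg_map_Hopf:
  assumes "hopf_algebra K R" "hopf_algebra K T" "\<alpha> \<in> Hopf K R T"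
  shows "univ_bialg_map K A R T \<alpha> \<in> Hopf K (\<B> T) (\<B> R)"
proof -
  have R: "bialgebra K R" and T: "bialgebra K T" and \<alpha>: "\<alpha> \<in> Bialg K R T"
    using assms by (auto simp: hopf_algebra_def Hopf_def)
  note m = univ_bialg_map(1)[OF R T \<alpha>]
  show ?thesis
    using m Bialg_antipode[OF bialgebra_univ[OF T] bialgebra_univ[OF R] m] by (auto simp: Hopf_def)
qed

end

theorem theorem2p4:
  fixes K :: "'k ring" and A :: "('k, 'a) module"
  assumes "field K" and "algebra K A"
  shows
    "(\<forall>T :: ('k, 't) bialg. bialgebra K T \<longrightarrow>
        universal_bimeasuring TYPE('n) K A T (univ_bialg K A T) (univ_theta K A T))
   \<and> (\<forall>(R :: ('k, 'r) bialg) (T :: ('k, 't) bialg) \<alpha>.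
        bialgebra K R \<longrightarrow> bialgebra K T \<longrightarrow> \<alpha> \<in> Bialg K R T \<longrightarrow>
        univ_bialg_map K A R T \<alpha> \<in> Bialg K (univ_bialg K A T) (univ_bialg K A R) \<and>
        (\<forall>b\<in>carrier (univ_bialg K A T). \<forall>r\<in>carrier R.
          univ_theta K A R (univ_bialg_map K A R T \<alpha> b) r = univ_theta K A T b (\<alpha> r)))
   \<and> (\<forall>T :: ('k, 't) bialg. bialgebra K T \<longrightarrow>
        univ_bialg_map K A T T (\<lambda>t\<in>carrier T. t) = (\<lambda>b\<in>carrier (univ_bialg K A T). b))
   \<and> (\<forall>(Q :: ('k, 'q) bialg) (R :: ('k, 'r) bialg) (T :: ('k, 't) bialg) \<alpha> \<beta>.
        bialgebra K Q \<longrightarrow> bialgebra K R \<longrightarrow> bialgebra K T \<longrightarrow>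
        \<beta> \<in> Bialg K Q R \<longrightarrow> \<alpha> \<in> Bialg K R T \<longrightarrow>
        univ_bialg_map K A Q T (compose (carrier Q) \<alpha> \<beta>) =
          compose (carrier (univ_bialg K A T)) (univ_bialg_map K A Q R \<beta>) (univ_bialg_map K A R T \<alpha>))
   \<and> (\<forall>(T :: ('k, 't) bialg) (N :: ('k, 'n) bialg). bialgebra K T \<longrightarrow> bialgebra K N \<longrightarrow>
        bij_betw (adjoint_transpose K A T N)
          (Bialg K T (univ_bialg K A N)) (Bialg K N (univ_bialg K A T)))
   \<and> (\<forall>(R :: ('k, 'r) bialg) (T :: ('k, 't) bialg) (N :: ('k, 'n) bialg) \<alpha> f.
        bialgebra K R \<longrightarrow> bialgebra K T \<longrightarrow> bialgebra K N \<longrightarrow>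
        \<alpha> \<in> Bialg K R T \<longrightarrow> f \<in> Bialg K T (univ_bialg K A N) \<longrightarrow>
        adjoint_transpose K A R N (compose (carrier R) f \<alpha>) =
          compose (carrier N) (univ_bialg_map K A R T \<alpha>) (adjoint_transpose K A T N f))
   \<and> (\<forall>(T :: ('k, 't) bialg) (P :: ('k, 'p) bialg) (N :: ('k, 'n) bialg) \<beta> f.
        bialgebra K T \<longrightarrow> bialgebra K P \<longrightarrow> bialgebra K N \<longrightarrow>
        \<beta> \<in> Bialg K P N \<longrightarrow> f \<in> Bialg K T (univ_bialg K A N) \<longrightarrow>
        adjoint_transpose K A T P (compose (carrier T) (univ_bialg_map K A P N \<beta>) f) =
          compose (carrier P) (adjoint_transpose K A T N f) \<beta>)
   \<and> (\<forall>T :: ('k, 't) bialg. hopf_algebra K T \<longrightarrow> hopf_algebra K (univ_bialg K A T))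
   \<and> (\<forall>(R :: ('k, 'r) bialg) (T :: ('k, 't) bialg) \<alpha>.
        hopf_algebra K R \<longrightarrow> hopf_algebra K T \<longrightarrow> \<alpha> \<in> Hopf K R T \<longrightarrow>
        univ_bialg_map K A R T \<alpha> \<in> Hopf K (univ_bialg K A T) (univ_bialg K A R))"
proof -
  interpret commutative_algebra K A by (rule commutative_algebra.intro[OF assms])
  show ?thesis
  proof (intro conjI allI impI ballI)
    fix T :: "('k, 't) bialg" assume "hopf_algebra K T"
    then show "hopf_algebra K (univ_bialg K A T)"
      by (intro measuring_data.hopf_univ[OF measuring_data]) (auto simp: hopf_algebra_def)
  qed (fact measuring_data.univ_universal[OF measuring_data] univ_bialg_map univ_bialg_map_id univ_bialg_map_compose
      adjoint_transpose_bij_betw adjoint_transpose_natural_source adjoint_transpose_natural_target univ_bialg_map_Hopf)+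
qed

end
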